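(* Let $m\ge 1$ and let $n=2r>2$ be even with $m\le n$, and let $q$ be generic (not a root of unity). For every positive integer $a$, the minimal irreducible $U_q[osp(m|n)]$-module $V(\lambda_a)$ with highest weight $\lambda_a=a\,\delta_1=(\dot 0|a,\dot 0)$ is affinizable to the twisted quantum affine superalgebra $U_q[gl(m|n)^{(2)}]$; that is, the action of $U_q[osp(m|n)]$ on $V(\lambda_a)$ extends to an (irreducible) representation of $U_q[gl(m|n)^{(2)}]$ on the same space $V(\lambda_a)$.
   Context: Everything is $\mathbf Z_2$-graded over $\mathbf C$; $[A,B]=AB-(-1)^{[A][B]}BA$ is the graded commutator. Let $n=2r$, $h=\lfloor m/2\rfloor$, $s=h+r$. Weights of $osp(m|n)$ are written in the basis $\epsilon_1,\dots,\epsilon_h$ (for $o(m)$) and $\delta_1,\dots,\delta_r$ (for $sp(n)$), with invariant form $(\epsilon_i,\epsilon_j)=\delta_{ij}$, $(\delta_\mu,\delta_\nu)=-\delta_{\mu\nu}$, $(\epsilon_i,\delta_\mu)=0$. The weight $(x_1,\dots,x_h|y_1,\dots,y_r)$ means $\sum x_i\epsilon_i+\sum y_\mu\delta_\mu$; $\dot 0$ denotes a string of zeros. Simple roots of $osp(m|n)$: the even roots $\epsilon_i-\epsilon_{i+1}$ ($1\le i<h$); $\alpha_h=\epsilon_h$ if $m=2h+1$ with $h\ge1$, $\alpha_h=\epsilon_{h-1}+\epsilon_h$ if $m=2h$ with $h\ge 2$; the even roots $\alpha_{h+\mu}=\delta_\mu-\delta_{\mu+1}$ ($1\le\mu<r$);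 and the odd root $\alpha_s=\delta_r-\epsilon_1$ (with $\epsilon_1:=0$ if $m=1$). If $m=2$ the simple roots are $\delta_\mu-\delta_{\mu+1}$ ($1\le\mu<r$) and the two odd roots $\delta_r\mp\epsilon_1$. Put $\theta=\delta_1+\delta_2$ and adjoin the even affine simple root $\alpha_0$, which on finite-dimensional modules (central charge $0$) is $\alpha_0=-\theta$ (as an affine root $\alpha_0=-\theta+\frac12\delta$, with $\frac12\delta$ the minimal positive imaginary root). Here $osp(m|n)$ is the fixed-point subalgebra of an order-two automorphism of $gl(m|n)$, and $\theta$ is the highest weight of the $(-1)$-eigenspace modulo the first-order invariant of $gl(m|n)$. $U_q[gl(m|n)^{(2)}]$ is generated by $e_i,f_i,q^{\pm h_i/2}$, $0\le i\le s$ ($e_i,f_i$ having the parity of $\alpha_i$), with commuting $h_i$ and $[h_i,e_j]=(\alpha_i,\alpha_j)e_j$, $[h_i,f_j]=-(\alpha_i,\alpha_j)f_j$, $[e_i,f_j]=\delta_{ij}\dfrac{q^{h_i}-q^{-h_i}}{q-q^{-1}}$, and the $q$-Serre relations: for $i\ne j$ and $(\alpha_i,\alpha_i)\neq0$, $(\mathrm{ad}_{q_i}e_i)^{1-a_{ij}}e_j=0=(\mathrm{ad}_{q_i}f_i)^{1-a_{ij}}f_j$ with $a_{ij}=2(\alpha_i,\alpha_j)/(\alpha_i,\alpha_i)$, $q_i=q^{(\alpha_i,\alpha_i)/2}$; for isotropic odd $\alpha_i$, $e_i^2=f_i^2=0$ and $[e_i,e_j]=[f_i,f_j]=0$ if $(\alpha_i,\alpha_j)=0$.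 (Additional higher-order $q$-Serre relations are ignored here.) The generators with $1\le i\le s$ generate $U_q[osp(m|n)]$. $V(\lambda)$ denotes the irreducible $U_q[osp(m|n)]$-module with highest weight $\lambda$ (generated by a vector of weight $\lambda$ killed by $e_1,\dots,e_s$). An irreducible representation of $gl(m|n)$ is called minimal if it remains irreducible under $osp(m|n)$; the antisymmetric tensor representations, with $gl(m|n)$ highest weight $\Lambda_a=(\dot 1_a,\dot 0|\dot 0)$ for $a\le m$ and $(\dot 1|a-m,\dot 0)$ for $a>m$, are minimal, with $osp(m|n)$-highest weight $\lambda_a=(\dot 0|a,\dot 0)$; $V(\lambda_a)$ is the corresponding $U_q[osp(m|n)]$-module. An irreducible $U_q[osp(m|n)]$-module is affinizable if its action extends to a representation of $U_q[gl(m|n)^{(2)}]$ on the same space, with $h_0$ acting on a weight-$\nu$ vector as $-(\theta,\nu)$. *)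

theory Defs
  imports Complex_Main "HOL-Library.Z2" "HOL-Library.Function_Algebras"
    "HOL-Library.Product_Plus"
begin

section \<open>Weights and simple roots\<close>

text \<open>
  The pair \<open>(x, y)\<close> stands for the integral weight
  $\sum_{i=1}^{h} x_i\epsilon_i + \sum_{\mu=1}^{r} y_\mu\delta_\mu$ with
  $h = \lfloor m/2\rfloor$ and $r = n/2$; entries outside these index ranges are never looked at.
  Roots and all weights of the modules below are integral.
\<close>

type_synonym weight = "(nat \<Rightarrow> int) \<times> (nat \<Rightarrow> int)"

definition eps :: "nat \<Rightarrow> weight" where
  "eps i = (\<lambda>k. if k = i then 1 else 0, \<lambda>_. 0)"

definition del :: "nat \<Rightarrow> weight" where
  "del \<mu> = (\<lambda>_. 0, \<lambda>k. if k = \<mu> then 1 else 0)"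

definition hh :: "nat \<Rightarrow> nat" where "hh m = m div 2"
definition rr :: "nat \<Rightarrow> nat" where "rr n = n div 2"
definition ss :: "nat \<Rightarrow> nat \<Rightarrow> nat" where "ss m n = hh m + rr n"

definition ip :: "nat \<Rightarrow> nat \<Rightarrow> weight \<Rightarrow> weight \<Rightarrow> int" where
  "ip m n a b = (\<Sum>i = 1..hh m. fst a i * fst b i) - (\<Sum>\<mu> = 1..rr n. snd a \<mu> * snd b \<mu>)"

definition theta :: weight where
  "theta = del 1 + del 2"

text \<open>
  Index \<open>0\<close> is the affine root \<open>- theta\<close> (the imaginary part is orthogonal to everything and
  dropped).  For \<open>m = 2\<close> the two odd roots are numbered \<open>1\<close> (for $\delta_r+\epsilon_1$) and
  \<open>s\<close> (for $\delta_r-\epsilon_1$).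
\<close>

definition sroot :: "nat \<Rightarrow> nat \<Rightarrow> nat \<Rightarrow> weight" where
  "sroot m n i =
     (if i = 0 then - theta
      else if i < hh m then eps i - eps (i + 1)
      else if i = hh m then
        (if odd m then eps (hh m)
         else if m = 2 then del (rr n) + eps 1
         else eps (hh m - 1) + eps (hh m))
      else if i < ss m n then del (i - hh m) - del (i - hh m + 1)
      else del (rr n) - (if m = 1 then 0 else eps 1))"

definition sroot_parity :: "nat \<Rightarrow> nat \<Rightarrow> nat \<Rightarrow> bit" where
  "sroot_parity m n i = (if i = ss m n \<or> (m = 2 \<and> i = 1) then 1 else 0)"

definition rootip :: "nat \<Rightarrow> nat \<Rightarrow> nat \<Rightarrow> nat \<Rightarrow> int" where
  "rootip m n i j = ip m n (sroot m n i) (sroot m n j)"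

text \<open>Only used for \<open>rootip m n i i \<noteq> 0\<close>; the division is then exact.\<close>

definition cartan :: "nat \<Rightarrow> nat \<Rightarrow> nat \<Rightarrow> nat \<Rightarrow> int" where
  "cartan m n i j = 2 * rootip m n i j div rootip m n i i"

definition lam :: "nat \<Rightarrow> weight" where
  "lam a = (\<lambda>_. 0, \<lambda>\<mu>. if \<mu> = 1 then int a else 0)"


section \<open>Graded vector spaces and operators\<close>

text \<open>
  The underlying space is the whole type \<open>'v\<close>, with scalar multiplication \<open>sc\<close>;
  \<open>G 0\<close> and \<open>G 1\<close> are its even and odd parts.
\<close>

definition z2_graded :: "(complex \<Rightarrow> 'v::ab_group_add \<Rightarrow> 'v) \<Rightarrow> (bit \<Rightarrow> 'v set) \<Rightarrow> bool" where
  "z2_graded sc G \<longleftrightarrow>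
     vector_space sc \<and> (\<forall>d. module.subspace sc (G d)) \<and> G 0 \<inter> G 1 = {0} \<and>
     (\<forall>v. \<exists>a\<in>G 0. \<exists>b\<in>G 1. v = a + b)"

definition graded_op ::
  "(complex \<Rightarrow> 'v::ab_group_add \<Rightarrow> 'v) \<Rightarrow> (bit \<Rightarrow> 'v set) \<Rightarrow> bit \<Rightarrow> ('v \<Rightarrow> 'v) \<Rightarrow> bool" where
  "graded_op sc G d A \<longleftrightarrow> Vector_Spaces.linear sc sc A \<and> (\<forall>c. A ` G c \<subseteq> G (c + d))"

definition parity_sign :: "bit \<Rightarrow> complex" where
  "parity_sign d = (if d = 0 then 1 else - 1)"

text \<open>
  \<open>qcomm sc a b t A B\<close> is $AB - (-1)^{ab}\,t\,BA$ for operators of parities \<open>a\<close>, \<open>b\<close>;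
  \<open>t = 1\<close> gives the graded commutator.
\<close>

definition qcomm ::
  "(complex \<Rightarrow> 'v::ab_group_add \<Rightarrow> 'v) \<Rightarrow> bit \<Rightarrow> bit \<Rightarrow> complex \<Rightarrow>
   ('v \<Rightarrow> 'v) \<Rightarrow> ('v \<Rightarrow> 'v) \<Rightarrow> 'v \<Rightarrow> 'v" where
  "qcomm sc a b t A B = (\<lambda>v. A (B v) - sc (parity_sign (a * b) * t) (B (A v)))"

text \<open>
  \<open>qad_pow sc a b t c A B N\<close> is $(\mathrm{ad}_t A)^N B$, where
  $(\mathrm{ad}_{q_i} e_i)\,x = e_i x - (-1)^{[e_i][x]} q^{(\alpha_i,\mathrm{wt}\,x)}\, x e_i$.
  After \<open>k\<close> steps, \<open>x\<close> has weight $\alpha_j + k\alpha_i$, so that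
  $q^{(\alpha_i,\mathrm{wt}\,x)} = q_i^{a_{ij}+2k}$.  For the $f$'s both weights change sign and
  the exponent is the same.
\<close>

primrec qad_pow ::
  "(complex \<Rightarrow> 'v::ab_group_add \<Rightarrow> 'v) \<Rightarrow> bit \<Rightarrow> bit \<Rightarrow> complex \<Rightarrow> int \<Rightarrow>
   ('v \<Rightarrow> 'v) \<Rightarrow> ('v \<Rightarrow> 'v) \<Rightarrow> nat \<Rightarrow> 'v \<Rightarrow> 'v" where
  "qad_pow sc a b t c A B 0 = B"
| "qad_pow sc a b t c A B (Suc k) =
     qcomm sc a (b + of_nat k * a) (t powi (c + 2 * int k)) A (qad_pow sc a b t c A B k)"


section \<open>Representations of the quantum superalgebras\<close>

text \<open>
  \<open>eop i\<close>, \<open>fop i\<close>, \<open>kop i\<close>, \<open>kinv i\<close> are the images of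
  $e_i$, $f_i$, $q^{h_i/2}$, $q^{-h_i/2}$.
\<close>

record 'v gens =
  eop :: "nat \<Rightarrow> 'v \<Rightarrow> 'v"
  fop :: "nat \<Rightarrow> 'v \<Rightarrow> 'v"
  kop :: "nat \<Rightarrow> 'v \<Rightarrow> 'v"
  kinv :: "nat \<Rightarrow> 'v \<Rightarrow> 'v"

text \<open>
  A graded representation of the superalgebra presented by the generators with index in \<open>I\<close>, i.e.
  operators satisfying the defining relations.  The parameter \<open>p\<close> is a square root of $q$, needed
  for $q^{\pm h_i/2}$ and for $q_i = q^{(\alpha_i,\alpha_i)/2}$.  The relations with $h_i$ are
  written in terms of the generators $q^{\pm h_i/2}$: for instance
  $[h_i,e_j] = (\alpha_i,\alpha_j)e_j$ becomes
  $q^{h_i/2}e_j = q^{(\alpha_i,\alpha_j)/2}e_jq^{h_i/2}$.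
\<close>

definition Uq_rep ::
  "nat \<Rightarrow> nat \<Rightarrow> complex \<Rightarrow> nat set \<Rightarrow>
   (complex \<Rightarrow> 'v::ab_group_add \<Rightarrow> 'v) \<Rightarrow> (bit \<Rightarrow> 'v set) \<Rightarrow> 'v gens \<Rightarrow> bool" where
  "Uq_rep m n p I sc G R \<longleftrightarrow>
     z2_graded sc G \<and>
     (\<forall>i\<in>I. graded_op sc G (sroot_parity m n i) (eop R i) \<and>
            graded_op sc G (sroot_parity m n i) (fop R i) \<and>
            graded_op sc G 0 (kop R i) \<and> graded_op sc G 0 (kinv R i)) \<and>
     (\<forall>i\<in>I. \<forall>v. kop R i (kinv R i v) = v \<and> kinv R i (kop R i v) = v) \<and>
     (\<forall>i\<in>I. \<forall>j\<in>I. \<forall>v. kop R i (kop R j v) = kop R j (kop R i v)) \<and>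
     (\<forall>i\<in>I. \<forall>j\<in>I. \<forall>v.
        kop R i (eop R j v) = sc (p powi rootip m n i j) (eop R j (kop R i v)) \<and>
        kop R i (fop R j v) = sc (p powi (- rootip m n i j)) (fop R j (kop R i v))) \<and>
     (\<forall>i\<in>I. \<forall>j\<in>I. \<forall>v.
        qcomm sc (sroot_parity m n i) (sroot_parity m n j) 1 (eop R i) (fop R j) v =
          (if i = j
           then sc (1 / (p\<^sup>2 - 1 / p\<^sup>2)) (kop R i (kop R i v) - kinv R i (kinv R i v))
           else 0)) \<and>
     (\<forall>i\<in>I. \<forall>j\<in>I. \<forall>X\<in>{eop R, fop R}. i \<noteq> j \<and> rootip m n i i \<noteq> 0 \<longrightarrow>
        (\<forall>v. qad_pow sc (sroot_parity m n i) (sroot_parity m n j)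
               (p powi rootip m n i i) (cartan m n i j)
               (X i) (X j) (nat (1 - cartan m n i j)) v = 0)) \<and>
     (\<forall>i\<in>I. \<forall>X\<in>{eop R, fop R}. sroot_parity m n i = 1 \<and> rootip m n i i = 0 \<longrightarrow>
        (\<forall>v. X i (X i v) = 0) \<and>
        (\<forall>j\<in>I. rootip m n i j = 0 \<longrightarrow>
           (\<forall>v. qcomm sc (sroot_parity m n i) (sroot_parity m n j) 1 (X i) (X j) v = 0)))"

definition osp_index :: "nat \<Rightarrow> nat \<Rightarrow> nat set" where
  "osp_index m n = {1..ss m n}"

definition aff_index :: "nat \<Rightarrow> nat \<Rightarrow> nat set" where
  "aff_index m n = {0..ss m n}"

abbreviation Uq_osp_rep where
  "Uq_osp_rep m n p \<equiv> Uq_rep m n p (osp_index m n)"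

abbreviation Uq_gl2_rep where
  "Uq_gl2_rep m n p \<equiv> Uq_rep m n p (aff_index m n)"

definition submodule ::
  "nat set \<Rightarrow> (complex \<Rightarrow> 'v::ab_group_add \<Rightarrow> 'v) \<Rightarrow> (bit \<Rightarrow> 'v set) \<Rightarrow> 'v gens \<Rightarrow> 'v set \<Rightarrow> bool"
where
  "submodule I sc G R W \<longleftrightarrow>
     module.subspace sc W \<and>
     (\<forall>a\<in>G 0. \<forall>b\<in>G 1. a + b \<in> W \<longrightarrow> a \<in> W \<and> b \<in> W) \<and>
     (\<forall>i\<in>I. \<forall>v\<in>W. eop R i v \<in> W \<and> fop R i v \<in> W \<and> kop R i v \<in> W \<and> kinv R i v \<in> W)"

definition irreducible_rep ::
  "nat set \<Rightarrow> (complex \<Rightarrow> 'v::ab_group_add \<Rightarrow> 'v) \<Rightarrow> (bit \<Rightarrow> 'v set) \<Rightarrow> 'v gens \<Rightarrow> bool" where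
  "irreducible_rep I sc G R \<longleftrightarrow>
     (\<exists>v::'v. v \<noteq> 0) \<and> (\<forall>W. submodule I sc G R W \<longrightarrow> W = {0} \<or> W = UNIV)"

definition has_weight ::
  "nat \<Rightarrow> nat \<Rightarrow> complex \<Rightarrow> (complex \<Rightarrow> 'v::ab_group_add \<Rightarrow> 'v) \<Rightarrow> 'v gens \<Rightarrow> weight \<Rightarrow> 'v \<Rightarrow> bool"
where
  "has_weight m n p sc R \<nu> v \<longleftrightarrow>
     (\<forall>i\<in>osp_index m n. kop R i v = sc (p powi ip m n (sroot m n i) \<nu>) v)"

text \<open>
  \<open>is_V m n p \<Lambda> sc G R\<close>: the space with the action \<open>R\<close> is (a realization of) $V(\Lambda)$.
\<close>

definition is_V ::
  "nat \<Rightarrow> nat \<Rightarrow> complex \<Rightarrow> weight \<Rightarrow>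
   (complex \<Rightarrow> 'v::ab_group_add \<Rightarrow> 'v) \<Rightarrow> (bit \<Rightarrow> 'v set) \<Rightarrow> 'v gens \<Rightarrow> bool" where
  "is_V m n p \<Lambda> sc G R \<longleftrightarrow>
     Uq_osp_rep m n p sc G R \<and>
     irreducible_rep (osp_index m n) sc G R \<and>
     (\<exists>v. v \<noteq> 0 \<and> has_weight m n p sc R \<Lambda> v \<and> (\<forall>i\<in>osp_index m n. eop R i v = 0) \<and>
          (\<forall>W. submodule (osp_index m n) sc G R W \<and> v \<in> W \<longrightarrow> W = UNIV))"

definition affinization ::
  "nat \<Rightarrow> nat \<Rightarrow> complex \<Rightarrow>
   (complex \<Rightarrow> 'v::ab_group_add \<Rightarrow> 'v) \<Rightarrow> (bit \<Rightarrow> 'v set) \<Rightarrow> 'v gens \<Rightarrow> 'v gens \<Rightarrow> bool" where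
  "affinization m n p sc G R S \<longleftrightarrow>
     Uq_gl2_rep m n p sc G S \<and>
     (\<forall>i\<in>osp_index m n.
        eop S i = eop R i \<and> fop S i = fop R i \<and> kop S i = kop R i \<and> kinv S i = kinv R i) \<and>
     (\<forall>\<nu> v. has_weight m n p sc R \<nu> v \<longrightarrow> kop S 0 v = sc (p powi (- ip m n theta \<nu>)) v)"

definition affinizable ::
  "nat \<Rightarrow> nat \<Rightarrow> complex \<Rightarrow>
   (complex \<Rightarrow> 'v::ab_group_add \<Rightarrow> 'v) \<Rightarrow> (bit \<Rightarrow> 'v set) \<Rightarrow> 'v gens \<Rightarrow> bool" where
  "affinizable m n p sc G R \<longleftrightarrow> (\<exists>S. affinization m n p sc G R S)"

end

theory Submission
  imports Defs
begin

text \<open>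
  Number the weights of the natural representation $\bf C^{m|n}$ by letters \<open>1, \<dots>, n + m\<close>, with highest
  weight $\delta_1$ first and lowest weight $-\delta_1$ last.  The tensor power of length \<open>a\<close> of the evaluation
  modules carries operators $E_i, F_i, K_i$ for all affine indices that satisfy the Chevalley relations, and
  the spectral parameters can be put into a $q$-string such that $E_0$ maps the highest word $x = 1^a$ to a
  multiple of a vector obtained from $x$ by $F_1, \dots, F_s$.  Since $E_0$ commutes with these operators, it
  preserves the cyclic module \<open>M\<close> generated by $x$.  As \<open>M\<close> also contains the lowest word
  $y \sim E_0^a F_{h+1}^a x$, the same argument from below shows that $F_0$ preserves \<open>M\<close>.

  The given module is the quotient of \<open>M\<close> by its radical.  The radical is described by vanishing
  of the $x$-coefficient under all products of raising operators, and equally by vanishing of the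
  $y$-coefficient under all products of lowering operators; $E_0$ commutes with the lowering and $F_0$ with the
  raising operators, so both preserve the radical and descend.

  A $q$-Serre element $u$ built from the $E_i$ commutes up to scalars with all $F_k$ and kills $y$.  So it
  kills the module generated by $y$ under $F_0$ and the $F_k$ with $k \neq h+1$.  That module contains
  $x$, hence $u$ kills \<open>M\<close>.
\<close>

section \<open>Cyclic submodules and q-Serre elements\<close>

text \<open>The \<epsilon>-letters and the letter of weight 0 are taken odd and the \<delta>-letters
  even: with this parity shift antisymmetric tensors become symmetric ones, so a \<delta>_1 is the
  weight of a constant word. On that word F_{h+1} and E_0 both excite one letter. With k letters to
  the right of it and i to the left, F_{h+1} gives the factor p^{-(k-i)} and E_0 the factor
  p^{(\<zeta>+1)(k-i)}; they agree for \<zeta> = -2.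

  The obstacle is that the given module is known only through irreducibility and a highest vector:
  neither finite dimension nor a weight decomposition is assumed, and M is not shown to be
  irreducible. Hence the detour through a relation between the two modules and through coefficients
  of words.

  Commutation alone does not make E_0 respect the kernel: the y-coefficient of E_0 t reads t at
  words N...2...N. In M these coefficients form a multiple of a fixed geometric sequence, and
  lowering with F_{h+1} pairs that sequence with itself. The resulting geometric sum is nonzero
  because p is not a root of unity, so the multiple has to vanish on the kernel. For F_0 and x the
  argument is the mirror image.\<close>

definition lin :: "(complex \<Rightarrow> 'w::ab_group_add \<Rightarrow> 'w) \<Rightarrow> ('w \<Rightarrow> 'w) \<Rightarrow> bool" where
  "lin sc A \<longleftrightarrow> (\<forall>x y. A (x + y) = A x + A y) \<and> (\<forall>c x. A (sc c x) = sc c (A x))"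

lemma lin_add: "lin sc A \<Longrightarrow> A (x + y) = A x + A y"
  and lin_scale: "lin sc A \<Longrightarrow> A (sc c x) = sc c (A x)"
  by (auto simp: lin_def)

lemma lin_0: "lin sc A \<Longrightarrow> A 0 = 0"
  by (metis add_cancel_right_right lin_add)

lemma lin_minus: "lin sc A \<Longrightarrow> A (- x) = - A x"
  by (metis add.inverse_unique add.right_inverse lin_0 lin_add)

lemma lin_diff: "lin sc A \<Longrightarrow> A (x - y) = A x - A y"
  by (metis diff_conv_add_uminus lin_add lin_minus)

lemma linear_imp_lin: "Vector_Spaces.linear sc sc A \<Longrightarrow> lin sc A"
  by (simp add: lin_def Vector_Spaces.linear.axioms module_hom.add module_hom.scale
      module_hom_eq_linear[symmetric] linear_iff_module_hom)

lemma lin_imp_linear: "vector_space sc \<Longrightarrow> lin sc A \<Longrightarrow> Vector_Spaces.linear sc sc A"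
  by (simp add: lin_def Vector_Spaces.linear_iff)

lemma parity_sign_add: "parity_sign (a + b) = parity_sign a * parity_sign b"
  by (cases "a = 0"; cases "b = 0") (auto simp: parity_sign_def)

lemma parity_sign_sq [simp]: "parity_sign a * parity_sign a = 1"
  by (auto simp: parity_sign_def)

lemma parity_sign_0 [simp]: "parity_sign 0 = 1"
  and parity_sign_1 [simp]: "parity_sign 1 = - 1"
  by (auto simp: parity_sign_def)

text \<open>Generated by one family of operators only, in practice all lowering or all raising ones.
  Closure under the opposite family is proved later, not built in.\<close>

inductive_set cyc :: "(complex \<Rightarrow> 'w::ab_group_add \<Rightarrow> 'w) \<Rightarrow> ('i \<Rightarrow> 'w \<Rightarrow> 'w) \<Rightarrow> 'i set \<Rightarrow> 'w \<Rightarrow> 'w set"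
  for sc A I w where
  cyc_base: "w \<in> cyc sc A I w"
| cyc_zero: "0 \<in> cyc sc A I w"
| cyc_add: "x \<in> cyc sc A I w \<Longrightarrow> y \<in> cyc sc A I w \<Longrightarrow> x + y \<in> cyc sc A I w"
| cyc_scale: "x \<in> cyc sc A I w \<Longrightarrow> sc c x \<in> cyc sc A I w"
| cyc_step: "x \<in> cyc sc A I w \<Longrightarrow> i \<in> I \<Longrightarrow> A i x \<in> cyc sc A I w"

text \<open>Commutation up to scalars reduces the claim to the generator. The scalars make this
  serve the K's as well as E_0 and F_0.\<close>

lemma cyc_closed_commuting:
  assumes X: "lin sc X" and w: "X w \<in> cyc sc A I w"
    and comm: "\<And>j u. j \<in> I \<Longrightarrow> X (A j u) = sc (c j) (A j (X u))"
    and u: "u \<in> cyc sc A I w"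
  shows "X u \<in> cyc sc A I w"
  using u
proof induction
  case (cyc_step x i)
  then show ?case by (simp add: comm cyc.cyc_scale cyc.cyc_step)
qed (use w X in \<open>auto simp: lin_add lin_scale lin_0 intro: cyc.intros\<close>)

lemma cyc_minimal:
  assumes w: "w' \<in> cyc sc A I w" and step: "\<And>j u. j \<in> I' \<Longrightarrow> u \<in> cyc sc A I w \<Longrightarrow> A' j u \<in> cyc sc A I w"
    and u: "u \<in> cyc sc A' I' w'"
  shows "u \<in> cyc sc A I w"
  using u by induction (auto intro: cyc.intros w step)

text \<open>The highest weight argument: e kills the generator, and moving e past one f j leaves
  only terms in the diagonal operators.\<close>

lemma cyc_closed_opposite:
  assumes e: "lin sc e" and w: "e w = 0"
    and KK: "\<And>u. u \<in> cyc sc f I w \<Longrightarrow> k u \<in> cyc sc f I w"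
    and KK': "\<And>u. u \<in> cyc sc f I w \<Longrightarrow> k' u \<in> cyc sc f I w"
    and comm: "\<And>j u. j \<in> I \<Longrightarrow> e (f j u) = sc (s j) (f j (e u)) + (sc (d j) (k (k u)) + sc (d' j) (k' (k' u)))"
    and u: "u \<in> cyc sc f I w"
  shows "e u \<in> cyc sc f I w"
  using u
proof induction
  case (cyc_step x i)
  then show ?case by (simp add: comm cyc.cyc_scale cyc.cyc_step cyc.cyc_add KK KK')
qed (use w e in \<open>auto simp: lin_add lin_scale lin_0 intro: cyc.intros\<close>)

lemma ps_mult_left: "parity_sign a * (parity_sign a * c) = c"
  by (simp add: mult.assoc[symmetric])

locale cspace = vector_space scale for scale :: "complex \<Rightarrow> 'w::ab_group_add \<Rightarrow> 'w"
begin

lemma qad_pow_lin: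
  assumes "lin scale A" "lin scale B"
  shows "lin scale (qad_pow scale a b t c A B k)"
  using assms by (induction k)
    (auto simp: qcomm_def lin_def scale_right_distrib scale_right_diff_distrib scale_left_commute algebra_simps)

lemma qad_pow_zero_at:
  assumes "lin scale A" "lin scale B" "A v = 0" "B v = 0"
  shows "qad_pow scale a b t c A B k v = 0"
  by (induction k) (simp_all add: qcomm_def assms lin_0[OF assms(1)] lin_0[OF qad_pow_lin[OF assms(1,2)]] del: mult_eq_0_iff)

lemma qad_pow_linear: 
  assumes "lin scale A" "lin scale B"
  shows "qad_pow scale a b t c A B k (x + y) = qad_pow scale a b t c A B k x + qad_pow scale a b t c A B k y"
    "qad_pow scale a b t c A B k (scale d x) = scale d (qad_pow scale a b t c A B k x)"
  using qad_pow_lin[OF assms] by (auto simp: lin_def)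

text \<open>For f at a node different from both nodes of the Serre element: it passes through either
  factor.\<close>

lemma qad_pow_comm_other:
  assumes lins: "lin scale A" "lin scale B" "lin scale f"
    and A: "\<And>v. A (f v) = scale s1 (f (A v))" and B: "\<And>v. B (f v) = scale s2 (f (B v))"
  shows "qad_pow scale a b t c A B k (f v) = scale (s1 ^ k * s2) (f (qad_pow scale a b t c A B k v))"
proof (induction k arbitrary: v)
  case (Suc k)
  note [simp] = lin_scale[OF lins(1)] lin_scale[OF lins(2)] lin_scale[OF lins(3)] lin_diff[OF lins(3)]
     qad_pow_linear[OF lins(1,2)]
  show ?case
    by (simp add: qcomm_def Suc A scale_right_diff_distrib mult_ac)
qed (simp add: B)

text \<open>Moving B past f leaves a k k term and a k' k' term. The first q-commutator with A
  cancels the k' k' term because t^c = y^2; every further one multiplies the k k term by one factor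
  of \<eta>. The factor of the last step is zero.\<close>

lemma qad_pow_comm_j:
  assumes lins: "lin scale A" "lin scale B" "lin scale f" "lin scale k" "lin scale k'"
    and A: "\<And>v. A (f v) = scale (parity_sign (a * b)) (f (A v))"
    and B: "\<And>v. B (f v) = scale (parity_sign b) (f (B v)) + scale d (k (k v) - k' (k' v))"
    and kA: "\<And>v. k (A v) = scale y (A (k v))" and k'A: "\<And>v. k' (A v) = scale (1 / y) (A (k' v))"
    and y: "y \<noteq> 0" and tc: "t powi c = y\<^sup>2" and t: "t \<noteq> 0"
    and N: "int (Suc N) = 1 - c" and par: "parity_sign (of_nat N * a) = 1"
  shows "qad_pow scale a b t c A B (Suc N) (f v)
     = scale (parity_sign (b + of_nat (Suc N) * a * b)) (f (qad_pow scale a b t c A B (Suc N) v))"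
proof -
  note lns[simp] = lin_scale[OF lins(1)] lin_scale[OF lins(2)] lin_scale[OF lins(3)] lin_scale[OF lins(4)] lin_scale[OF lins(5)]
    lin_diff[OF lins(1)] lin_diff[OF lins(3)] lin_add[OF lins(1)] lin_add[OF lins(3)] lin_diff[OF lins(4)] lin_diff[OF lins(5)]
     qad_pow_linear[OF lins(1,2)]
  define u where "u = qad_pow scale a b t c A B"
  define \<eta> where "\<eta> k = d * (1 / y\<^sup>2 - y\<^sup>2) * (\<Prod>i=1..k. 1 / y\<^sup>2 - parity_sign (of_nat i * a) * t powi (c + 2 * int i))" for k :: nat
  have u0: "u 0 v = B v" for v by (simp add: u_def)
  have uS: "u (Suc k) v = A (u k v) - scale (parity_sign (a * (b + of_nat k * a)) * t powi (c + 2 * int k)) (u k (A v))" for k v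
    by (simp add: u_def qcomm_def)
  have ulin: "u k (x + z) = u k x + u k z" "u k (scale e x) = scale e (u k x)" for k x z e
    by (simp_all add: u_def)
  have Ak: "A (k v) = scale (1 / y) (k (A v))" "A (k' v) = scale y (k' (A v))" for v
    using y by (simp_all add: kA k'A)
  have main: "u (Suc k') (f v) = scale (parity_sign (b + of_nat (Suc k') * a * b)) (f (u (Suc k') v)) + scale (\<eta> k') (k (k ((A ^^ Suc k') v)))" for k' v
  proof (induction k' arbitrary: v)
    case 0
    show ?case
      using tc by (simp add: uS u0 A B Ak \<eta>_def scale_right_diff_distrib scale_right_distrib parity_sign_add
          mult_ac ps_mult_left scale_left_diff_distrib power2_eq_square)
        (simp add: algebra_simps)
  next
    case (Suc k')
    have Afun: "(A ^^ k') (A v) = A ((A ^^ k') v)" for v by (metis funpow_swap1)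
    have ps: "parity_sign (a * (b + of_nat (Suc k') * a)) * parity_sign (a * b) = parity_sign (of_nat (Suc k') * a)"
      by (cases "a = 0"; cases "b = 0") (auto simp: parity_sign_def)
    have "u (Suc (Suc k')) (f v) = A (u (Suc k') (f v)) - scale (parity_sign (a * (b + of_nat (Suc k') * a)) * t powi (c + 2 * int (Suc k'))) (u (Suc k') (A (f v)))"
      by (rule uS)
    also have "\<dots> = scale (parity_sign (b + of_nat (Suc k') * a * b) * parity_sign (a * b)) (f (A (u (Suc k') v)))
         + scale (\<eta> k' * (1 / y\<^sup>2)) (k (k ((A ^^ Suc (Suc k')) v)))
      - scale (parity_sign (of_nat (Suc k') * a) * t powi (c + 2 * int (Suc k')))
          (scale (parity_sign (b + of_nat (Suc k') * a * b)) (f (u (Suc k') (A v))) + scale (\<eta> k') (k (k ((A ^^ Suc (Suc k')) v))))"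
      unfolding ps[symmetric]
      by (simp only: Suc A ulin lns Ak scale_scale scale_right_distrib funpow.simps Afun o_apply)
        (simp add: mult_ac power2_eq_square)
    also have "\<dots> = scale (parity_sign (b + of_nat (Suc (Suc k')) * a * b)) (f (u (Suc (Suc k')) v)) 
        + scale (\<eta> k' * (1 / y\<^sup>2 - parity_sign (of_nat (Suc k') * a) * t powi (c + 2 * int (Suc k')))) (k (k ((A ^^ Suc (Suc k')) v)))"
    proof -
      have p1: "parity_sign (b + of_nat (Suc k') * a * b) * parity_sign (a * b) = parity_sign (b + of_nat (Suc (Suc k')) * a * b)"
        by (cases "a = 0"; cases "b = 0") (auto simp: parity_sign_def)
      have p2: "parity_sign (b + of_nat (Suc (Suc k')) * a * b) * parity_sign (a * (b + of_nat (Suc k') * a)) =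
         parity_sign (of_nat (Suc k') * a) * parity_sign (b + of_nat (Suc k') * a * b)"
        by (cases "a = 0"; cases "b = 0") (auto simp: parity_sign_def)
      show ?thesis
        unfolding p1 uS[of "Suc k'"] lns scale_right_diff_distrib scale_scale mult.assoc[symmetric] p2 scale_right_distrib
        by (simp add: algebra_simps)
    qed
    also have "\<eta> k' * (1 / y\<^sup>2 - parity_sign (of_nat (Suc k') * a) * t powi (c + 2 * int (Suc k'))) = \<eta> (Suc k')"
      by (simp add: \<eta>_def mult_ac)
    finally show ?case .
  qed
  have "\<eta> N = 0"
  proof (cases N)
    case 0
    then have "c = 0" using N by simp
    then show ?thesis using 0 tc by (simp add: \<eta>_def)
  next
    case (Suc N')
    \<comment> \<open>The last factor is 1 / y^2 - t^{-c}, which vanishes by t^c = y^2.\<close>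
    have "c + 2 * int N = - c" using N by simp
    then have "1 / y\<^sup>2 - parity_sign (of_nat N * a) * t powi (c + 2 * int N) = 0"
      unfolding par by (simp only: power_int_minus tc) (simp add: divide_inverse)
    then show ?thesis unfolding \<eta>_def using Suc by auto
  qed
  then show ?thesis using main[of N v] by (simp add: u_def del: qad_pow.simps)
qed


text \<open>Now A itself does not commute with f, so every step creates new diagonal terms. The k k
  parts of one step cancel each other; the k' k' parts accumulate to \<zeta>, and the sum closes up
  to 0 at the length of the Serre element. The listed values of c are the Cartan entries met at the
  affine node.\<close>

lemma qad_pow_comm_i:
  assumes lins: "lin scale A" "lin scale B" "lin scale f" "lin scale k" "lin scale k'"
    and A: "\<And>v. A (f v) = scale (parity_sign a) (f (A v)) + scale d (k (k v) - k' (k' v))"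
    and B: "\<And>v. B (f v) = scale (parity_sign (a * b)) (f (B v))"
    and kA: "\<And>v. k (A v) = scale t (A (k v))" and k'A: "\<And>v. k' (A v) = scale (1 / t) (A (k' v))"
    and kB: "\<And>v. k (B v) = scale y (B (k v))" and k'B: "\<And>v. k' (B v) = scale (1 / y) (B (k' v))"
    and y: "y \<noteq> 0" and t: "t \<noteq> 0" and tc: "t powi c = y\<^sup>2"
    and N: "int (Suc N) = 1 - c"
    and cases: "c = 0 \<or> c = - 1 \<and> a = 0 \<or> c = - 2 \<and> a = 1 \<and> b = 0"
  shows "qad_pow scale a b t c A B (Suc N) (f v)
     = scale (parity_sign (a * (b + of_nat (Suc N) * a))) (f (qad_pow scale a b t c A B (Suc N) v))"
proof -
  note lns[simp] = lin_scale[OF lins(1)] lin_scale[OF lins(2)] lin_scale[OF lins(3)] lin_scale[OF lins(4)] lin_scale[OF lins(5)]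
    lin_diff[OF lins(1)] lin_diff[OF lins(3)] lin_add[OF lins(1)] lin_add[OF lins(3)] lin_diff[OF lins(4)] lin_diff[OF lins(5)]
     qad_pow_linear[OF lins(1,2)]
  define u where "u = qad_pow scale a b t c A B"
  define s where "s n = parity_sign (a * (b + of_nat n * a))" for n
  define \<tau> where "\<tau> n = t powi (c + 2 * int n)" for n
  define \<zeta> where "\<zeta> = rec_nat (s 0 * d * ((\<tau> 0)\<^sup>2 - 1)) (\<lambda>n z. s (Suc n) * d * ((\<tau> (Suc n))\<^sup>2 - 1) + t\<^sup>2 * z)"
  have \<zeta>0: "\<zeta> 0 = s 0 * d * ((\<tau> 0)\<^sup>2 - 1)" and \<zeta>S: "\<zeta> (Suc n) = s (Suc n) * d * ((\<tau> (Suc n))\<^sup>2 - 1) + t\<^sup>2 * \<zeta> n" for n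
    by (simp_all add: \<zeta>_def)
  have \<tau>S: "\<tau> (Suc n) = t\<^sup>2 * \<tau> n" for n
  proof -
    have "c + 2 * int (Suc n) = (c + 2 * int n) + 2" by simp
    then have "\<tau> (Suc n) = t powi ((c + 2 * int n) + 2)" unfolding \<tau>_def by (simp only:)
    also have "\<dots> = t powi (c + 2 * int n) * t powi 2" using t by (intro power_int_add) auto
    finally show ?thesis by (simp add: \<tau>_def)
  qed
  have \<tau>0: "\<tau> 0 = y\<^sup>2" by (simp add: \<tau>_def tc)
  have \<tau>nz: "\<tau> n \<noteq> 0" for n by (simp add: \<tau>_def t)
  have sS: "s (Suc n) = s n * parity_sign a" for n
    unfolding s_def by (cases "a = 0") (auto simp: parity_sign_add[symmetric] algebra_simps)
  have ss: "s n * s n = 1" for n by (simp add: s_def)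
  have ss': "s n * (s n * e) = e" for n e by (simp add: s_def ps_mult_left)
  have u0: "u 0 v = B v" for v by (simp add: u_def)
  have uS: "u (Suc n) v = A (u n v) - scale (s n * \<tau> n) (u n (A v))" for n v
    by (simp add: u_def qcomm_def s_def \<tau>_def)
  have ulin: "u k (x + z) = u k x + u k z" "u k (x - z) = u k x - u k z" "u k (scale e x) = scale e (u k x)" for k x z e
    using lin_diff[OF qad_pow_lin[OF lins(1,2)]] by (simp_all add: u_def)
  have kk: "k (k (u n v)) = scale (\<tau> n) (u n (k (k v)))" for n v
  proof (induction n arbitrary: v)
    case 0
    show ?case by (simp add: u0 kB \<tau>0 power2_eq_square)
  next
    case (Suc n)
    show ?case by (simp add: uS kA Suc \<tau>S scale_right_diff_distrib ulin power2_eq_square mult_ac)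
  qed
  have kk': "k' (k' (u n v)) = scale (1 / \<tau> n) (u n (k' (k' v)))" for n v
  proof (induction n arbitrary: v)
    case 0
    show ?case by (simp add: u0 k'B \<tau>0 power2_eq_square)
  next
    case (Suc n)
    show ?case by (simp add: uS k'A Suc \<tau>S scale_right_diff_distrib ulin power2_eq_square mult_ac)
  qed
  have ukk: "u n (k (k v)) = scale (1 / \<tau> n) (k (k (u n v)))" "u n (k' (k' v)) = scale (\<tau> n) (k' (k' (u n v)))" for n v
    using \<tau>nz[of n] by (simp_all add: kk kk')
  have Ak': "A (k' (k' v)) = scale (t\<^sup>2) (k' (k' (A v)))" for v
    using t by (simp add: k'A power2_eq_square)
  have ps_a: "parity_sign a * (parity_sign a * e) = e" for e by (rule ps_mult_left)
  have step: "A (scale (s n) (f (u n v)) + Z v) - scale (s n * \<tau> n) (u n (scale (parity_sign a) (f (A v)) + scale d (k (k v) - k' (k' v))))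
     = scale (s (Suc n)) (f (u (Suc n) v)) + scale (s n * d * ((\<tau> n)\<^sup>2 - 1)) (k' (k' (u n v)))
       + (A (Z v) - scale (s n * \<tau> n * parity_sign a) (Z (A v)))"
    if IH: "\<And>v. u n (f v) = scale (s n) (f (u n v)) + Z v" for n v Z
    unfolding ulin IH
    using \<tau>nz[of n]
    by (simp add: A ukk uS sS scale_right_diff_distrib scale_right_distrib scale_left_diff_distrib mult_ac ss' ps_a power2_eq_square)
      (simp add: scale_left_diff_distrib algebra_simps)
  have main: "u (Suc n) (f v) = scale (s (Suc n)) (f (u (Suc n) v)) + scale (\<zeta> n) (k' (k' (u n v)))" for n v
  proof (induction n arbitrary: v)
    case 0
    have IH: "u 0 (f v) = scale (s 0) (f (u 0 v)) + 0" for v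
      by (simp add: u0 B s_def)
    show ?case
      using step[of 0 "\<lambda>_. 0" v] IH unfolding uS[of 0 "f v"] IH A
      by (simp add: \<zeta>0 lin_0[OF lins(1)])
  next
    case (Suc n)
    have *: "A (scale (\<zeta> n) (k' (k' (u n v)))) - scale (s (Suc n) * \<tau> (Suc n) * parity_sign a) (scale (\<zeta> n) (k' (k' (u n (A v)))))
       = scale (t\<^sup>2 * \<zeta> n) (k' (k' (u (Suc n) v)))"
      by (simp add: Ak' uS sS \<tau>S scale_right_diff_distrib mult_ac ps_a)
    show ?case
      unfolding uS[of "Suc n" "f v"] Suc A step[of "Suc n" "\<lambda>v. scale (\<zeta> n) (k' (k' (u n v)))" v, OF Suc] *
      by (simp add: \<zeta>S scale_left_distrib add.assoc)
  qed
  \<comment> \<open>Up to the factor d: for c = -1 the sum is (t^2 - 1) + t^2 (t^{-2} - 1); for c =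
    -2 the middle term has \<tau> = 1, and what is left is (t^4 - 1) + t^4 (t^{-4} - 1).\<close>
  have "\<zeta> N = 0"
    using cases
  proof (elim disjE conjE)
    assume c: "c = 0"
    with N have "N = 0" by simp
    with tc c show ?thesis by (simp add: \<zeta>0 \<tau>0)
  next
    assume c: "c = - 1" and a: "a = 0"
    with N have N: "N = Suc 0" by simp
    have y2: "y\<^sup>2 = 1 / t" using tc c by (simp add: power_int_minus inverse_eq_divide)
    then show ?thesis using t unfolding N \<zeta>S \<zeta>0 \<tau>S \<tau>0 s_def a y2
      by (simp add: field_simps power2_eq_square)
  next
    assume c: "c = - 2" and a: "a = 1" and b: "b = 0"
    with N have N: "N = Suc (Suc 0)" by simp
    have y2: "y\<^sup>2 = 1 / t\<^sup>2" using tc c by (simp add: power_int_minus inverse_eq_divide)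
    then show ?thesis using t unfolding N \<zeta>S \<zeta>0 \<tau>S \<tau>0 s_def a b y2
      by (simp add: field_simps power2_eq_square)
  qed
  then show ?thesis using main[of N v] by (simp add: u_def s_def del: qad_pow.simps)
qed

end

abbreviation wsum :: "(nat \<Rightarrow> int) \<Rightarrow> nat list \<Rightarrow> int" where
  "wsum \<beta> u \<equiv> sum_list (map \<beta> u)"

abbreviation wprod :: "(nat \<Rightarrow> complex) \<Rightarrow> nat list \<Rightarrow> complex" where
  "wprod h u \<equiv> prod_list (map h u)"

section \<open>Tensor powers of a letter space\<close>

text \<open>
  A tensor is the function of its coefficients on words.  If \<open>D\<close> is the action of a generator on one letter,
  \<open>\<beta>\<close> the weight exponent of the matching $K$ and \<open>s\<close> the sign from moving past a letter, then
  \<open>tact\<close> is the action through the coproduct $X \otimes K + K^{-1} \otimes X$; the letter with $k$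
  letters to its right and $i$ to its left gets the spectral parameter $p^{\zeta(k-i)}$.
\<close>

primrec tact :: "complex \<Rightarrow> int \<Rightarrow> ((nat \<Rightarrow> complex) \<Rightarrow> nat \<Rightarrow> complex) \<Rightarrow> (nat \<Rightarrow> int) \<Rightarrow> (nat \<Rightarrow> complex) \<Rightarrow>
   nat list \<Rightarrow> (nat list \<Rightarrow> complex) \<Rightarrow> complex" where
  "tact p \<zeta> D \<beta> s [] t = 0"
| "tact p \<zeta> D \<beta> s (w # u) t =
     p powi (\<zeta> * int (length u) + wsum \<beta> u) * D (\<lambda>w'. t (w' # u)) w
   + p powi (- \<zeta> - \<beta> w) * s w * tact p \<zeta> D \<beta> s u (\<lambda>u'. t (w # u'))"

text \<open>The matrix on one letter has at most two nonzero entries in each row. This shape yields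
  linearity and lets an action on the first letter be exchanged with one on the remaining
  letters.\<close>

definition twoterm :: "((nat \<Rightarrow> complex) \<Rightarrow> nat \<Rightarrow> complex) \<Rightarrow> bool" where
  "twoterm D \<longleftrightarrow> (\<exists>c k c' k'. \<forall>g l. D g l = c l * g (k l) + c' l * g (k' l))"

lemma twoterm_lincomb: "twoterm D \<Longrightarrow> D (\<lambda>w. c * g w + d * h w) l = c * D g l + d * D h l"
  by (auto simp: twoterm_def algebra_simps)

lemma twoterm_scale: "twoterm D \<Longrightarrow> D (\<lambda>w. c * g w) l = c * D g l"
  by (auto simp: twoterm_def algebra_simps)

lemma twoterm_add: "twoterm D \<Longrightarrow> D (\<lambda>w. g w + h w) l = D g l + D h l"
  by (auto simp: twoterm_def algebra_simps)

lemma tact_lincomb: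
  assumes "twoterm D"
  shows "tact p \<zeta> D \<beta> s u (\<lambda>u. c * t u + d * t' u) = c * tact p \<zeta> D \<beta> s u t + d * tact p \<zeta> D \<beta> s u t'"
  by (induction u arbitrary: t t') (simp_all add: twoterm_lincomb[OF assms] algebra_simps)

lemma tact_scale:
  assumes "twoterm D"
  shows "tact p \<zeta> D \<beta> s u (\<lambda>u. c * t u) = c * tact p \<zeta> D \<beta> s u t"
  using tact_lincomb[OF assms, of p \<zeta> \<beta> s u c t 0 t] by simp

lemma tact_add:
  assumes "twoterm D"
  shows "tact p \<zeta> D \<beta> s u (\<lambda>u. t u + t' u) = tact p \<zeta> D \<beta> s u t + tact p \<zeta> D \<beta> s u t'"
  using tact_lincomb[OF assms, of p \<zeta> \<beta> s u 1 t 1 t'] by simp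

lemma tact_zero: "twoterm D \<Longrightarrow> tact p \<zeta> D \<beta> s u (\<lambda>u. 0) = 0"
  using tact_scale[of D p \<zeta> \<beta> s u 0] by simp

lemma tact_cong:
  assumes "\<And>u'. length u' = length u \<Longrightarrow> t u' = t' u'"
  shows "tact p \<zeta> D \<beta> s u t = tact p \<zeta> D \<beta> s u t'"
  using assms
proof (induction u arbitrary: t t')
  case (Cons w u)
  have "(\<lambda>w'. t (w' # u)) = (\<lambda>w'. t' (w' # u))" using Cons.prems by auto
  moreover have "tact p \<zeta> D \<beta> s u (\<lambda>u'. t (w # u')) = tact p \<zeta> D \<beta> s u (\<lambda>u'. t' (w # u'))"
    by (rule Cons.IH) (simp add: Cons.prems)
  ultimately show ?case by simp
qed simp

lemma tact_length:
  assumes "twoterm D"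
  shows "tact p \<zeta> D \<beta> s u (\<lambda>u. f (length u) * t u) = f (length u) * tact p \<zeta> D \<beta> s u t"
  using tact_cong[of u "\<lambda>u'. f (length u') * t u'" "\<lambda>u'. f (length u) * t u'"] by (simp add: tact_scale[OF assms])

text \<open>Homogeneity of degree c for the grading \<gamma>, tested by multiplication with
  arbitrary functions of the weight. It then applies to powers of p and to projections onto one
  weight alike, and the induction along a word can translate f.\<close>

definition shifts :: "((nat \<Rightarrow> complex) \<Rightarrow> nat \<Rightarrow> complex) \<Rightarrow> (nat \<Rightarrow> int) \<Rightarrow> int \<Rightarrow> bool" where
  "shifts D \<gamma> c \<longleftrightarrow> (\<forall>(f :: int \<Rightarrow> complex) g l. D (\<lambda>w. f (\<gamma> w) * g w) l = f (\<gamma> l - c) * D g l)"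

definition signs :: "((nat \<Rightarrow> complex) \<Rightarrow> nat \<Rightarrow> complex) \<Rightarrow> (nat \<Rightarrow> complex) \<Rightarrow> complex \<Rightarrow> bool" where
  "signs D h e \<longleftrightarrow> (\<forall>g l. D (\<lambda>w. h w * g w) l = e * h l * D g l)"

lemma tact_shifts:
  assumes "shifts D \<gamma> c" "twoterm D"
  shows "tact p \<zeta> D \<beta> s u (\<lambda>u. f (wsum \<gamma> u) * t u) = f (wsum \<gamma> u - c) * tact p \<zeta> D \<beta> s u t"
proof (induction u arbitrary: t f)
  case (Cons w u)
  have "D (\<lambda>w'. f (\<gamma> w' + wsum \<gamma> u) * t (w' # u)) w = f (\<gamma> w - c + wsum \<gamma> u) * D (\<lambda>w'. t (w' # u)) w"
    using assms(1)[unfolded shifts_def, rule_format, of "\<lambda>x. f (x + wsum \<gamma> u)"] by simp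
  moreover have "tact p \<zeta> D \<beta> s u (\<lambda>u'. f (\<gamma> w + wsum \<gamma> u') * t (w # u')) = f (\<gamma> w + (wsum \<gamma> u - c)) * tact p \<zeta> D \<beta> s u (\<lambda>u'. t (w # u'))"
    by (rule Cons.IH[of "\<lambda>x. f (\<gamma> w + x)"])
  ultimately show ?case by (simp add: algebra_simps)
qed simp

lemma tact_signs:
  assumes "signs D h e" "twoterm D" "e * e = 1"
  shows "tact p \<zeta> D \<beta> s u (\<lambda>u. wprod h u * t u) = e * wprod h u * tact p \<zeta> D \<beta> s u t"
proof (induction u arbitrary: t)
  case (Cons w u)
  have "D (\<lambda>w'. (h w' * wprod h u) * t (w' # u)) w = wprod h u * (e * h w * D (\<lambda>w'. t (w' # u)) w)"
    using assms(1)[unfolded signs_def, rule_format, of "\<lambda>w'. wprod h u * t (w' # u)" w]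
    by (simp add: twoterm_scale[OF assms(2)] mult_ac)
  moreover have "tact p \<zeta> D \<beta> s u (\<lambda>u'. (h w * wprod h u') * t (w # u')) = h w * (e * wprod h u * tact p \<zeta> D \<beta> s u (\<lambda>u'. t (w # u')))"
    using tact_scale[OF assms(2), of p \<zeta> \<beta> s u "h w" "\<lambda>u'. wprod h u' * t (w # u')"] Cons.IH[of "\<lambda>u'. t (w # u')"]
    by (simp add: mult_ac)
  ultimately show ?case by (simp add: algebra_simps)
qed simp

lemma tact_letter_comm:
  assumes "twoterm D" "twoterm D'"
  shows "D' (\<lambda>w'. tact p \<zeta> D \<beta> s u (\<lambda>u'. t (w' # u'))) w = tact p \<zeta> D \<beta> s u (\<lambda>u'. D' (\<lambda>w'. t (w' # u')) w)"
proof -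
  obtain c k c' k' where D': "\<And>g l. D' g l = c l * g (k l) + c' l * g (k' l)"
    using assms(2) by (auto simp: twoterm_def)
  show ?thesis by (simp add: D' tact_lincomb[OF assms(1)])
qed

text \<open>The eigenvalue of the commutator of two coproducts on a word: each letter contributes
  its Q, multiplied by the K's of the letters to its right and the inverse K's and signs of those to
  its left.\<close>

primrec tcomm :: "complex \<Rightarrow> int \<Rightarrow> (nat \<Rightarrow> int) \<Rightarrow> (nat \<Rightarrow> complex) \<Rightarrow> (nat \<Rightarrow> complex) \<Rightarrow> nat list \<Rightarrow> complex" where
  "tcomm p \<zeta> \<beta> s Q [] = 0"
| "tcomm p \<zeta> \<beta> s Q (w # u) = p powi (\<zeta> * int (length u) + wsum \<beta> u) * Q w + p powi (- \<zeta> - \<beta> w) * s w * tcomm p \<zeta> \<beta> s Q u"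

text \<open>The two mixed terms of the coproducts cancel because \<open>X\<close> lowers the \<open>\<beta>2\<close>-weight of a word by
  exactly what \<open>Y\<close> adds to its \<open>\<beta>1\<close>-weight.\<close>

lemma tact_commutator:
  fixes p e :: complex and \<zeta>1 \<zeta>2 c :: int and \<beta>1 \<beta>2 :: "nat \<Rightarrow> int" and s1 s2 Q :: "nat \<Rightarrow> complex"
    and D1 D2 :: "(nat \<Rightarrow> complex) \<Rightarrow> nat \<Rightarrow> complex" and u :: "nat list" and t :: "nat list \<Rightarrow> complex"
  assumes p: "p \<noteq> 0" and D: "twoterm D1" "twoterm D2"
    and sh: "shifts D1 \<beta>2 c" "shifts D2 \<beta>1 (- c)"
    and sg: "signs D1 s2 e" "signs D2 s1 e" and e: "e * e = 1"
    and comm: "\<And>g l. D1 (D2 g) l - e * D2 (D1 g) l = Q l * g l"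
  defines "X \<equiv> \<lambda>t u. tact p \<zeta>1 D1 \<beta>1 s1 u t" and "Y \<equiv> \<lambda>t u. tact p \<zeta>2 D2 \<beta>2 s2 u t"
  shows "X (Y t) u - e * Y (X t) u = tcomm p (\<zeta>1 + \<zeta>2) (\<lambda>w. \<beta>1 w + \<beta>2 w) (\<lambda>w. s1 w * s2 w) Q u * t u"
proof (induction u arbitrary: t)
  case Nil
  show ?case by (simp add: X_def Y_def)
next
  case (Cons w u)
  define T2 where "T2 = (\<lambda>w'. Y (\<lambda>u'. t (w' # u')) u)"
  define T1 where "T1 = (\<lambda>w'. X (\<lambda>u'. t (w' # u')) u)"
  have one: "D1 (\<lambda>w'. (p powi (- \<zeta>2 - \<beta>2 w') * s2 w') * g w') w = p powi (- \<zeta>2 - (\<beta>2 w - c)) * (e * s2 w * D1 g w)" for g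
    using sh(1)[unfolded shifts_def, rule_format, of "\<lambda>x. p powi (- \<zeta>2 - x)" "\<lambda>w'. s2 w' * g w'" w]
      sg(1)[unfolded signs_def, rule_format, of g w] by (simp add: mult.assoc)
  have two: "D2 (\<lambda>w'. (p powi (- \<zeta>1 - \<beta>1 w') * s1 w') * g w') w = p powi (- \<zeta>1 - (\<beta>1 w + c)) * (e * s1 w * D2 g w)" for g
    using sh(2)[unfolded shifts_def, rule_format, of "\<lambda>x. p powi (- \<zeta>1 - x)" "\<lambda>w'. s1 w' * g w'" w]
      sg(2)[unfolded signs_def, rule_format, of g w] by (simp add: mult.assoc)
  have Xs: "X (\<lambda>u'. p powi (\<zeta>2 * int (length u') + wsum \<beta>2 u') * g u') u = p powi (\<zeta>2 * int (length u) + (wsum \<beta>2 u - c)) * X g u" for g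
    unfolding X_def
    using tact_shifts[OF sh(1) D(1), of p \<zeta>1 \<beta>1 s1 u "\<lambda>x. p powi x" "\<lambda>u'. p powi (\<zeta>2 * int (length u')) * g u'"]
      tact_length[OF D(1), of p \<zeta>1 \<beta>1 s1 u "\<lambda>k. p powi (\<zeta>2 * int k)" g] p
    by (simp add: power_int_add mult_ac)
  have Ys: "Y (\<lambda>u'. p powi (\<zeta>1 * int (length u') + wsum \<beta>1 u') * g u') u = p powi (\<zeta>1 * int (length u) + (wsum \<beta>1 u + c)) * Y g u" for g
    unfolding Y_def
    using tact_shifts[OF sh(2) D(2), of p \<zeta>2 \<beta>2 s2 u "\<lambda>x. p powi x" "\<lambda>u'. p powi (\<zeta>1 * int (length u')) * g u'"]
      tact_length[OF D(2), of p \<zeta>2 \<beta>2 s2 u "\<lambda>k. p powi (\<zeta>1 * int k)" g] p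
    by (simp add: power_int_add mult_ac)
  have X_lin: "X (\<lambda>u'. c * g u' + d * h u') u = c * X g u + d * X h u" for c d g h
    unfolding X_def by (rule tact_lincomb[OF D(1)])
  have Y_lin: "Y (\<lambda>u'. c * g u' + d * h u') u = c * Y g u + d * Y h u" for c d g h
    unfolding Y_def by (rule tact_lincomb[OF D(2)])
  have XC: "X t (w # u) = p powi (\<zeta>1 * int (length u) + wsum \<beta>1 u) * D1 (\<lambda>w'. t (w' # u)) w
      + p powi (- \<zeta>1 - \<beta>1 w) * s1 w * X (\<lambda>u'. t (w # u')) u" for t w u
    by (simp add: X_def)
  have YC: "Y t (w # u) = p powi (\<zeta>2 * int (length u) + wsum \<beta>2 u) * D2 (\<lambda>w'. t (w' # u)) w
      + p powi (- \<zeta>2 - \<beta>2 w) * s2 w * Y (\<lambda>u'. t (w # u')) u" for t w u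
    by (simp add: Y_def)
  define A where "A = X (\<lambda>u'. D2 (\<lambda>w'. t (w' # u')) w) u"
  define B where "B = Y (\<lambda>u'. D1 (\<lambda>w'. t (w' # u')) w) u"
  have D1T: "D1 (\<lambda>w'. Y (\<lambda>u'. t (w' # u')) u) w = B"
    unfolding B_def Y_def by (rule tact_letter_comm[OF D(2,1)])
  have D2T: "D2 (\<lambda>w'. X (\<lambda>u'. t (w' # u')) u) w = A"
    unfolding A_def X_def by (rule tact_letter_comm[OF D])
  have XY: "X (Y t) (w # u) = p powi (\<zeta>1 * int (length u) + wsum \<beta>1 u) *
        (p powi (\<zeta>2 * int (length u) + wsum \<beta>2 u) * D1 (D2 (\<lambda>w'. t (w' # u))) w + p powi (- \<zeta>2 - (\<beta>2 w - c)) * (e * s2 w * B))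
      + p powi (- \<zeta>1 - \<beta>1 w) * s1 w *
        (p powi (\<zeta>2 * int (length u) + (wsum \<beta>2 u - c)) * A + p powi (- \<zeta>2 - \<beta>2 w) * s2 w * X (Y (\<lambda>u'. t (w # u'))) u)"
  proof -
    have "(\<lambda>w'. D2 (\<lambda>w'. t (w' # u)) w') = D2 (\<lambda>w'. t (w' # u))" by simp
    moreover have "X (\<lambda>u'. Y t (w # u')) u = p powi (\<zeta>2 * int (length u) + (wsum \<beta>2 u - c)) * A + p powi (- \<zeta>2 - \<beta>2 w) * s2 w * X (Y (\<lambda>u'. t (w # u'))) u"
      using X_lin[of 1 "\<lambda>u'. p powi (\<zeta>2 * int (length u') + wsum \<beta>2 u') * D2 (\<lambda>w'. t (w' # u')) w" "p powi (- \<zeta>2 - \<beta>2 w) * s2 w" "Y (\<lambda>u'. t (w # u'))"]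
      by (simp add: YC Xs A_def)
    moreover have "D1 (\<lambda>w'. Y t (w' # u)) w = p powi (\<zeta>2 * int (length u) + wsum \<beta>2 u) * D1 (D2 (\<lambda>w'. t (w' # u))) w + p powi (- \<zeta>2 - (\<beta>2 w - c)) * (e * s2 w * B)"
      unfolding YC using twoterm_add[OF D(1)] one D1T by (simp add: twoterm_scale[OF D(1)])
    ultimately show ?thesis by (simp add: XC)
  qed
  have YX: "Y (X t) (w # u) = p powi (\<zeta>2 * int (length u) + wsum \<beta>2 u) *
        (p powi (\<zeta>1 * int (length u) + wsum \<beta>1 u) * D2 (D1 (\<lambda>w'. t (w' # u))) w + p powi (- \<zeta>1 - (\<beta>1 w + c)) * (e * s1 w * A))
      + p powi (- \<zeta>2 - \<beta>2 w) * s2 w *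
        (p powi (\<zeta>1 * int (length u) + (wsum \<beta>1 u + c)) * B + p powi (- \<zeta>1 - \<beta>1 w) * s1 w * Y (X (\<lambda>u'. t (w # u'))) u)"
  proof -
    have "Y (\<lambda>u'. X t (w # u')) u = p powi (\<zeta>1 * int (length u) + (wsum \<beta>1 u + c)) * B + p powi (- \<zeta>1 - \<beta>1 w) * s1 w * Y (X (\<lambda>u'. t (w # u'))) u"
      using Y_lin[of 1 "\<lambda>u'. p powi (\<zeta>1 * int (length u') + wsum \<beta>1 u') * D1 (\<lambda>w'. t (w' # u')) w" "p powi (- \<zeta>1 - \<beta>1 w) * s1 w" "X (\<lambda>u'. t (w # u'))"]
      by (simp add: XC Ys B_def)
    moreover have "D2 (\<lambda>w'. X t (w' # u)) w = p powi (\<zeta>1 * int (length u) + wsum \<beta>1 u) * D2 (D1 (\<lambda>w'. t (w' # u))) w + p powi (- \<zeta>1 - (\<beta>1 w + c)) * (e * s1 w * A)"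
      unfolding XC using twoterm_add[OF D(2)] two D2T by (simp add: twoterm_scale[OF D(2)])
    ultimately show ?thesis by (simp add: YC)
  qed
  define Par where "Par z = p powi z" for z
  have PPa: "Par (z + z') = Par z * Par z'" and PPm: "Par (- z) * Par z = 1" and PPd: "Par (z - z') = Par z * Par (- z')" for z z'
    using p by (auto simp: Par_def power_int_add power_int_minus power_int_diff divide_inverse)
  have ee: "e * (e * x) = x" for x using e by (simp add: mult.assoc[symmetric])
  have sums: "wsum (\<lambda>w. \<beta>1 w + \<beta>2 w) u = wsum \<beta>1 u + wsum \<beta>2 u" by (induction u) auto
  have "X (Y t) (w # u) - e * Y (X t) (w # u) = 
     Par (\<zeta>1 * int (length u) + wsum \<beta>1 u) * Par (\<zeta>2 * int (length u) + wsum \<beta>2 u) * (D1 (D2 (\<lambda>w'. t (w' # u))) w - e * D2 (D1 (\<lambda>w'. t (w' # u))) w)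
     + Par (- \<zeta>1 - \<beta>1 w) * s1 w * Par (- \<zeta>2 - \<beta>2 w) * s2 w * (X (Y (\<lambda>u'. t (w # u'))) u - e * Y (X (\<lambda>u'. t (w # u'))) u)"
    unfolding XY YX Par_def[symmetric]
    by (simp add: PPa PPd algebra_simps ee)
  also have "\<dots> = tcomm p (\<zeta>1 + \<zeta>2) (\<lambda>w. \<beta>1 w + \<beta>2 w) (\<lambda>w. s1 w * s2 w) Q (w # u) * t (w # u)"
    unfolding comm Cons.IH tcomm.simps sums Par_def[symmetric]
    by (simp add: PPa PPd algebra_simps)
  finally show ?case .
qed

lemma tcomm_zero: "tcomm p \<zeta> \<beta> s (\<lambda>_. 0) u = 0"
  by (induction u) auto

text \<open>Along the word this is the addition rule [x + y] = p^{2y} [x] + p^{-2x} [y] of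
  q-numbers.\<close>

lemma tcomm_qnumber:
  assumes "p \<noteq> 0" "\<And>w. s w * s w = 1"
  shows "tcomm p 0 (\<lambda>w. \<beta> w + \<beta> w) (\<lambda>w. s w * s w) (\<lambda>w. (p powi (2 * \<beta> w) - p powi (- 2 * \<beta> w)) / d) u
    = (p powi (2 * wsum \<beta> u) - p powi (- 2 * wsum \<beta> u)) / d"
proof (induction u)
  case (Cons w u)
  have sums: "wsum (\<lambda>w. \<beta> w + \<beta> w) u = 2 * wsum \<beta> u" by (induction u) auto
  have PPa: "p powi (z + z') = p powi z * p powi z'" and PPd: "p powi (z - z') = p powi z * p powi (- z')" for z z'
    using assms by (auto simp: power_int_add power_int_minus power_int_diff divide_inverse)
  have e: "2 * (\<beta> w + wsum \<beta> u) = 2 * \<beta> w + 2 * wsum \<beta> u" "- 2 * (\<beta> w + wsum \<beta> u) = - 2 * \<beta> w + (- 2) * wsum \<beta> u"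
    "- 0 - (\<beta> w + \<beta> w) = - 2 * \<beta> w" by simp_all
  show ?case
    unfolding tcomm.simps Cons.IH
    unfolding sums list.map sum_list.Cons e PPa assms(2)
    by (simp add: diff_divide_distrib algebra_simps)
qed simp

section \<open>The natural representation\<close>

locale osp =
  fixes m n :: nat and p :: complex
  assumes m1: "m \<ge> 1" and even_n: "even n" and n2: "n > 2" and p0: "p \<noteq> 0" and proot: "\<And>k. k > 0 \<Longrightarrow> p ^ k \<noteq> 1"
begin

definition r where "r = rr n"
definition h where "h = hh m"
definition s where "s = ss m n"
definition N where "N = n + m"

lemma params: "2 \<le> r" "s = r + h" "N = 2 * r + m" "even m \<and> m = 2 * h \<or> odd m \<and> m = Suc (2 * h)"
  using even_n n2 by (auto simp: r_def h_def s_def N_def rr_def hh_def ss_def) presburger+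

lemma h_less_m: "h < m"
  using params(4) m1 by auto

definition bar :: "nat \<Rightarrow> nat" where "bar l = N + 1 - l"

text \<open>
  Node \<open>i\<close> raises the letter \<open>src i\<close> to \<open>tgt i\<close> and \<open>bar (tgt i)\<close> to \<open>bar (src i)\<close>, so its root is the
  difference of the weights of \<open>tgt i\<close> and \<open>src i\<close>.  With $r = n/2$ the letters \<open>1, \<dots>, r\<close> have the weights $\delta_\mu$,
  the next \<open>h\<close> letters the weights $\epsilon_i$, and \<open>bar\<close> negates weights.
\<close>

definition src :: "nat \<Rightarrow> nat" where
  "src i = (if i = 0 then 1 else if i < h \<or> i = h \<and> odd m then r + i + 1 else if i = h then s + 1 else i - h + 1)"
definition tgt :: "nat \<Rightarrow> nat" where
  "tgt i = (if i = 0 then N - 1 else if i < h \<or> i = h \<and> odd m then r + i else if i = h then s - 1 else i - h)"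

lemma node_range:
  assumes "i \<le> s"
  shows "1 \<le> src i" "src i \<le> N" "1 \<le> tgt i" "tgt i \<le> N" "src i \<noteq> tgt i" "src i \<noteq> bar (tgt i)"
  using assms params m1 by (auto simp: src_def tgt_def bar_def)

lemma bar_range: "1 \<le> l \<Longrightarrow> l \<le> N \<Longrightarrow> 1 \<le> bar l \<and> bar l \<le> N"
  by (auto simp: bar_def)

lemma bar_bar: "1 \<le> l \<Longrightarrow> l \<le> N \<Longrightarrow> bar (bar l) = l"
  by (auto simp: bar_def)

lemma bar_eq: "1 \<le> l \<Longrightarrow> l \<le> N \<Longrightarrow> (bar k = l) = (k = bar l)"
  by (auto simp: bar_def)

lemma bar_inj: "1 \<le> l \<Longrightarrow> l \<le> N \<Longrightarrow> (bar k = bar l) = (k = l)"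
  by (auto simp: bar_def)

text \<open>These are the letters of weight \<plusminus>\<epsilon>_i and, for odd m, the one of
  weight 0. They are the odd letters here, so that constant words in the \<delta>-letters are
  even.\<close>

definition fermionic :: "nat \<Rightarrow> bool" where "fermionic l \<longleftrightarrow> r < l \<and> l \<le> r + m"
definition lsign :: "nat \<Rightarrow> int" where "lsign l = (if fermionic l then 1 else - 1)"

lemma fermionic_bar: "1 \<le> l \<Longrightarrow> l \<le> N \<Longrightarrow> fermionic (bar l) = fermionic l"
  using params by (auto simp: fermionic_def bar_def)

lemma lsign_bar: "1 \<le> l \<Longrightarrow> l \<le> N \<Longrightarrow> lsign (bar l) = lsign l"
  by (simp add: lsign_def fermionic_bar)

lemma lsign_sq: "lsign l * lsign l = 1" by (simp add: lsign_def)

text \<open>The invariant form on the weights of letters, see \<open>ip_wt\<close>. For the letter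
  of weight 0, which equals its own \<open>bar\<close>, the two terms cancel.\<close>

definition lform :: "nat \<Rightarrow> nat \<Rightarrow> int" where
  "lform l l' = lsign l * ((if l = l' then 1 else 0) - (if l = bar l' then 1 else 0))"

definition par :: "nat \<Rightarrow> bit" where "par i = (if fermionic (src i) = fermionic (tgt i) then 0 else 1)"

text \<open>The inner product of the i-th simple root with the weight of l, see \<open>B_ip\<close>;
  the image of q^{h_i/2} multiplies the letter l by p^{B i l}.\<close>

definition B :: "nat \<Rightarrow> nat \<Rightarrow> int" where "B i l = lform (tgt i) l - lform (src i) l"

definition sgn_op :: "nat \<Rightarrow> nat \<Rightarrow> complex" where
  "sgn_op i l = (if par i = 1 \<and> fermionic l then - 1 else 1)"

definition rform :: "nat \<Rightarrow> nat \<Rightarrow> int" where "rform i j = B i (tgt j) - B i (src j)"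

text \<open>In letter order \<delta>_1, ..., \<delta>_r, \<epsilon>_1, ..., \<epsilon>_h the simple
  roots are consecutive differences, ending for odd m with the letter of weight 0. The numbering of
  nodes puts the \<epsilon>-part first, whence the two formulas for i. For even m there is one more
  node, with root \<epsilon>_{h-1} + \<epsilon>_h or, if m = 2, \<delta>_r + \<epsilon>_1.\<close>

lemma node_cases:
  assumes "i \<le> s"
  obtains (affine) "i = 0" "src i = 1" "tgt i = N - 1"
  | (chain) l where "1 \<le> l" "l \<le> s" "src i = l + 1" "tgt i = l" "i = (if l \<le> r then l + h else l - r)" "l = s \<longrightarrow> odd m"
  | (fork) "even m" "i = h" "1 \<le> h" "src i = s + 1" "tgt i = s - 1"
proof -
  have "i = 0 \<or> i \<noteq> 0 \<and> (i < h \<or> i = h \<and> odd m) \<or> i \<noteq> 0 \<and> i = h \<and> even m \<or> i > h"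
    using linorder_less_linear[of i h] by blast
  then consider "i = 0" | "i \<noteq> 0" "i < h \<or> i = h \<and> odd m" | "i \<noteq> 0" "i = h" "even m" | "i > h" by blast
  then show thesis
  proof cases
    case 1 then show thesis by (intro affine) (simp_all add: src_def tgt_def)
  next
    case 2
    then have "src i = (r + i) + 1" "tgt i = r + i" "r + i \<le> s" "r + i = s \<longrightarrow> odd m"
      using params(2) by (auto simp: src_def tgt_def)
    then show thesis using 2(1) by (intro chain[of "r + i"]) simp_all
  next
    case 3 then show thesis by (intro fork) (simp_all add: src_def tgt_def)
  next
    case 4
    then have "src i = (i - h) + 1" "tgt i = i - h" "i - h \<le> r" using assms params(2) by (auto simp: src_def tgt_def)
    moreover have "i - h = s \<longrightarrow> odd m"
    proof
      assume "i - h = s"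
      then have "h = 0" using \<open>i - h \<le> r\<close> params(2) by simp
      then show "odd m" using params(4) m1 by simp
    qed
    ultimately show thesis using 4 params(2) by (intro chain[of "i - h"]) simp_all
  qed
qed

lemma par_eq: 
  assumes "i \<le> s"
  shows "par i = sroot_parity m n i"
  using assms
proof (cases i rule: node_cases)
  case affine
  then show ?thesis using params m1 by (auto simp: par_def sroot_parity_def fermionic_def s_def[symmetric])
next
  case (chain l)
  have "par i = 1 \<longleftrightarrow> l = r"
    using chain params(1,2) h_less_m by (auto simp: par_def fermionic_def)
  moreover have "i = s \<or> m = 2 \<and> i = 1 \<longleftrightarrow> l = r"
    using chain params m1 by (auto split: if_splits)
  ultimately show ?thesis by (auto simp: sroot_parity_def s_def[symmetric])
next
  case fork
  have "par i = 1 \<longleftrightarrow> h = 1"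
    using fork params(1-4) m1 by (auto simp: par_def fermionic_def)
  moreover have "i = s \<or> m = 2 \<and> i = 1 \<longleftrightarrow> h = 1"
    using fork params m1 by auto
  ultimately show ?thesis by (auto simp: sroot_parity_def s_def[symmetric])
qed

section \<open>Incidences between the arrows of two nodes\<close>

lemma N_cases: "even m \<and> N = 2 * s \<or> odd m \<and> N = 2 * s + 1" "2 \<le> s" "r \<le> s" "even m \<Longrightarrow> r < s"
  using params m1 by auto

definition node_at :: "nat \<Rightarrow> nat \<Rightarrow> bool" where
  "node_at i l \<longleftrightarrow> i = (if l \<le> r then l + h else l - r)"

lemma node_at_unique: "node_at i l \<Longrightarrow> node_at j l \<Longrightarrow> i = j"
  by (simp add: node_at_def)

lemma node_at_1: "node_at i 1 \<Longrightarrow> i = h + 1"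
  using params(1) by (simp add: node_at_def)

text \<open>The trichotomy as a disjunction, so that two nodes can be split together and the mixed
  cases left to linear arithmetic.\<close>

lemma node_disj:
  assumes "i \<le> s"
  shows "i = 0 \<and> src i = 1 \<and> tgt i = N - 1 \<or>
    (\<exists>l. 1 \<le> l \<and> l \<le> s \<and> src i = l + 1 \<and> tgt i = l \<and> node_at i l \<and> (l = s \<longrightarrow> odd m)) \<or>
    even m \<and> i = h \<and> 1 \<le> h \<and> src i = s + 1 \<and> tgt i = s - 1"
  using assms
proof (cases i rule: node_cases)
  case (chain l)
  then show ?thesis unfolding node_at_def by (intro disjI2 disjI1 exI[of _ l] conjI)
next
  case affine
  then show ?thesis by (intro disjI1 conjI)
next
  case fork
  then show ?thesis by (intro disjI2 conjI)
qed

lemma src_inj: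
  assumes "i \<le> s" "j \<le> s" "src i = src j" shows "i = j" 
  using node_disj[OF assms(1)] node_disj[OF assms(2)]
proof (elim disjE exE conjE)
  fix l l' assume "src i = l + 1" "node_at i l" "src j = l' + 1" "node_at j l'"
  with assms(3) show ?thesis by (auto intro: node_at_unique)
qed (use assms(3) N_cases(2) in linarith)+

text \<open>An arrow ends where a mirrored arrow begins only at the two nodes with roots \<delta>_1
  - \<delta>_2 and -\<delta>_1 - \<delta>_2; the common letter is 2.\<close>

lemma src_eq_bar_tgt:
  assumes "i \<le> s" "j \<le> s" "src i = bar (tgt j)" shows "i = h + 1 \<and> j = 0" 
proof -
  have e: "src i + tgt j = N + 1" using assms(3) node_range[OF assms(2)] by (simp add: bar_def)
  have N: "N = 2 * s \<or> odd m \<and> N = 2 * s + 1" using N_cases(1) by blast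
  show ?thesis
    using node_disj[OF assms(1)] node_disj[OF assms(2)]
  proof (elim disjE exE conjE)
    fix l assume "src i = l + 1" "node_at i l" "j = 0" "tgt j = N - 1"
    moreover from this have "l = 1" using e N_cases(2) N by linarith
    ultimately show ?thesis using node_at_1[of i] by metis
  next
    fix l l' assume "src i = l + 1" "tgt j = l'" "l \<le> s" "l' \<le> s" "l = s \<longrightarrow> odd m" "l' = s \<longrightarrow> odd m"
    then show ?thesis using e N N_cases(1) by (cases "l = s"; cases "l' = s") auto
  qed (use e N N_cases(2) in linarith)+
qed

text \<open>Two nodes share a target only at the fork for even m, where their roots are
  \<epsilon>_{h-1} \<minusplus> \<epsilon>_h, or \<delta>_r \<minusplus> \<epsilon>_1 if m =
  2.\<close>

lemma tgt_eq:
  assumes "i \<le> s" "j \<le> s" "i \<noteq> j" "tgt i = tgt j"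
  shows "src i = bar (src j) \<and> par i = par j \<and> lsign (src i) = (if par i = 1 then - lsign (tgt i) else lsign (tgt i))"
proof -
  have g: "lsign (src i) = (if par i = 1 then - lsign (tgt i) else lsign (tgt i))"
    by (auto simp: par_def lsign_def)
  have N2: "N = 2 * s \<or> N = 2 * s + 1" using N_cases(1) by blast
  have src: "src i = bar (src j)"
    using node_disj[OF assms(1)] node_disj[OF assms(2)]
  proof (elim disjE exE conjE)
    fix l assume *: "src i = l + 1" "tgt i = l" "even m" "src j = s + 1" "tgt j = s - 1"
    then show ?thesis using assms(4) N_cases by (auto simp: bar_def)
  next
    fix l assume *: "src j = l + 1" "tgt j = l" "even m" "src i = s + 1" "tgt i = s - 1"
    then show ?thesis using assms(4) N_cases by (auto simp: bar_def)
  next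
    fix l l' assume *: "tgt i = l" "node_at i l" "tgt j = l'" "node_at j l'"
    then show ?thesis using assms(3,4) by (auto dest: node_at_unique)
  qed (use assms(3,4) N_cases(2) N2 in linarith)+
  have "par i = par j"
    using src node_range[OF assms(2)] fermionic_bar[of "src j"] by (simp add: par_def assms(4))
  then show ?thesis using g src by simp
qed

text \<open>Letter operators act on coefficient functions: the new coefficient at l is read off at
  the letter that is sent to l.\<close>

definition DE :: "nat \<Rightarrow> (nat \<Rightarrow> complex) \<Rightarrow> nat \<Rightarrow> complex" where
  "DE i g l = (if l = tgt i then g (src i) else 0) + (if l = bar (src i) then g (bar (tgt i)) else 0)"

text \<open>The factors \<open>lsign\<close> normalise F_i so that its graded commutator with E_i is
  the diagonal matrix \<open>B i\<close>, also when node i is odd.\<close>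

definition DF :: "nat \<Rightarrow> (nat \<Rightarrow> complex) \<Rightarrow> nat \<Rightarrow> complex" where
  "DF i g l = (if l = src i then of_int (lsign (tgt i)) * g (tgt i) else 0) + (if l = bar (tgt i) then of_int (lsign (src i)) * g (bar (src i)) else 0)"

lemma twoterm_DE: "twoterm (DE i)"
  unfolding twoterm_def DE_def
  by (intro exI[of _ "\<lambda>l. if l = tgt i then 1 else 0"] exI[of _ "\<lambda>_. src i"] exI[of _ "\<lambda>l. if l = bar (src i) then 1 else 0"] exI[of _ "\<lambda>_. bar (tgt i)"]) auto

lemma twoterm_DF: "twoterm (DF i)"
  unfolding twoterm_def DF_def
  by (intro exI[of _ "\<lambda>l. if l = src i then of_int (lsign (tgt i)) else 0"] exI[of _ "\<lambda>_. tgt i"] exI[of _ "\<lambda>l. if l = bar (tgt i) then of_int (lsign (src i)) else 0"] exI[of _ "\<lambda>_. bar (src i)"]) auto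

lemma bar_src_tgt: "i \<le> s \<Longrightarrow> bar (src i) \<noteq> tgt i" "i \<le> s \<Longrightarrow> tgt i \<noteq> bar (src i)"
  using node_range[of i] bar_eq[of "tgt i" "src i"] by auto

text \<open>A grading that is odd under \<open>bar\<close> is changed by the same amount along an
  arrow and its mirror image.\<close>

lemma letter_shifts:
  assumes "i \<le> s" and anti: "\<And>l. 1 \<le> l \<Longrightarrow> l \<le> N \<Longrightarrow> \<gamma> (bar l) = - \<gamma> l"
  shows "shifts (DE i) \<gamma> (\<gamma> (tgt i) - \<gamma> (src i))" "shifts (DF i) \<gamma> (- (\<gamma> (tgt i) - \<gamma> (src i)))"
  using node_range[OF assms(1)] bar_src_tgt[OF assms(1)] by (auto simp: shifts_def DE_def DF_def anti)

lemma B_bar: "1 \<le> l \<Longrightarrow> l \<le> N \<Longrightarrow> B i (bar l) = - B i l"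
  by (auto simp: B_def lform_def bar_bar algebra_simps)

lemma shifts_B:
  assumes "i \<le> s"
  shows "shifts (DE i) (B j) (rform j i)" "shifts (DF i) (B j) (- rform j i)"
  using letter_shifts[OF assms, of "B j"] B_bar unfolding rform_def by auto

lemma lform_sym: "1 \<le> l \<Longrightarrow> l \<le> N \<Longrightarrow> 1 \<le> l' \<Longrightarrow> l' \<le> N \<Longrightarrow> lform l l' = lform l' l"
  using bar_eq[of l l'] by (auto simp: lform_def lsign_bar bar_bar)

lemma rform_sym: "i \<le> s \<Longrightarrow> j \<le> s \<Longrightarrow> rform i j = rform j i"
  using node_range[of i] node_range[of j] by (simp add: rform_def B_def lform_sym)

lemma signs_op:
  assumes "i \<le> s"
  shows "signs (DE i) (sgn_op j) (parity_sign (par i * par j))" "signs (DF i) (sgn_op j) (parity_sign (par i * par j))"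
  using node_range[OF assms(1)] bar_src_tgt[OF assms(1)] by (auto simp: signs_def DE_def DF_def sgn_op_def par_def fermionic_bar)

lemma N_ge_5: "5 \<le> N" 
  using params(1,3) m1 by linarith

lemma end_letters: "fermionic 1 = False" "fermionic 2 = False" "fermionic (N - 1) = False" "bar 1 = N" "bar 2 = N - 1" "bar (N - 1) = 2" "bar N = 1" "1 < N - 1"
    "src (h + 1) = 2" "tgt (h + 1) = 1" "src 0 = 1" "tgt 0 = N - 1"
proof -
  show "bar 1 = N" "bar 2 = N - 1" "bar (N - 1) = 2" "bar N = 1" "1 < N - 1"
    using N_ge_5 by (simp_all add: bar_def)
  show "fermionic 1 = False" "fermionic 2 = False" "fermionic (N - 1) = False"
    using params(1,3) by (auto simp: fermionic_def)
qed (simp_all add: src_def tgt_def)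

text \<open>Both products vanish unless the two nodes are 0 and h+1 or form the fork. In these cases
  EF and FE lead from the same letter to the same letter along the two routes of a square, and the
  two contributions cancel.\<close>

lemma letter_comm:
  assumes ij: "i \<le> s" "j \<le> s" "i \<noteq> j"
  shows "DE i (DF j g) l - parity_sign (par i * par j) * DF j (DE i g) l = 0"
proof -
  note ri = node_range[OF ij(1)] bar_src_tgt[OF ij(1)] and rj = node_range[OF ij(2)] bar_src_tgt[OF ij(2)]
  have src: "src i \<noteq> src j" "src j \<noteq> src i" "bar (src j) \<noteq> bar (src i)"
    using src_inj[OF ij(1,2)] ij(3) bar_inj[of "src i" "src j"] ri by auto
  have sym: "bar (tgt i) = src j \<longleftrightarrow> src j = bar (tgt i)" "tgt j = bar (src i) \<longleftrightarrow> src i = bar (tgt j)"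
     "bar (src j) = tgt i \<longleftrightarrow> src j = bar (tgt i)" "bar (tgt i) = bar (tgt j) \<longleftrightarrow> tgt i = tgt j" "tgt j = tgt i \<longleftrightarrow> tgt i = tgt j"
    by (metis bar_bar ri rj)+
  have v1: "DF j g (src i) = (if src i = bar (tgt j) then of_int (lsign (src j)) * g (bar (src j)) else 0)"
    by (simp add: DF_def src)
  have v2: "DF j g (bar (tgt i)) = (if src j = bar (tgt i) then of_int (lsign (tgt j)) * g (tgt j) else 0) + (if tgt i = tgt j then of_int (lsign (src j)) * g (bar (src j)) else 0)"
    unfolding DF_def sym ..
  have v3: "DE i g (tgt j) = (if tgt i = tgt j then g (src i) else 0) + (if src i = bar (tgt j) then g (bar (tgt i)) else 0)"
    unfolding DE_def sym ..
  have v4: "DE i g (bar (src j)) = (if src j = bar (tgt i) then g (src i) else 0)"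
    unfolding DE_def sym by (simp add: src)
  have EF: "DE i (DF j g) l = (if l = tgt i then DF j g (src i) else 0) + (if l = bar (src i) then DF j g (bar (tgt i)) else 0)"
    by (simp only: DE_def)
  have FE: "DF j (DE i g) l = (if l = src j then of_int (lsign (tgt j)) * DE i g (tgt j) else 0) + (if l = bar (tgt j) then of_int (lsign (src j)) * DE i g (bar (src j)) else 0)"
    by (simp only: DF_def)
  consider (c1) "src i = bar (tgt j)" | (c2) "src j = bar (tgt i)" | (c3) "tgt i = tgt j" | (none) "src i \<noteq> bar (tgt j)" "src j \<noteq> bar (tgt i)" "tgt i \<noteq> tgt j"
    by blast
  then show ?thesis
  proof cases
    case c1
    then have i: "i = h + 1" and j: "j = 0" using src_eq_bar_tgt[OF ij(1,2)] by auto
    note e = end_letters[folded i j]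
    have "par j = 0" "lsign (src j) = - 1" "lsign (tgt j) = - 1" by (simp_all add: par_def lsign_def e del: One_nat_def)
    then show ?thesis using e(8) unfolding EF FE unfolding v1 v2 v3 v4 by (auto simp: e(1-7) e(9-) simp del: One_nat_def)
  next
    case c2
    then have i: "j = h + 1" and j: "i = 0" using src_eq_bar_tgt[OF ij(2,1)] by auto
    note e = end_letters[folded i j]
    have "par i = 0" "lsign (src j) = - 1" "lsign (tgt j) = - 1" by (simp_all add: par_def lsign_def e del: One_nat_def)
    then show ?thesis using e(8) unfolding EF FE unfolding v1 v2 v3 v4 by (auto simp: e(1-7) e(9-) simp del: One_nat_def)
  next
    case c3
    note nbe = tgt_eq[OF ij c3]
    then have aj: "bar (src i) = src j" using rj by (simp add: bar_bar)
    have gaj: "lsign (src i) = lsign (src j)" using nbe lsign_bar[of "src j"] rj by simp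
    have bna: "bar (src j) = src i" using nbe by simp
    have n1: "src i \<noteq> bar (tgt j)" "src j \<noteq> bar (tgt i)" using c3 ri rj by auto
    have "parity_sign (par i * par j) * of_int (lsign (tgt j)) = (of_int (lsign (src j)) :: complex)"
      using nbe c3 gaj by (cases "par j = 0") (auto simp: parity_sign_def)
    then show ?thesis
      unfolding EF FE unfolding v1 v2 v3 v4 unfolding aj bna using n1 c3 rj(5) by (simp add: mult.assoc[symmetric])
  next
    case none
    then have "DF j g (src i) = 0" "DF j g (bar (tgt i)) = 0" "DE i g (tgt j) = 0" "DE i g (bar (src j)) = 0"
      unfolding v1 v2 v3 v4 by simp_all
    then show ?thesis unfolding EF FE by simp
  qed
qed

lemma letter_comm_same:
  assumes i: "i \<le> s"
  shows "DE i (DF i g) l - parity_sign (par i * par i) * DF i (DE i g) l = (p powi (2 * B i l) - p powi (- 2 * B i l)) / (p\<^sup>2 - 1 / p\<^sup>2) * g l"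
proof -
  note ri = node_range[OF i] bar_src_tgt[OF i]
  have d: "p\<^sup>2 - 1 / p\<^sup>2 \<noteq> 0"
  proof
    assume "p\<^sup>2 - 1 / p\<^sup>2 = 0"
    then have "p ^ 4 = 1" using p0 by (simp add: field_simps power4_eq_xxxx power2_eq_square)
    then show False using proot[of 4] by simp
  qed
  have q: "(p powi (2 * 1) - p powi (- 2 * 1)) / (p\<^sup>2 - 1 / p\<^sup>2) = 1" "(p powi (2 * - 1) - p powi (- 2 * - 1)) / (p\<^sup>2 - 1 / p\<^sup>2) = - 1"
  proof -
    have "p powi (2 * 1) - p powi (- 2 * 1) = p\<^sup>2 - 1 / p\<^sup>2" "p powi (2 * - 1) - p powi (- 2 * - 1) = - (p\<^sup>2 - 1 / p\<^sup>2)"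
      by (simp_all add: power_int_minus inverse_eq_divide)
    then show "(p powi (2 * 1) - p powi (- 2 * 1)) / (p\<^sup>2 - 1 / p\<^sup>2) = 1" "(p powi (2 * - 1) - p powi (- 2 * - 1)) / (p\<^sup>2 - 1 / p\<^sup>2) = - 1"
      using d by (simp_all only: divide_self minus_divide_left[symmetric] divide_self[OF d])
  qed
  note be = bar_eq bar_bar bar_range bar_inj
  have Bv: "B i l = (if l = tgt i then lsign (tgt i) else 0) - (if l = bar (tgt i) then lsign (tgt i) else 0)
      - (if l = src i then lsign (src i) else 0) + (if l = bar (src i) then lsign (src i) else 0)"
  proof -
    have "(src i = bar l) = (l = bar (src i))" "(tgt i = bar l) = (l = bar (tgt i))"
      using bar_eq[of "src i" l] bar_eq[of "tgt i" l] ri by auto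
    then show ?thesis by (simp add: B_def lform_def right_diff_distrib eq_commute[of l])
  qed
  have qB: "(p powi (2 * B i l) - p powi (- 2 * B i l)) / (p\<^sup>2 - 1 / p\<^sup>2) = of_int (B i l)"
  proof -
    \<comment> \<open>On these three values a q-number equals the number itself, so the relation on
      one letter is the undeformed one.\<close>
    have "B i l \<in> {- 1, 0, 1}" using ri unfolding Bv by (auto simp: lsign_def be)
    then show ?thesis using q by auto
  qed
  have ps: "parity_sign (par i * par i) = (if lsign (src i) = lsign (tgt i) then 1 else - 1)" 
    by (auto simp: par_def lsign_def)
  have "lsign (src i) = lsign (tgt i) \<or> lsign (src i) = - lsign (tgt i) \<and> - lsign (tgt i) \<noteq> lsign (tgt i)" by (auto simp: lsign_def)
  then show ?thesis
  proof (elim disjE conjE)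
    assume e: "lsign (src i) = lsign (tgt i)"
    show ?thesis unfolding qB unfolding Bv ps e using ri
      by (auto simp: DE_def DF_def be lsign_bar e)
  next
    assume e: "lsign (src i) = - lsign (tgt i)" "- lsign (tgt i) \<noteq> lsign (tgt i)"
    show ?thesis unfolding qB unfolding Bv ps e(1) using ri e(2)
      by (auto simp: DE_def DF_def be lsign_bar e(1))
  qed
qed

end

section \<open>Constant words and words with one excited letter\<close>

definition sT :: "complex \<Rightarrow> ('x \<Rightarrow> complex) \<Rightarrow> 'x \<Rightarrow> complex" where
  "sT c t = (\<lambda>u. c * t u)"

lemma sT_apply: "sT c t u = c * t u"
  by (simp add: sT_def)

lemma cspace_sT: "cspace sT"
  by unfold_locales (auto simp: sT_def fun_eq_iff algebra_simps)

definition cword :: "nat \<Rightarrow> nat list \<Rightarrow> complex" where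
  "cword b u = (if u = replicate (length u) b then 1 else 0)"

definition trunc :: "nat \<Rightarrow> (nat list \<Rightarrow> complex) \<Rightarrow> nat list \<Rightarrow> complex" where
  "trunc a t u = (if length u = a then 1 else 0) * t u"

definition unitv :: "nat \<Rightarrow> nat \<Rightarrow> complex" where
  "unitv l k = (if k = l then 1 else 0)"

text \<open>The sum over all positions of the word with one letter replaced by g; each b to the
  right of it counts \<rho>, each b to the left counts \<rho>'. This is the shape of a generator
  applied to a constant word, see \<open>tact_wb\<close>.\<close>

primrec excited :: "complex \<Rightarrow> complex \<Rightarrow> nat \<Rightarrow> (nat \<Rightarrow> complex) \<Rightarrow> nat list \<Rightarrow> complex" where
  "excited \<rho> \<rho>' b g [] = 0"
| "excited \<rho> \<rho>' b g (w # u) = \<rho> ^ length u * cword b u * g w + (if w = b then \<rho>' else 0) * excited \<rho> \<rho>' b g u"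

lemma cword_Cons: "cword b (w # u) = unitv b w * cword b u"
  by (simp add: cword_def unitv_def)

lemma cword_wsum: "cword b u * f (wsum \<beta> u) = cword b u * f (int (length u) * \<beta> b)"
proof (cases "u = replicate (length u) b")
  case True
  have "wsum \<beta> (replicate k b) = int k * \<beta> b" for k
    by (induction k) (auto simp: algebra_simps)
  then show ?thesis using True by metis
qed (simp add: cword_def)

lemma excited_scale: "excited \<rho> \<rho>' b (\<lambda>w. c * g w) u = c * excited \<rho> \<rho>' b g u"
  by (induction u) (auto simp: algebra_simps)

lemma tact_trunc:
  assumes "twoterm D"
  shows "tact p \<zeta> D \<beta> s u (trunc a t) = trunc a (\<lambda>u. tact p \<zeta> D \<beta> s u t) u"
proof -
  have "trunc a t = (\<lambda>u. (if length u = a then 1 else 0) * t u)" by (simp add: trunc_def fun_eq_iff)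
  then show ?thesis using tact_length[OF assms, of p \<zeta> \<beta> s u "\<lambda>k. if k = a then 1 else 0"] by (simp add: trunc_def)
qed

lemma tact_wb:
  assumes D: "twoterm D" and p: "p \<noteq> 0" and s: "s b = 1"
  shows "tact p \<zeta> D \<beta> s u (cword b) = excited (p powi (\<zeta> + \<beta> b)) (p powi (- \<zeta> - \<beta> b)) b (D (unitv b)) u"
proof (induction u)
  case (Cons w u)
  have "(\<lambda>w'. cword b (w' # u)) = (\<lambda>w'. cword b u * unitv b w')" by (simp add: cword_Cons mult.commute)
  then have 1: "D (\<lambda>w'. cword b (w' # u)) w = cword b u * D (unitv b) w" by (simp add: twoterm_scale[OF D])
  have "(\<lambda>u'. cword b (w # u')) = (\<lambda>u'. unitv b w * cword b u')" by (simp add: cword_Cons)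
  then have 2: "tact p \<zeta> D \<beta> s u (\<lambda>u'. cword b (w # u')) = unitv b w * tact p \<zeta> D \<beta> s u (cword b)" by (simp add: tact_scale[OF D])
  have 3: "p powi (\<zeta> * int (length u) + wsum \<beta> u) * cword b u = (p powi (\<zeta> + \<beta> b)) ^ length u * cword b u"
  proof -
    have "\<zeta> * int (length u) + int (length u) * \<beta> b = (\<zeta> + \<beta> b) * int (length u)" by (simp add: algebra_simps)
    then have "p powi (\<zeta> * int (length u) + int (length u) * \<beta> b) = (p powi (\<zeta> + \<beta> b)) ^ length u" by (simp add: power_int_mult)
    then show ?thesis using cword_wsum[of b u "\<lambda>x. p powi (\<zeta> * int (length u) + x)" \<beta>] by (simp add: mult.commute)
  qed
  have 4: "p powi (\<zeta> * int (length u) + wsum \<beta> u) * (cword b u * D (unitv b) w) = (p powi (\<zeta> + \<beta> b)) ^ length u * cword b u * D (unitv b) w"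
    using 3 by (simp add: mult.assoc[symmetric])
  show ?case
    using s by (simp add: 1 2 Cons.IH 4) (simp add: unitv_def)
qed simp

text \<open>D kills b and its K is trivial on b, so only the excited letter feels the
  action.\<close>

lemma tact_exc:
  assumes D: "twoterm D" and s: "s b = 1" and \<beta>: "\<beta> b = 0" and kill: "D (unitv b) = (\<lambda>_. 0)" and p: "p \<noteq> 0"
  shows "tact p 0 D \<beta> s u (excited \<rho> \<rho>' b g) = excited \<rho> \<rho>' b (D g) u"
proof (induction u)
  case (Cons w u)
  have D1: "D (\<lambda>w'. excited \<rho> \<rho>' b g (w' # u)) w = \<rho> ^ length u * cword b u * D g w"
  proof -
    have "(\<lambda>w'. excited \<rho> \<rho>' b g (w' # u)) = (\<lambda>w'. (\<rho> ^ length u * cword b u) * g w' + (\<rho>' * excited \<rho> \<rho>' b g u) * unitv b w')"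
      by (auto simp: unitv_def)
    then show ?thesis using fun_cong[OF kill] by (simp add: twoterm_lincomb[OF D])
  qed
  have 3: "p powi (wsum \<beta> u) * (\<rho> ^ length u * cword b u * D g w) = \<rho> ^ length u * cword b u * D g w"
    using cword_wsum[of b u "\<lambda>x. p powi x" \<beta>] by (cases "cword b u = 0") (simp_all add: \<beta>)
  have zero: "excited x y b (\<lambda>_. 0) u = 0" for x y
    using excited_scale[of x y b 0 "\<lambda>_. 0" u] by simp
  have X: "tact p 0 D \<beta> s u (\<lambda>u'. \<rho> ^ length u' * cword b u' * g w) = 0"
  proof -
    have "(\<lambda>u'. \<rho> ^ length u' * cword b u' * g w) = (\<lambda>u'. (\<rho> ^ length u' * g w) * cword b u')" by auto
    then show ?thesis
      using tact_length[OF D, of p 0 \<beta> s u "\<lambda>k. \<rho> ^ k * g w" "cword b"] tact_wb[OF D p, of s b 0 \<beta> u, OF s]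
      by (simp add: kill zero)
  qed
  have "tact p 0 D \<beta> s u (\<lambda>u'. excited \<rho> \<rho>' b g (w # u')) = (if w = b then \<rho>' else 0) * excited \<rho> \<rho>' b (D g) u"
  proof -
    have "(\<lambda>u'. excited \<rho> \<rho>' b g (w # u')) = (\<lambda>u'. 1 * (\<rho> ^ length u' * cword b u' * g w) + (if w = b then \<rho>' else 0) * excited \<rho> \<rho>' b g u')"
      by auto
    then show ?thesis using tact_lincomb[OF D, of p 0 \<beta> s u 1 "\<lambda>u'. \<rho> ^ length u' * cword b u' * g w" "if w = b then \<rho>' else 0" "excited \<rho> \<rho>' b g"]
      by (simp only: X Cons.IH) simp
  qed
  then show ?case using s \<beta> unfolding tact.simps(2) D1 by (auto simp: 3)
qed simp

lemma tact_replicate_row_zero: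
  assumes row: "\<And>g. D g b = 0"
  shows "tact p \<zeta> D \<beta> s (replicate k b) t = 0"
  by (induction k arbitrary: t) (simp_all add: row)

text \<open>D never produces the letter b, so on this word it can only have acted at the position of
  w.\<close>

lemma tact_word:
  assumes row: "\<And>g. D g b = 0" and s: "s b = 1" and p: "p \<noteq> 0"
  shows "tact p \<zeta> D \<beta> s (replicate i b @ w # replicate k b) t
    = p powi ((\<zeta> + \<beta> b) * (int k - int i)) * D (\<lambda>w'. t (replicate i b @ w' # replicate k b)) w"
proof (induction i arbitrary: t)
  case 0
  have "wsum \<beta> (replicate k b) = int k * \<beta> b"
    by (induction k) (auto simp: algebra_simps)
  then show ?case by (simp add: tact_replicate_row_zero[of D b, OF row] algebra_simps)
next
  case (Suc i)
  have "p powi ((\<zeta> + \<beta> b) * (int k - int (Suc i))) = p powi (- \<zeta> - \<beta> b) * p powi ((\<zeta> + \<beta> b) * (int k - int i))"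
    using p by (subst power_int_add[symmetric]) (auto simp: algebra_simps)
  then show ?case by (simp add: row s Suc)
qed

lemma tact_replicate:
  assumes D: "twoterm D" and s: "s b = 1" and p: "p \<noteq> 0"
  shows "tact p \<zeta> D \<beta> s (replicate a b) t
    = (\<Sum>i<a. p powi ((\<zeta> + \<beta> b) * (int (a - 1 - i) - int i)) * D (\<lambda>w'. t (replicate i b @ w' # replicate (a - 1 - i) b)) b)"
proof (induction a arbitrary: t)
  case (Suc a)
  have "wsum \<beta> (replicate a b) = int a * \<beta> b"
    by (induction a) (auto simp: algebra_simps)
  then have 1: "\<zeta> * int (length (replicate a b)) + wsum \<beta> (replicate a b) = (\<zeta> + \<beta> b) * int a" by (simp add: algebra_simps)
  have 2: "p powi (- \<zeta> - \<beta> b) * (p powi ((\<zeta> + \<beta> b) * (int (a - 1 - i) - int i)) * z) = p powi ((\<zeta> + \<beta> b) * (int (Suc a - 1 - Suc i) - int (Suc i))) * z" for i z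
  proof -
    have "(\<zeta> + \<beta> b) * (int (Suc a - 1 - Suc i) - int (Suc i)) = (- \<zeta> - \<beta> b) + (\<zeta> + \<beta> b) * (int (a - 1 - i) - int i)"
      by (simp add: algebra_simps)
    then show ?thesis using p by (simp only: power_int_add) (simp add: power_int_add)
  qed
  show ?case
    unfolding replicate_Suc tact.simps(2) 1 Suc.IH s mult_1_right sum_distrib_left 2 sum.lessThan_Suc_shift
    by simp
qed simp

lemma tact_power_shift:
  fixes p :: complex and \<zeta> c :: int and s :: "nat \<Rightarrow> complex" and \<beta> :: "nat \<Rightarrow> int"
  assumes D: "twoterm D" "shifts D \<beta> c" and p: "p \<noteq> 0"
  defines "X \<equiv> \<lambda>t u. tact p \<zeta> D \<beta> s u t"
  shows "p powi (wsum \<beta> u) * (X ^^ n) (cword b) u = p powi (int (length u) * \<beta> b + int n * c) * (X ^^ n) (cword b) u"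
proof (induction n arbitrary: u)
  case 0
  show ?case using cword_wsum[of b u "\<lambda>x. p powi x" \<beta>] by (simp add: mult.commute)
next
  case (Suc n)
  have "p powi (wsum \<beta> u) * X t u = p powi c * X (\<lambda>u. p powi (wsum \<beta> u) * t u) u" for t
    unfolding X_def tact_shifts[OF D(2,1), where f = "\<lambda>x. p powi x"]
    using p by (simp add: power_int_diff)
  then have "p powi (wsum \<beta> u) * (X ^^ Suc n) (cword b) u = p powi c * X (\<lambda>u. p powi (wsum \<beta> u) * (X ^^ n) (cword b) u) u"
    by simp
  also have "\<dots> = p powi c * X (\<lambda>u. p powi (int (length u) * \<beta> b + int n * c) * (X ^^ n) (cword b) u) u"
    by (simp add: Suc)
  also have "\<dots> = p powi c * p powi (int (length u) * \<beta> b + int n * c) * (X ^^ Suc n) (cword b) u"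
    unfolding X_def
    using tact_length[OF D(1), where f = "\<lambda>k. p powi (int k * \<beta> b + int n * c)"] by simp
  finally show ?case using p by (simp add: power_int_add[symmetric] algebra_simps)
qed

text \<open>Split off the first letter. As D kills b', this letter changes in at most one of the
  applications of X, and summing over which one gives \<gamma>, up to a power of p a geometric sum
  in p^4 or its inverse. It is nonzero because p is not a root of unity. The vanishing of one
  further power is what lets the induction drop the terms in which the first letter stays
  unchanged.\<close>

lemma tact_power_wb:
  fixes p c :: complex and \<zeta> :: int and s :: "nat \<Rightarrow> complex" and \<beta> :: "nat \<Rightarrow> int"
  assumes D: "twoterm D" "shifts D \<beta> (- 2 * \<beta> b)" and p: "p \<noteq> 0" "\<And>k. k > 0 \<Longrightarrow> p ^ k \<noteq> 1"
    and Db: "D (unitv b) = (\<lambda>w. c * unitv b' w)" "D (unitv b') = (\<lambda>_. 0)" and c: "c \<noteq> 0" and bb': "b \<noteq> b'"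
    and s: "s b = 1" "s b' = 1" and \<beta>: "\<beta> b' = - \<beta> b" "\<beta> b = 1 \<or> \<beta> b = - 1"
  defines "X \<equiv> \<lambda>t u. tact p \<zeta> D \<beta> s u t"
  shows "\<exists>C. C \<noteq> 0 \<and> (\<forall>u. length u = a \<longrightarrow> (X ^^ a) (cword b) u = C * cword b' u \<and> (X ^^ Suc a) (cword b) u = 0)"
proof (induction a)
  case 0
  show ?case by (intro exI[of _ 1]) (simp add: cword_def X_def)
next
  case (Suc k)
  then obtain C where C: "C \<noteq> 0" and IH: "\<And>u. length u = k \<Longrightarrow> (X ^^ k) (cword b) u = C * cword b' u" "\<And>u. length u = k \<Longrightarrow> (X ^^ Suc k) (cword b) u = 0"
    by blast
  define W where "W n = (X ^^ n) (cword b)" for n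
  define e where "e = (\<lambda>z. p powi z)"
  define \<gamma> where "\<gamma> n = c * (\<Sum>i<n. e ((int n - 1) * (\<beta> b - \<zeta>) + int k * (\<zeta> + \<beta> b) - 4 * \<beta> b * int i))" for n
  have e_add: "e (x + y) = e x * e y" for x y using p by (simp add: e_def power_int_add)
  have WS: "W (Suc n) = X (W n)" for n by (simp add: W_def)
  have Xlin: "X (\<lambda>u. x * t u) u = x * X t u" for x t u by (simp add: X_def tact_scale[OF D(1)])
  have \<gamma>S: "\<gamma> (Suc n) = c * e (\<zeta> * int k + int k * \<beta> b + int n * (- 2 * \<beta> b) + int n * (- \<zeta> - \<beta> b)) + e (- \<zeta> + \<beta> b) * \<gamma> n" for n
  proof -
    have "e (- \<zeta> + \<beta> b) * (\<Sum>i<n. e ((int n - 1) * (\<beta> b - \<zeta>) + int k * (\<zeta> + \<beta> b) - 4 * \<beta> b * int i))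
      = (\<Sum>i<n. e ((int (Suc n) - 1) * (\<beta> b - \<zeta>) + int k * (\<zeta> + \<beta> b) - 4 * \<beta> b * int i))"
      unfolding sum_distrib_left e_add[symmetric] by (intro sum.cong) (auto simp: algebra_simps)
    moreover have "\<zeta> * int k + int k * \<beta> b + int n * (- 2 * \<beta> b) + int n * (- \<zeta> - \<beta> b) = (int (Suc n) - 1) * (\<beta> b - \<zeta>) + int k * (\<zeta> + \<beta> b) - 4 * \<beta> b * int n"
      by (simp add: algebra_simps)
    ultimately show ?thesis unfolding \<gamma>_def sum.lessThan_Suc by (simp add: algebra_simps)
  qed
  have main: "W n (w # u) = unitv b w * (e (int n * (- \<zeta> - \<beta> b)) * W n u) + unitv b' w * (\<gamma> n * W (n - 1) u)"
    if "length u = k" for n w u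
    using that
  proof (induction n arbitrary: w u)
    case 0
    show ?case by (simp add: W_def cword_Cons \<gamma>_def e_def)
  next
    case (Suc n)
    have len: "length u = k" by fact
    have D1: "D (\<lambda>w'. W n (w' # u)) w = e (int n * (- \<zeta> - \<beta> b)) * W n u * c * unitv b' w"
    proof -
      have "(\<lambda>w'. W n (w' # u)) = (\<lambda>w'. (e (int n * (- \<zeta> - \<beta> b)) * W n u) * unitv b w' + (\<gamma> n * W (n - 1) u) * unitv b' w')"
        using Suc.IH[OF len] by auto
      then show ?thesis by (simp add: twoterm_lincomb[OF D(1)] Db)
    qed
    have X1: "X (\<lambda>u'. W n (w # u')) u = unitv b w * (e (int n * (- \<zeta> - \<beta> b)) * W (Suc n) u) + unitv b' w * (\<gamma> n * X (W (n - 1)) u)"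
    proof -
      have "X (\<lambda>u'. W n (w # u')) u = X (\<lambda>u'. (unitv b w * e (int n * (- \<zeta> - \<beta> b))) * W n u' + (unitv b' w * \<gamma> n) * W (n - 1) u') u"
        unfolding X_def by (rule tact_cong) (simp add: Suc.IH len)
      then show ?thesis unfolding X_def tact_lincomb[OF D(1)] WS by (simp add: X_def)
    qed
    \<comment> \<open>For n = 0 the truncated index n - 1 is harmless because \<gamma> 0 =
      0.\<close>
    have X2: "\<gamma> n * X (W (n - 1)) u = \<gamma> n * W n u"
      by (cases n) (simp_all add: \<gamma>_def WS)
    have sh: "e (wsum \<beta> u) * W n u = e (int k * \<beta> b + int n * (- 2 * \<beta> b)) * W n u"
      using tact_power_shift[OF D p(1), of u n \<zeta> s b] len by (simp add: W_def e_def X_def)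
    have "W (Suc n) (w # u) = e (\<zeta> * int k + wsum \<beta> u) * (e (int n * (- \<zeta> - \<beta> b)) * W n u * c * unitv b' w)
        + e (- \<zeta> - \<beta> w) * s w * X (\<lambda>u'. W n (w # u')) u"
      unfolding WS D1[symmetric] by (simp add: X_def e_def len)
    also have "e (\<zeta> * int k + wsum \<beta> u) * (e (int n * (- \<zeta> - \<beta> b)) * W n u * c * unitv b' w)
       = e (\<zeta> * int k) * e (int n * (- \<zeta> - \<beta> b)) * c * unitv b' w * (e (wsum \<beta> u) * W n u)" by (simp add: e_add mult_ac)
    also have "e (- \<zeta> - \<beta> w) * s w * X (\<lambda>u'. W n (w # u')) u
       = unitv b w * (e (int (Suc n) * (- \<zeta> - \<beta> b)) * W (Suc n) u) + unitv b' w * (e (- \<zeta> + \<beta> b) * \<gamma> n * W n u)"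
    proof -
      have "int (Suc n) * (- \<zeta> - \<beta> b) = (- \<zeta> - \<beta> b) + int n * (- \<zeta> - \<beta> b)" by (simp add: algebra_simps)
      then have "e (int (Suc n) * (- \<zeta> - \<beta> b)) = e (- \<zeta> - \<beta> b) * e (int n * (- \<zeta> - \<beta> b))" by (simp only: e_add)
      then show ?thesis using bb' s \<beta>(1) X2 unfolding X1 by (auto simp: unitv_def)
    qed
    finally show ?case unfolding sh \<gamma>S by (simp only: e_add distrib_left distrib_right mult_ac add_ac diff_Suc_1)
  qed
  have \<gamma>nz: "\<gamma> (Suc k) \<noteq> 0"
  proof -
    define x where "x = e (- 4 * \<beta> b)"
    have ex: "e (- 4 * \<beta> b * int i) = x ^ i" for i
      unfolding x_def e_def by (simp only: power_int_mult power_int_of_nat)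
    have x: "x = inverse (p ^ 4) \<or> x = p ^ 4" using \<beta>(2) by (auto simp: x_def e_def power_int_minus)
    then have x1: "x ^ j \<noteq> 1" if "j > 0" for j
      using p(2)[of "4 * j"] that p(1) by (auto simp: power_mult[symmetric] power_inverse inverse_eq_1_iff)
    have "(\<Sum>i<Suc k. x ^ i) \<noteq> 0"
      using x1[of 1] x1[of "Suc k"] geometric_sum[of x "Suc k"] by auto
    moreover have "\<gamma> (Suc k) = c * e ((int (Suc k) - 1) * (\<beta> b - \<zeta>) + int k * (\<zeta> + \<beta> b)) * (\<Sum>i<Suc k. x ^ i)"
    proof -
      have "e ((int (Suc k) - 1) * (\<beta> b - \<zeta>) + int k * (\<zeta> + \<beta> b) - 4 * \<beta> b * int i) =
         e ((int (Suc k) - 1) * (\<beta> b - \<zeta>) + int k * (\<zeta> + \<beta> b)) * x ^ i" for i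
        unfolding ex[symmetric] e_add[symmetric] by (simp add: algebra_simps)
      then show ?thesis unfolding \<gamma>_def by (simp only: sum_distrib_left mult.assoc)
    qed
    moreover have "e z \<noteq> 0" for z using p by (simp add: e_def)
    ultimately show ?thesis using c by simp
  qed
  have z: "W (Suc (Suc k)) u = 0" if "length u = k" for u
  proof -
    have "W (Suc (Suc k)) u = X (W (Suc k)) u" by (simp add: WS)
    also have "\<dots> = X (\<lambda>u. 0) u" unfolding X_def by (rule tact_cong) (simp add: W_def IH that del: funpow.simps)
    finally show ?thesis by (simp add: X_def tact_zero[OF D(1)])
  qed
  show ?case
  proof (intro exI[of _ "\<gamma> (Suc k) * C"] conjI allI impI)
    show "\<gamma> (Suc k) * C \<noteq> 0" using \<gamma>nz C by simp
    fix u :: "nat list" assume "length u = Suc k"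
    then obtain w v where u: "u = w # v" and v: "length v = k" by (cases u) auto
    have W1: "W (Suc k) v = 0" "W k v = C * cword b' v" using IH v by (auto simp: W_def simp del: funpow.simps)
    show "(X ^^ Suc k) (cword b) u = \<gamma> (Suc k) * C * cword b' u"
      using main[OF v, of "Suc k" w] W1 by (simp add: u W_def[symmetric] cword_Cons mult_ac del: funpow.simps)
    show "(X ^^ Suc (Suc k)) (cword b) u = 0"
      using main[OF v, of "Suc (Suc k)" w] W1 z[OF v] by (simp add: u W_def[symmetric] del: funpow.simps)
  qed
qed

context osp begin

section \<open>The action on tensors\<close>

text \<open>
  The exponent \<open>- 2\<close> makes the coefficients of $E_0 1^a$ proportional to those of $F_{h+1} 1^a$, up to
  renaming the excited letter.
\<close>

definition zexp :: "nat \<Rightarrow> int" where "zexp i = (if i = 0 then - 2 else 0)"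

definition EE where "EE i t = (\<lambda>u. tact p (zexp i) (DE i) (B i) (sgn_op i) u t)"
text \<open>The opposite exponent makes the spectral parameters cancel in the commutator with
  \<open>EE i\<close>. For different nodes the commutator on a letter is already zero, whatever the
  exponents are.\<close>

definition FF where "FF i t = (\<lambda>u. tact p (- zexp i) (DF i) (B i) (sgn_op i) u t)"
definition KK where "KK i t = (\<lambda>u. p powi (wsum (B i) u) * t u)" for t :: "nat list \<Rightarrow> complex"
definition KI where "KI i t = (\<lambda>u. p powi (- wsum (B i) u) * t u)" for t :: "nat list \<Rightarrow> complex"

lemma lin_ops: "lin sT (EE i)" "lin sT (FF i)" "lin sT (KK i)" "lin sT (KI i)"
  by (auto simp: lin_def EE_def FF_def KK_def KI_def sT_def fun_eq_iff plus_fun_def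
      tact_add[OF twoterm_DE] tact_add[OF twoterm_DF] tact_scale[OF twoterm_DE] tact_scale[OF twoterm_DF] algebra_simps)

lemma KK_KI: "KK i (KI i t) = t" "KI i (KK i t) = t"
  using p0 by (simp_all add: KK_def KI_def power_int_minus fun_eq_iff)

lemma K_comm: "KK i (KK j t) = KK j (KK i t)" "KI i (KI j t) = KI j (KI i t)" "KK i (KI j t) = KI j (KK i t)"
  by (simp_all add: KK_def KI_def fun_eq_iff)

lemma K_EF:
  assumes "j \<le> s"
  shows "KK i (EE j t) = sT (p powi rform i j) (EE j (KK i t))"
    "KI i (EE j t) = sT (p powi (- rform i j)) (EE j (KI i t))"
    "KK i (FF j t) = sT (p powi (- rform i j)) (FF j (KK i t))"
    "KI i (FF j t) = sT (p powi rform i j) (FF j (KI i t))"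
proof -
  note E = tact_shifts[OF shifts_B(1)[OF assms, of i] twoterm_DE] and F = tact_shifts[OF shifts_B(2)[OF assms, of i] twoterm_DF]
  show "KK i (EE j t) = sT (p powi rform i j) (EE j (KK i t))"
    unfolding KK_def EE_def E[where f = "\<lambda>x. p powi x"] sT_def using p0 by (auto simp: power_int_diff)
  show "KI i (EE j t) = sT (p powi (- rform i j)) (EE j (KI i t))"
    unfolding KI_def EE_def E[where f = "\<lambda>x. p powi (- x)"] sT_def using p0 by (auto simp: power_int_diff power_int_minus field_simps)
  show "KK i (FF j t) = sT (p powi (- rform i j)) (FF j (KK i t))"
    unfolding KK_def FF_def F[where f = "\<lambda>x. p powi x"] sT_def using p0 by (auto simp: power_int_add power_int_minus)
  show "KI i (FF j t) = sT (p powi rform i j) (FF j (KI i t))"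
    unfolding KI_def FF_def F[where f = "\<lambda>x. p powi (- x)"] sT_def using p0 by (auto simp: power_int_diff power_int_minus power_int_add field_simps)
qed

abbreviation (input) dq :: complex where "dq \<equiv> 1 / (p\<^sup>2 - 1 / p\<^sup>2)"

lemma sgn_op_sq: "sgn_op i l * sgn_op i l = 1"
  by (simp add: sgn_op_def)

lemma EE_FF:
  assumes "i \<le> s" "j \<le> s"
  shows "EE i (FF j t) = sT (parity_sign (par i * par j)) (FF j (EE i t))
     + (if i = j then sT dq (KK i (KK i t) - KI i (KI i t)) else 0)"
proof
  fix u
  define e where "e = parity_sign (par i * par j)"
  have sh: "shifts (DF j) (B i) (- rform j i)" using shifts_B(2)[OF assms(2), of i] rform_sym[OF assms] by simp
  have sg: "signs (DF j) (sgn_op i) e" using signs_op(2)[OF assms(2), of i] unfolding e_def by (simp only: mult.commute)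
  have ee: "e * e = 1" by (simp add: e_def)
  define Q where "Q = (if i = j then \<lambda>l. (p powi (2 * B i l) - p powi (- 2 * B i l)) / (p\<^sup>2 - 1 / p\<^sup>2) else (\<lambda>_. 0))"
  have comm: "DE i (DF j g) l - e * DF j (DE i g) l = Q l * g l" for g l
    using letter_comm[OF assms, of g l] letter_comm_same[OF assms(1), of g l] by (auto simp: Q_def e_def)
  have "EE i (FF j t) u - e * FF j (EE i t) u
      = tcomm p (zexp i + - zexp j) (\<lambda>w. B i w + B j w) (\<lambda>w. sgn_op i w * sgn_op j w) Q u * t u"
    unfolding EE_def FF_def
    by (rule tact_commutator[OF p0 twoterm_DE twoterm_DF shifts_B(1)[OF assms(1)] sh signs_op(1)[OF assms(1), of j, folded e_def] sg ee comm])
  also have "\<dots> = (if i = j then sT dq (KK i (KK i t) - KI i (KI i t)) else 0) u"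
  proof (cases "i = j")
    case True
    have pp: "p powi (2 * x) = p powi x * p powi x" "p powi (- 2 * x) = p powi (- x) * p powi (- x)" for x
      using p0 by (simp_all add: power_int_add[symmetric])
    have z: "zexp i + - zexp j = 0" using True by simp
    have tc: "tcomm p (zexp i + - zexp j) (\<lambda>w. B i w + B j w) (\<lambda>w. sgn_op i w * sgn_op j w) Q u
       = (p powi (2 * wsum (B j) u) - p powi (- 2 * wsum (B j) u)) / (p\<^sup>2 - 1 / p\<^sup>2)"
      unfolding z Q_def if_P[OF True] unfolding True
      by (rule tcomm_qnumber[OF p0, of "sgn_op j" "B j" "p\<^sup>2 - 1 / p\<^sup>2" u, OF sgn_op_sq])
    show ?thesis unfolding tc if_P[OF True] pp using True
      by (simp add: KK_def KI_def sT_apply algebra_simps diff_divide_distrib)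
  next
    case False
    then show ?thesis by (simp add: Q_def tcomm_zero)
  qed
  finally show "EE i (FF j t) u = (sT (parity_sign (par i * par j)) (FF j (EE i t))
     + (if i = j then sT dq (KK i (KK i t) - KI i (KI i t)) else 0)) u"
    by (simp add: e_def algebra_simps sT_apply)
qed

lemma sT_sign_cancel: "sT (parity_sign d) (sT (parity_sign d) t) = t"
  by (simp add: sT_def mult.assoc[symmetric])

lemma sT_add: "sT c (t + t') = sT c t + sT c t'" and sT_diff: "sT c (t - t') = sT c t - sT c t'"
  and sT_sT: "sT c (sT d t) = sT (c * d) t" and sT_1 [simp]: "sT 1 t = t" and sT_0 [simp]: "sT c 0 = 0" "sT 0 t = 0"
  and sT_uminus: "sT (- c) t = - sT c t"
  by (auto simp: sT_def fun_eq_iff algebra_simps)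

lemma FF_EE:
  assumes "i \<le> s" "j \<le> s"
  shows "FF i (EE j t) = sT (parity_sign (par i * par j)) (EE j (FF i t))
     + (if i = j then sT (- parity_sign (par i) * dq) (KK i (KK i t) - KI i (KI i t)) else 0)"
proof -
  have "sT (parity_sign (par i * par j)) (EE j (FF i t)) = FF i (EE j t) + sT (parity_sign (par i * par j)) (if j = i then sT dq (KK j (KK j t) - KI j (KI j t)) else 0)"
    unfolding EE_FF[OF assms(2,1)] sT_add by (simp only: mult.commute[of "par j"] sT_sign_cancel)
  moreover have "par i * par i = par i" by (cases "par i") auto
  ultimately show ?thesis by (auto simp: sT_sT sT_uminus)
qed

definition Par where "Par t = (\<lambda>u. wprod (\<lambda>l. if fermionic l then - 1 else 1) u * t u)" for t :: "nat list \<Rightarrow> complex"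

lemma PP_ops:
  assumes "i \<le> s"
  shows "EE i (Par t) = sT (parity_sign (par i)) (Par (EE i t))" "FF i (Par t) = sT (parity_sign (par i)) (Par (FF i t))"
    "KK i (Par t) = Par (KK i t)" "KI i (Par t) = Par (KI i t)"
proof -
  have "signs (DE i) (\<lambda>l. if fermionic l then - 1 else 1) (parity_sign (par i))"
    "signs (DF i) (\<lambda>l. if fermionic l then - 1 else 1) (parity_sign (par i))"
    using node_range[OF assms] bar_src_tgt[OF assms] by (auto simp: signs_def DE_def DF_def par_def fermionic_bar)
  then show "EE i (Par t) = sT (parity_sign (par i)) (Par (EE i t))" "FF i (Par t) = sT (parity_sign (par i)) (Par (FF i t))"
    by (simp_all add: EE_def FF_def Par_def sT_def tact_signs[OF _ twoterm_DE] tact_signs[OF _ twoterm_DF] fun_eq_iff)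
qed (simp_all add: KK_def KI_def Par_def fun_eq_iff)

lemma lin_PP: "lin sT Par" and PP_PP: "Par (Par t) = t"
proof -
  show "lin sT Par" by (auto simp: lin_def Par_def sT_def fun_eq_iff plus_fun_def algebra_simps)
  have "wprod (\<lambda>l. if fermionic l then - 1 else 1) u * wprod (\<lambda>l. if fermionic l then - 1 else (1::complex)) u = 1" for u
    by (induction u) (auto simp: algebra_simps)
  then show "Par (Par t) = t" by (simp add: Par_def fun_eq_iff mult.assoc[symmetric])
qed

text \<open>The nodes of osp(m|n) whose roots do not involve \<delta>_1. Their operators neither
  change nor produce the letters 1 and N, see \<open>inner_end\<close>.\<close>

definition inner :: "nat \<Rightarrow> bool" where "inner j \<longleftrightarrow> 1 \<le> j \<and> j \<le> s \<and> j \<noteq> h + 1"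

lemma h1_le_s: "h + 1 \<le> s" "h + 1 < s"
  using params(1,2) by auto

lemma inner_range:
  assumes "inner j" 
  shows "2 \<le> src j" "src j < N" "2 \<le> tgt j" "tgt j < N" "src j < N - 1" "3 \<le> src j" "tgt j < N - 1"
proof -
  from assms have j: "1 \<le> j" "j \<le> s" "j \<noteq> h + 1" by (auto simp: inner_def)
  have s3: "even m \<Longrightarrow> 3 \<le> s" using N_cases(2) N_cases(4) params(1) by linarith
  have "2 \<le> src j \<and> src j < N - 1 \<and> 2 \<le> tgt j \<and> tgt j < N - 1 \<and> 3 \<le> src j"
    using node_disj[OF j(2)]
  proof (elim disjE exE conjE)
    fix l assume l: "1 \<le> l" "l \<le> s" "src j = l + 1" "tgt j = l" "node_at j l" "l = s \<longrightarrow> odd m"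
    have "l \<noteq> 1" using l(5) j(3) node_at_1[of j] by blast
    moreover have "l + 1 < N - 1"
    proof (cases "l = s")
      case True then show ?thesis using l N_cases(1,2) N_ge_5 by auto
    next
      case False then show ?thesis using l N_cases(1,2) N_ge_5 by auto
    qed
    ultimately show ?thesis using l by auto
  next
    assume "even m" "src j = s + 1" "tgt j = s - 1"
    then show ?thesis using s3 N_cases(1) by auto
  qed (use j in auto)
  then show "2 \<le> src j" "src j < N" "2 \<le> tgt j" "tgt j < N" "src j < N - 1" "3 \<le> src j" "tgt j < N - 1" by auto
qed

lemma inner_end:
  assumes "inner j" "b = 1 \<or> b = N"
  shows "DE j (unitv b) = (\<lambda>_. 0)" "DF j (unitv b) = (\<lambda>_. 0)" "B j b = 0" "sgn_op j b = 1" "DE j g b = 0" "DF j g b = 0"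
proof -
  note r = inner_range[OF assms(1)]
  have ne: "src j \<noteq> b" "tgt j \<noteq> b" "b \<noteq> src j" "b \<noteq> tgt j" "bar (src j) \<noteq> b" "bar (tgt j) \<noteq> b" "b \<noteq> bar (src j)" "b \<noteq> bar (tgt j)"
      "src j \<noteq> bar b" "tgt j \<noteq> bar b"
    using assms(2) r by (auto simp: bar_def)
  show "DE j (unitv b) = (\<lambda>_. 0)" "DF j (unitv b) = (\<lambda>_. 0)" "DE j g b = 0" "DF j g b = 0" "B j b = 0"
    using ne by (auto simp: DE_def DF_def unitv_def B_def lform_def)
  show "sgn_op j b = 1" using assms(2) params(1,3) by (auto simp: sgn_op_def fermionic_def)
qed

lemma end_distinct: "(1::nat) \<noteq> 2" "(2::nat) \<noteq> 1" "N \<noteq> 1" "N \<noteq> 2" "N - 1 \<noteq> 1" "N - 1 \<noteq> 2" "N - 1 \<noteq> N"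
  "1 \<noteq> N" "2 \<noteq> N" "1 \<noteq> N - 1" "2 \<noteq> N - 1" "N \<noteq> N - 1"
  using N_ge_5 by auto

lemma end_values:
  "DF (h + 1) (unitv 1) = (\<lambda>w. - 1 * unitv 2 w)" "DF (h + 1) (unitv 2) = (\<lambda>_. 0)" "DF (h + 1) (unitv (N - 1)) = (\<lambda>w. - 1 * unitv N w)" "DF (h + 1) (unitv N) = (\<lambda>_. 0)"
  "DE (h + 1) (unitv 2) = (\<lambda>w. 1 * unitv 1 w)" "DE (h + 1) (unitv 1) = (\<lambda>_. 0)" "DE (h + 1) (unitv N) = (\<lambda>w. 1 * unitv (N - 1) w)" "DE (h + 1) (unitv (N - 1)) = (\<lambda>_. 0)"
  "DE 0 (unitv 1) = (\<lambda>w. 1 * unitv (N - 1) w)" "DE 0 (unitv (N - 1)) = (\<lambda>_. 0)" "DE 0 (unitv 2) = (\<lambda>w. 1 * unitv N w)" "DE 0 (unitv N) = (\<lambda>_. 0)"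
  "DF 0 (unitv (N - 1)) = (\<lambda>w. - 1 * unitv 1 w)" "DF 0 (unitv 1) = (\<lambda>_. 0)" "DF 0 (unitv N) = (\<lambda>w. - 1 * unitv 2 w)" "DF 0 (unitv 2) = (\<lambda>_. 0)"
  "B (h + 1) 1 = - 1" "B (h + 1) 2 = 1" "B (h + 1) (N - 1) = - 1" "B (h + 1) N = 1"
  "B 0 1 = 1" "B 0 2 = 1" "B 0 (N - 1) = - 1" "B 0 N = - 1"
  "sgn_op (h + 1) l = 1" "sgn_op 0 l = 1" "rform (h + 1) (h + 1) = - 2" "rform 0 0 = - 2" "rform (h + 1) 0 = 0" "rform 0 (h + 1) = 0"
  "par (h + 1) = 0" "par 0 = 0"
proof -
  have gs: "lsign 1 = - 1" "lsign 2 = - 1" "lsign (N - 1) = - 1" by (simp_all only: lsign_def end_letters if_False)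
  have gN: "lsign N = - 1" using lsign_bar[of 1] gs N_ge_5 by (simp only: end_letters(4))
  note ne = end_distinct
  note [simp del] = One_nat_def diff_Suc_1
  show "DF (h + 1) (unitv 1) = (\<lambda>w. - 1 * unitv 2 w)" "DF (h + 1) (unitv 2) = (\<lambda>_. 0)" "DF (h + 1) (unitv (N - 1)) = (\<lambda>w. - 1 * unitv N w)" "DF (h + 1) (unitv N) = (\<lambda>_. 0)"
  "DE (h + 1) (unitv 2) = (\<lambda>w. 1 * unitv 1 w)" "DE (h + 1) (unitv 1) = (\<lambda>_. 0)" "DE (h + 1) (unitv N) = (\<lambda>w. 1 * unitv (N - 1) w)" "DE (h + 1) (unitv (N - 1)) = (\<lambda>_. 0)"
  "DE 0 (unitv 1) = (\<lambda>w. 1 * unitv (N - 1) w)" "DE 0 (unitv (N - 1)) = (\<lambda>_. 0)" "DE 0 (unitv 2) = (\<lambda>w. 1 * unitv N w)" "DE 0 (unitv N) = (\<lambda>_. 0)"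
  "DF 0 (unitv (N - 1)) = (\<lambda>w. - 1 * unitv 1 w)" "DF 0 (unitv 1) = (\<lambda>_. 0)" "DF 0 (unitv N) = (\<lambda>w. - 1 * unitv 2 w)" "DF 0 (unitv 2) = (\<lambda>_. 0)"
    by (simp_all add: fun_eq_iff DE_def DF_def unitv_def end_letters(1-7,9-12) gs gN ne)
  show 1: "B (h + 1) 1 = - 1" "B (h + 1) 2 = 1" "B (h + 1) (N - 1) = - 1" "B (h + 1) N = 1"
   "B 0 1 = 1" "B 0 2 = 1" "B 0 (N - 1) = - 1" "B 0 N = - 1"
    by (simp_all add: B_def lform_def end_letters(1-7,9-12) gs gN ne)
  show "rform (h + 1) (h + 1) = - 2" "rform 0 0 = - 2" "rform (h + 1) 0 = 0" "rform 0 (h + 1) = 0" unfolding rform_def end_letters 1 by simp_all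
  show "par (h + 1) = 0" "par 0 = 0" unfolding par_def end_letters by simp_all
  then show "sgn_op (h + 1) l = 1" "sgn_op 0 l = 1" by (simp_all add: sgn_op_def)
qed

lemma EE_trunc: "EE i (trunc a t) = trunc a (EE i t)" and FF_trunc: "FF i (trunc a t) = trunc a (FF i t)"
  by (simp_all add: EE_def FF_def fun_eq_iff tact_trunc[OF twoterm_DE] tact_trunc[OF twoterm_DF])

lemma trunc_sT: "trunc a (sT c t) = sT c (trunc a t)"
  by (simp add: trunc_def sT_def fun_eq_iff)

lemma excited_sT: "excited \<rho> \<rho>' b (\<lambda>w. c * g w) = sT c (excited \<rho> \<rho>' b g)"
  by (simp add: sT_def fun_eq_iff excited_scale)

lemma excited_zero: "excited \<rho> \<rho>' b (\<lambda>_. 0) = 0"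
  using excited_sT[of \<rho> \<rho>' b 0 "\<lambda>_. 0"] by simp

lemma trunc_zero: "trunc a 0 = 0"
  by (simp add: trunc_def fun_eq_iff)

lemma inner_wb:
  assumes "inner j" "b = 1 \<or> b = N"
  shows "EE j (trunc a (cword b)) = 0" "FF j (trunc a (cword b)) = 0"
proof -
  have "EE j (cword b) = 0" "FF j (cword b) = 0"
    unfolding EE_def FF_def tact_wb[where s = "sgn_op j" and b = b, OF twoterm_DE p0 inner_end(4)[OF assms]]
      tact_wb[where s = "sgn_op j" and b = b, OF twoterm_DF p0 inner_end(4)[OF assms]]
      inner_end(1,2)[OF assms] excited_zero by (simp_all add: fun_eq_iff)
  then show "EE j (trunc a (cword b)) = 0" "FF j (trunc a (cword b)) = 0" by (simp_all add: EE_trunc FF_trunc trunc_zero)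
qed

lemma inner_exc:
  assumes "inner j" "b = 1 \<or> b = N"
  shows "EE j (trunc a (excited \<rho> \<rho>' b g)) = trunc a (excited \<rho> \<rho>' b (DE j g))" "FF j (trunc a (excited \<rho> \<rho>' b g)) = trunc a (excited \<rho> \<rho>' b (DF j g))"
proof -
  have "zexp j = 0" using assms by (simp add: zexp_def inner_def)
  then show "EE j (trunc a (excited \<rho> \<rho>' b g)) = trunc a (excited \<rho> \<rho>' b (DE j g))" "FF j (trunc a (excited \<rho> \<rho>' b g)) = trunc a (excited \<rho> \<rho>' b (DF j g))"
    using tact_exc[OF twoterm_DE, of "sgn_op j" b "B j" j p, OF inner_end(4)[OF assms] inner_end(3)[OF assms] inner_end(1)[OF assms] p0] 
      tact_exc[OF twoterm_DF, of "sgn_op j" b "B j" j p, OF inner_end(4)[OF assms] inner_end(3)[OF assms] inner_end(2)[OF assms] p0]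
    unfolding EE_trunc FF_trunc by (simp_all add: EE_def FF_def)
qed

abbreviation (input) "XS l \<equiv> excited (p powi (- 1)) (p powi 1) 1 (unitv l)"
abbreviation (input) "YS l \<equiv> excited (p powi 1) (p powi (- 1)) N (unitv l)"

lemma end_wb:
  "FF (h + 1) (trunc a (cword 1)) = sT (- 1) (trunc a (XS 2))" "EE (h + 1) (trunc a (cword 1)) = 0"
  "EE 0 (trunc a (cword 1)) = trunc a (XS (N - 1))" "FF 0 (trunc a (cword 1)) = 0"
  "EE (h + 1) (trunc a (cword N)) = trunc a (YS (N - 1))" "FF (h + 1) (trunc a (cword N)) = 0"
  "FF 0 (trunc a (cword N)) = sT (- 1) (trunc a (YS 2))" "EE 0 (trunc a (cword N)) = 0"
proof -
  have z: "zexp (h + 1) = 0" "zexp 0 = - 2" by (simp_all add: zexp_def)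
  note w = tact_wb[where s = "sgn_op (h + 1)", OF twoterm_DE p0 end_values(25)] tact_wb[where s = "sgn_op (h + 1)", OF twoterm_DF p0 end_values(25)]
    tact_wb[where s = "sgn_op 0", OF twoterm_DE p0 end_values(26)] tact_wb[where s = "sgn_op 0", OF twoterm_DF p0 end_values(26)]
  show "FF (h + 1) (trunc a (cword 1)) = sT (- 1) (trunc a (XS 2))" "EE (h + 1) (trunc a (cword 1)) = 0"
  "EE 0 (trunc a (cword 1)) = trunc a (XS (N - 1))" "FF 0 (trunc a (cword 1)) = 0"
  "EE (h + 1) (trunc a (cword N)) = trunc a (YS (N - 1))" "FF (h + 1) (trunc a (cword N)) = 0"
  "FF 0 (trunc a (cword N)) = sT (- 1) (trunc a (YS 2))" "EE 0 (trunc a (cword N)) = 0"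
    unfolding EE_trunc FF_trunc unfolding EE_def FF_def z w end_values excited_sT excited_zero
    by (simp_all only: trunc_sT trunc_zero sT_1) (simp_all add: trunc_def fun_eq_iff)
qed


section \<open>The cyclic module generated by the highest word\<close>

text \<open>The first letter is the higher one: F_j leads from l to l' and E_j back, along the
  defining arrow of node j or its mirror image.\<close>

definition arrow :: "nat \<Rightarrow> nat \<Rightarrow> nat \<Rightarrow> bool" where
  "arrow j l l' \<longleftrightarrow> l = tgt j \<and> l' = src j \<or> l = bar (src j) \<and> l' = bar (tgt j)"

primrec path :: "nat list \<Rightarrow> nat \<Rightarrow> nat \<Rightarrow> bool" where
  "path [] l l' \<longleftrightarrow> l = l'"
| "path (j # js) l l' \<longleftrightarrow> inner j \<and> (\<exists>k. arrow j l k \<and> path js k l')"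

lemma path_append: "path (js @ js') l l' \<longleftrightarrow> (\<exists>k. path js l k \<and> path js' k l')"
  by (induction js arbitrary: l) auto

lemma arrow_letters:
  assumes "inner j" "arrow j l l'"
  shows "DE j g l = g l'" "\<exists>c. c * c = 1 \<and> (\<forall>g. DF j g l' = c * g l)"
    "DE j (unitv l') = unitv l" "\<exists>c. c * c = 1 \<and> DF j (unitv l) = (\<lambda>w. c * unitv l' w)"
proof -
  have j: "j \<le> s" using assms(1) by (simp add: inner_def)
  note r = node_range[OF j] bar_src_tgt[OF j]
  have gs: "of_int (lsign k) * of_int (lsign k) = (1::complex)" for k by (metis lsign_sq of_int_1 of_int_mult)
  have ne: "bar (src j) \<noteq> tgt j" "tgt j \<noteq> bar (src j)" "src j \<noteq> bar (tgt j)" "bar (tgt j) \<noteq> src j"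
    using r by metis+
  have cases: "l = tgt j \<and> l' = src j \<or> l = bar (src j) \<and> l' = bar (tgt j)"
    using assms(2) by (simp add: arrow_def)
  show "DE j g l = g l'" using cases ne by (auto simp: DE_def)
  show "\<exists>c. c * c = 1 \<and> (\<forall>g. DF j g l' = c * g l)"
    using cases
  proof (elim disjE conjE)
    assume "l = tgt j" "l' = src j"
    then show ?thesis using ne gs by (intro exI[of _ "of_int (lsign (tgt j))"]) (simp add: DF_def)
  next
    assume "l = bar (src j)" "l' = bar (tgt j)"
    then show ?thesis using ne gs by (intro exI[of _ "of_int (lsign (src j))"]) (simp add: DF_def)
  qed
  have bb: "bar (tgt j) = bar x \<longleftrightarrow> x = tgt j" "bar (src j) = bar x \<longleftrightarrow> x = src j" if "1 \<le> x" "x \<le> N" for x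
    using bar_inj[of x] that by metis+
  show "DE j (unitv l') = unitv l"
    using cases
  proof (elim disjE conjE)
    assume "l = tgt j" "l' = src j"
    then show ?thesis using ne by (auto simp: DE_def unitv_def fun_eq_iff)
  next
    assume "l = bar (src j)" "l' = bar (tgt j)"
    then show ?thesis using ne by (auto simp: DE_def unitv_def fun_eq_iff)
  qed
  show "\<exists>c. c * c = 1 \<and> DF j (unitv l) = (\<lambda>w. c * unitv l' w)"
    using cases
  proof (elim disjE conjE)
    assume "l = tgt j" "l' = src j"
    then show ?thesis using ne gs by (intro exI[of _ "of_int (lsign (tgt j))"]) (auto simp: DF_def unitv_def fun_eq_iff)
  next
    assume "l = bar (src j)" "l' = bar (tgt j)"
    then show ?thesis using ne gs by (intro exI[of _ "of_int (lsign (src j))"]) (auto simp: DF_def unitv_def fun_eq_iff)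
  qed
qed

definition node_of :: "nat \<Rightarrow> nat" where "node_of l = (if l \<le> r then l + h else l - r)"

lemma node_of:
  assumes "2 \<le> l" "l \<le> s" "l = s \<longrightarrow> odd m"
  shows "inner (node_of l)" "src (node_of l) = l + 1" "tgt (node_of l) = l"
proof -
  define i where "i = node_of l"
  show "inner (node_of l)"
    using assms params(1,2) by (auto simp: inner_def node_of_def)
  show "src (node_of l) = l + 1" "tgt (node_of l) = l"
  proof -
    have "l \<le> r \<and> i = l + h \<or> l > r \<and> i = l - r \<and> i \<noteq> 0 \<and> (i < h \<or> i = h \<and> odd m)"
      using assms params(2) by (auto simp: i_def node_of_def)
    then show "src (node_of l) = l + 1" "tgt (node_of l) = l"
      unfolding i_def[symmetric] using assms(1) by (auto simp: src_def tgt_def)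
  qed
qed

lemma path_up:
  assumes "2 \<le> l" "l \<le> k" "k \<le> s + 1" "k = s + 1 \<longrightarrow> odd m"
  shows "\<exists>js. path js l k"
  using assms(2-)
proof (induction k rule: dec_induct)
  case base
  show ?case by (intro exI[of _ "[]"]) simp
next
  case (step k)
  then obtain js where "path js l k" by auto
  moreover have k: "2 \<le> k" "k \<le> s" "k = s \<longrightarrow> odd m" using step assms(1) by auto
  have "path [node_of k] k (Suc k)"
    using node_of[OF k] by (auto simp: arrow_def)
  ultimately show ?case using path_append by blast
qed

lemma path_down:
  assumes "2 \<le> l" "l \<le> k" "k \<le> s + 1" "k = s + 1 \<longrightarrow> odd m"
  shows "\<exists>js. path js (bar k) (bar l)"
  using assms(2-)
proof (induction k rule: dec_induct)
  case base
  show ?case by (intro exI[of _ "[]"]) simp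
next
  case (step k)
  then obtain js where "path js (bar k) (bar l)" by auto
  moreover have k: "2 \<le> k" "k \<le> s" "k = s \<longrightarrow> odd m" using step assms(1) by auto
  have "path [node_of k] (bar (Suc k)) (bar k)"
    using node_of[OF k] by (auto simp: arrow_def)
  ultimately show ?case using path_append[of "[node_of k]"] by (metis append_Cons append_Nil)
qed

text \<open>Go to the middle of the alphabet and return by the mirror image. For odd m the two
  halves meet in the letter of weight 0; for even m the fork jumps from s to s + 2 =
  \<open>bar (s - 1)\<close>.\<close>

lemma path_exists: "\<exists>js. path js 2 (N - 1)"
proof (cases "odd m")
  case True
  then have "N = 2 * s + 1" using N_cases(1) by blast
  then have "bar (s + 1) = s + 1" by (simp add: bar_def)
  moreover obtain js where "path js 2 (s + 1)" using path_up[of 2 "s + 1"] True N_cases(2) by auto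
  moreover obtain js' where "path js' (bar (s + 1)) (bar 2)" using path_down[of 2 "s + 1"] True N_cases(2) by auto
  ultimately show ?thesis using path_append end_letters(5) by metis
next
  case False
  then have N: "N = 2 * s" using N_cases(1) by blast
  have s3: "3 \<le> s" using N_cases(4) params(1) False by linarith
  have h1: "1 \<le> h" using params(4) m1 False by auto
  have "inner h" using h1 params(1,2) by (simp add: inner_def)
  moreover have "arrow h s (bar (s - 1))"
    using False h1 N s3 by (auto simp: arrow_def src_def tgt_def bar_def)
  ultimately have 1: "path [h] s (bar (s - 1))" by auto
  obtain js where 2: "path js 2 s" using path_up[of 2 s] False s3 by auto
  obtain js' where 3: "path js' (bar (s - 1)) (bar 2)" using path_down[of 2 "s - 1"] s3 by force
  show ?thesis using 1 2 3 path_append end_letters(5) by metis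
qed

abbreviation "I1 \<equiv> {1..s}"
abbreviation "I0 \<equiv> {0..s} - {h + 1}"

lemma inner_I: "inner j \<Longrightarrow> j \<in> I1" "inner j \<Longrightarrow> j \<in> I0"
  by (auto simp: inner_def)

lemma I1_cases: "j \<in> I1 \<Longrightarrow> inner j \<or> j = h + 1" and I0_cases: "j \<in> I0 \<Longrightarrow> inner j \<or> j = 0"
  by (auto simp: inner_def)

lemma chain_FF:
  assumes "\<And>j. inner j \<Longrightarrow> j \<in> I" "b = 1 \<or> b = N" "path js l l'" "trunc a (excited \<rho> \<rho>' b (unitv l)) \<in> cyc sT FF I w"
  shows "trunc a (excited \<rho> \<rho>' b (unitv l')) \<in> cyc sT FF I w"
  using assms(3,4)
proof (induction js arbitrary: l)
  case (Cons j js)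
  then obtain k where k: "inner j" "arrow j l k" "path js k l'" by auto
  obtain c where c: "c * c = 1" "DF j (unitv l) = (\<lambda>w. c * unitv k w)" using arrow_letters(4)[OF k(1,2)] by blast
  have "FF j (trunc a (excited \<rho> \<rho>' b (unitv l))) \<in> cyc sT FF I w" using Cons.prems k assms by (auto intro: cyc.intros)
  then have "sT c (FF j (trunc a (excited \<rho> \<rho>' b (unitv l)))) \<in> cyc sT FF I w" by (rule cyc.cyc_scale)
  moreover have "sT c (FF j (trunc a (excited \<rho> \<rho>' b (unitv l)))) = trunc a (excited \<rho> \<rho>' b (unitv k))"
    by (simp add: inner_exc[OF k(1) assms(2)] c excited_sT trunc_sT sT_sT)
  ultimately show ?case using Cons.IH[OF k(3)] by simp
qed simp

lemma chain_EE:
  assumes "\<And>j. inner j \<Longrightarrow> j \<in> I" "b = 1 \<or> b = N" "path js l l'" "trunc a (excited \<rho> \<rho>' b (unitv l')) \<in> cyc sT EE I w"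
  shows "trunc a (excited \<rho> \<rho>' b (unitv l)) \<in> cyc sT EE I w"
  using assms(3)
proof (induction js arbitrary: l)
  case Nil
  then show ?case using assms(4) by simp
next
  case (Cons j js)
  then obtain k where k: "inner j" "arrow j l k" "path js k l'" by auto
  have "EE j (trunc a (excited \<rho> \<rho>' b (unitv k))) \<in> cyc sT EE I w" using Cons.IH[OF k(3)] k assms by (auto intro: cyc.intros)
  then show ?case by (simp add: inner_exc[OF k(1) assms(2)] arrow_letters(3)[OF k(1,2)])
qed

abbreviation "xv a \<equiv> trunc a (cword 1)"
abbreviation "yv a \<equiv> trunc a (cword N)"

lemma cyc_unscale: "sT C t \<in> cyc sT A I w \<Longrightarrow> C \<noteq> 0 \<Longrightarrow> t \<in> cyc sT A I w"
  using cyc.cyc_scale[of "sT C t" sT A I w "1 / C"] by (simp add: sT_sT)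

text \<open>E_0 and F_{h+1} excite the highest word with the same position factors, so a path of
  inner nodes turns one result into the other. The four claims are images of each other under
  exchanging x with y and node 0 with node h+1; the latter is the diagram symmetry \<delta>_1
  \<rightarrow> -\<delta>_1, and it carries \<open>I1\<close> to \<open>I0\<close>.\<close>

lemma neighbours:
  "EE 0 (xv a) \<in> cyc sT FF I1 (xv a)" "FF 0 (yv a) \<in> cyc sT EE I1 (yv a)"
  "EE (h + 1) (yv a) \<in> cyc sT FF I0 (yv a)" "FF (h + 1) (xv a) \<in> cyc sT EE I0 (xv a)"
proof -
  obtain js where js: "path js 2 (N - 1)" using path_exists by blast
  have "FF (h + 1) (xv a) \<in> cyc sT FF I1 (xv a)" using h1_le_s by (intro cyc.intros) auto
  then have "trunc a (XS 2) \<in> cyc sT FF I1 (xv a)" unfolding end_wb by (rule cyc_unscale) simp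
  from chain_FF[OF inner_I(1) _ js this] show "EE 0 (xv a) \<in> cyc sT FF I1 (xv a)" unfolding end_wb by simp
  have "EE (h + 1) (yv a) \<in> cyc sT EE I1 (yv a)" using h1_le_s by (intro cyc.intros) auto
  then have "trunc a (YS (N - 1)) \<in> cyc sT EE I1 (yv a)" unfolding end_wb .
  from chain_EE[OF inner_I(1) _ js this] show "FF 0 (yv a) \<in> cyc sT EE I1 (yv a)" unfolding end_wb
    by (intro cyc.intros) simp
  have "FF 0 (yv a) \<in> cyc sT FF I0 (yv a)" by (intro cyc.intros) auto
  then have "trunc a (YS 2) \<in> cyc sT FF I0 (yv a)" unfolding end_wb by (rule cyc_unscale) simp
  from chain_FF[OF inner_I(2) _ js this] show "EE (h + 1) (yv a) \<in> cyc sT FF I0 (yv a)" unfolding end_wb by simp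
  have "EE 0 (xv a) \<in> cyc sT EE I0 (xv a)" by (intro cyc.intros) auto
  then have "trunc a (XS (N - 1)) \<in> cyc sT EE I0 (xv a)" unfolding end_wb .
  from chain_EE[OF inner_I(2) _ js this] show "FF (h + 1) (xv a) \<in> cyc sT EE I0 (xv a)" unfolding end_wb
    by (intro cyc.intros) simp
qed

lemma powers_aux:
  assumes X: "\<And>t. X t = (\<lambda>u. tact p \<zeta> D \<beta> sg u t)"
    and D: "twoterm D" "shifts D \<beta> (- 2 * \<beta> b)"
    and Db: "D (unitv b) = (\<lambda>w. c * unitv b' w)" "D (unitv b') = (\<lambda>_. 0)" and c: "c \<noteq> 0" and bb': "b \<noteq> b'"
    and s: "sg b = 1" "sg b' = 1" and \<beta>: "\<beta> b' = - \<beta> b" "\<beta> b = 1 \<or> \<beta> b = - 1"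
  shows "\<exists>C. C \<noteq> 0 \<and> (X ^^ a) (trunc a (cword b)) = sT C (trunc a (cword b'))"
proof -
  from tact_power_wb[OF D p0 proot Db c bb' s \<beta>, of a \<zeta>] obtain C where C: "C \<noteq> 0"
    "\<And>u. length u = a \<Longrightarrow> ((\<lambda>t u. tact p \<zeta> D \<beta> sg u t) ^^ a) (cword b) u = C * cword b' u" by blast
  have X': "X = (\<lambda>t u. tact p \<zeta> D \<beta> sg u t)" using X by blast
  have "X (trunc a t) = trunc a (X t)" for t
    unfolding X by (rule ext) (rule tact_trunc[OF D(1)])
  then have "(X ^^ k) (trunc a (cword b)) = trunc a ((X ^^ k) (cword b))" for k
    by (induction k) simp_all
  then have "(X ^^ a) (trunc a (cword b)) = sT C (trunc a (cword b'))"
    using C(2) by (auto simp: trunc_def sT_def fun_eq_iff X')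
  then show ?thesis using C(1) by blast
qed

lemma powers:
  "\<exists>C. C \<noteq> 0 \<and> (FF (h + 1) ^^ a) (trunc a (cword 1)) = sT C (trunc a (cword 2))"
  "\<exists>C. C \<noteq> 0 \<and> (FF (h + 1) ^^ a) (trunc a (cword (N - 1))) = sT C (trunc a (cword N))"
  "\<exists>C. C \<noteq> 0 \<and> (EE (h + 1) ^^ a) (trunc a (cword 2)) = sT C (trunc a (cword 1))"
  "\<exists>C. C \<noteq> 0 \<and> (EE (h + 1) ^^ a) (trunc a (cword N)) = sT C (trunc a (cword (N - 1)))"
  "\<exists>C. C \<noteq> 0 \<and> (EE 0 ^^ a) (trunc a (cword 1)) = sT C (trunc a (cword (N - 1)))"
  "\<exists>C. C \<noteq> 0 \<and> (EE 0 ^^ a) (trunc a (cword 2)) = sT C (trunc a (cword N))"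
  "\<exists>C. C \<noteq> 0 \<and> (FF 0 ^^ a) (trunc a (cword (N - 1))) = sT C (trunc a (cword 1))"
  "\<exists>C. C \<noteq> 0 \<and> (FF 0 ^^ a) (trunc a (cword N)) = sT C (trunc a (cword 2))"
proof -
  note ne = end_distinct
  have sh: "shifts (DF (h + 1)) (B (h + 1)) 2" "shifts (DE (h + 1)) (B (h + 1)) (- 2)" "shifts (DF 0) (B 0) 2" "shifts (DE 0) (B 0) (- 2)"
    using shifts_B[OF h1_le_s(1), of "h + 1"] shifts_B[of 0 0] unfolding end_values by simp_all
  note [simp del] = One_nat_def diff_Suc_1
  note F = powers_aux[OF FF_def twoterm_DF _ _ _ _ _ end_values(25) end_values(25)] powers_aux[OF FF_def twoterm_DF _ _ _ _ _ end_values(26) end_values(26)]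
  note E = powers_aux[OF EE_def twoterm_DE _ _ _ _ _ end_values(25) end_values(25)] powers_aux[OF EE_def twoterm_DE _ _ _ _ _ end_values(26) end_values(26)]
  show "\<exists>C. C \<noteq> 0 \<and> (FF (h + 1) ^^ a) (trunc a (cword 1)) = sT C (trunc a (cword 2))"
    by (rule F(1)[OF _ end_values(1,2)]) (simp_all only: end_values ne, simp_all add: sh)
  show "\<exists>C. C \<noteq> 0 \<and> (FF (h + 1) ^^ a) (trunc a (cword (N - 1))) = sT C (trunc a (cword N))"
    by (rule F(1)[OF _ end_values(3,4)]) (simp_all only: end_values ne, simp_all add: sh)
  show "\<exists>C. C \<noteq> 0 \<and> (EE (h + 1) ^^ a) (trunc a (cword 2)) = sT C (trunc a (cword 1))"
    by (rule E(1)[OF _ end_values(5,6)]) (simp_all only: end_values ne, simp_all add: sh)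
  show "\<exists>C. C \<noteq> 0 \<and> (EE (h + 1) ^^ a) (trunc a (cword N)) = sT C (trunc a (cword (N - 1)))"
    by (rule E(1)[OF _ end_values(7,8)]) (simp_all only: end_values ne, simp_all add: sh)
  show "\<exists>C. C \<noteq> 0 \<and> (EE 0 ^^ a) (trunc a (cword 1)) = sT C (trunc a (cword (N - 1)))"
    by (rule E(2)[OF _ end_values(9,10)]) (simp_all only: end_values ne, simp_all add: sh)
  show "\<exists>C. C \<noteq> 0 \<and> (EE 0 ^^ a) (trunc a (cword 2)) = sT C (trunc a (cword N))"
    by (rule E(2)[OF _ end_values(11,12)]) (simp_all only: end_values ne, simp_all add: sh)
  show "\<exists>C. C \<noteq> 0 \<and> (FF 0 ^^ a) (trunc a (cword (N - 1))) = sT C (trunc a (cword 1))"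
    by (rule F(2)[OF _ end_values(13,14)]) (simp_all only: end_values ne, simp_all add: sh)
  show "\<exists>C. C \<noteq> 0 \<and> (FF 0 ^^ a) (trunc a (cword N)) = sT C (trunc a (cword 2))"
    by (rule F(2)[OF _ end_values(15,16)]) (simp_all only: end_values ne, simp_all add: sh)
qed

end

declare One_nat_def [simp del]

section \<open>The extremal words and the closure of M under all generators\<close>

context osp begin

abbreviation M where "M a \<equiv> cyc sT FF I1 (xv a)"

lemma parity_zero_mult: "parity_sign (0 * x) = 1" "parity_sign (x * 0) = 1"
  by simp_all

lemma comm_affine:
  "j \<le> s \<Longrightarrow> j \<noteq> 0 \<Longrightarrow> EE 0 (FF j t) = FF j (EE 0 t)" "j \<le> s \<Longrightarrow> j \<noteq> 0 \<Longrightarrow> FF 0 (EE j t) = EE j (FF 0 t)"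
  "j \<le> s \<Longrightarrow> j \<noteq> h + 1 \<Longrightarrow> EE (h + 1) (FF j t) = FF j (EE (h + 1) t)" "j \<le> s \<Longrightarrow> j \<noteq> h + 1 \<Longrightarrow> FF (h + 1) (EE j t) = EE j (FF (h + 1) t)"
  using EE_FF[of 0 j t] FF_EE[of 0 j t] EE_FF[of "h + 1" j t] FF_EE[of "h + 1" j t] h1_le_s
  unfolding end_values parity_zero_mult by auto

lemma funpow_closed: "(\<And>t. t \<in> S \<Longrightarrow> X t \<in> S) \<Longrightarrow> t \<in> S \<Longrightarrow> (X ^^ k) t \<in> S"
  by (induction k) auto

lemma transport:
  assumes "w \<in> cyc sT A I v" "\<exists>C. C \<noteq> 0 \<and> (X ^^ k) w = sT C w'" "\<And>t. t \<in> cyc sT A I v \<Longrightarrow> X t \<in> cyc sT A I v"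
  shows "w' \<in> cyc sT A I v"
  using assms(2) funpow_closed[of "cyc sT A I v" X w k, OF assms(3,1)] cyc_unscale by metis

lemma cyc_affine_closed:
  "t \<in> M a \<Longrightarrow> EE 0 t \<in> M a" "t \<in> cyc sT EE I1 (yv a) \<Longrightarrow> FF 0 t \<in> cyc sT EE I1 (yv a)"
  "t \<in> cyc sT FF I0 (yv a) \<Longrightarrow> EE (h + 1) t \<in> cyc sT FF I0 (yv a)" "t \<in> cyc sT EE I0 (xv a) \<Longrightarrow> FF (h + 1) t \<in> cyc sT EE I0 (xv a)"
  by (rule cyc_closed_commuting[OF lin_ops(1) neighbours(1), where c = "\<lambda>_. 1"]
      cyc_closed_commuting[OF lin_ops(2) neighbours(2), where c = "\<lambda>_. 1"]
      cyc_closed_commuting[OF lin_ops(1) neighbours(3), where c = "\<lambda>_. 1"]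
      cyc_closed_commuting[OF lin_ops(2) neighbours(4), where c = "\<lambda>_. 1"]; auto simp: comm_affine)+

text \<open>The constant words in 1, 2, N, N - 1 are the corners of a square whose sides are a-th
  powers of generators at the nodes h+1 and 0 in turn. One of the two nodes belongs to the
  generating set, the other acts by \<open>cyc_affine_closed\<close>.\<close>

lemma extremal_mem:
  "yv a \<in> M a" "xv a \<in> cyc sT EE I1 (yv a)" "xv a \<in> cyc sT FF I0 (yv a)" "yv a \<in> cyc sT EE I0 (xv a)"
proof -
  have h1: "h + 1 \<in> I1" "(0::nat) \<in> I0" using h1_le_s by auto
  show "yv a \<in> M a"
    by (rule transport[OF transport[OF cyc.cyc_base powers(1)] powers(6)]) (auto intro: cyc.cyc_step h1 cyc_affine_closed)
  show "xv a \<in> cyc sT EE I1 (yv a)"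
    by (rule transport[OF transport[OF cyc.cyc_base powers(4)] powers(7)]) (auto intro: cyc.cyc_step h1 cyc_affine_closed)
  show "xv a \<in> cyc sT FF I0 (yv a)"
    by (rule transport[OF transport[OF cyc.cyc_base powers(8)] powers(3)]) (auto intro: cyc.cyc_step h1 cyc_affine_closed)
  show "yv a \<in> cyc sT EE I0 (xv a)"
    by (rule transport[OF transport[OF cyc.cyc_base powers(5)] powers(2)]) (auto intro: cyc.cyc_step h1 cyc_affine_closed)
qed

lemma K_wb: "KK i (trunc a (cword b)) = sT (p powi (int a * B i b)) (trunc a (cword b))" "KI i (trunc a (cword b)) = sT (p powi (- (int a * B i b))) (trunc a (cword b))"
proof -
  show "KK i (trunc a (cword b)) = sT (p powi (int a * B i b)) (trunc a (cword b))"
  proof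
    fix u show "KK i (trunc a (cword b)) u = sT (p powi (int a * B i b)) (trunc a (cword b)) u"
      using cword_wsum[of b u "\<lambda>x. p powi x" "B i"] by (cases "length u = a") (simp_all add: KK_def trunc_def sT_apply mult.commute)
  qed
  show "KI i (trunc a (cword b)) = sT (p powi (- (int a * B i b))) (trunc a (cword b))"
  proof
    fix u show "KI i (trunc a (cword b)) u = sT (p powi (- (int a * B i b))) (trunc a (cword b)) u"
      using cword_wsum[of b u "\<lambda>x. p powi - x" "B i"] by (cases "length u = a") (simp_all add: KI_def trunc_def sT_apply mult.commute)
  qed
qed

lemma cyc_K_closed:
  assumes "I \<subseteq> {0..s}"
  shows "t \<in> cyc sT FF I (trunc a (cword b)) \<Longrightarrow> KK i t \<in> cyc sT FF I (trunc a (cword b))"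
    "t \<in> cyc sT FF I (trunc a (cword b)) \<Longrightarrow> KI i t \<in> cyc sT FF I (trunc a (cword b))"
    "t \<in> cyc sT EE I (trunc a (cword b)) \<Longrightarrow> KK i t \<in> cyc sT EE I (trunc a (cword b))"
    "t \<in> cyc sT EE I (trunc a (cword b)) \<Longrightarrow> KI i t \<in> cyc sT EE I (trunc a (cword b))"
  by (rule cyc_closed_commuting[OF lin_ops(3)] cyc_closed_commuting[OF lin_ops(4)]; use assms in \<open>auto simp: K_wb K_EF intro: cyc.intros\<close>)+

lemma M_opposite_closed:
  assumes j: "j \<in> I1"
  shows "t \<in> M a \<Longrightarrow> EE j t \<in> M a" "t \<in> cyc sT EE I1 (yv a) \<Longrightarrow> FF j t \<in> cyc sT EE I1 (yv a)"
proof -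
  have kill: "EE j (xv a) = 0" "FF j (yv a) = 0" using I1_cases[OF j] inner_wb end_wb by auto
  have c1: "EE j (FF i u) = sT (parity_sign (par j * par i)) (FF i (EE j u)) + (sT (if j = i then dq else 0) (KK j (KK j u)) + sT (if j = i then - dq else 0) (KI j (KI j u)))"
    if "i \<in> I1" for i u
    using EE_FF[of j i u] j that by (simp add: sT_diff sT_uminus)
  have c2: "FF j (EE i u) = sT (parity_sign (par j * par i)) (EE i (FF j u)) + (sT (if j = i then - parity_sign (par j) * dq else 0) (KK j (KK j u)) + sT (if j = i then parity_sign (par j) * dq else 0) (KI j (KI j u)))"
    if "i \<in> I1" for i u
    using FF_EE[of j i u] j that by (simp add: sT_diff sT_uminus)
  have I: "I1 \<subseteq> {0..s}" by auto
  show "t \<in> M a \<Longrightarrow> EE j t \<in> M a"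
    by (rule cyc_closed_opposite[OF lin_ops(1) kill(1) cyc_K_closed(1,2)[OF I] c1])
  show "t \<in> cyc sT EE I1 (yv a) \<Longrightarrow> FF j t \<in> cyc sT EE I1 (yv a)"
    by (rule cyc_closed_opposite[OF lin_ops(2) kill(2) cyc_K_closed(3,4)[OF I] c2])
qed

text \<open>Either side contains the generator of the other and is closed under its operators. The
  description from below is what makes F_0 accessible.\<close>

lemma M_eq: "M a = cyc sT EE I1 (yv a)"
  using cyc_minimal[OF extremal_mem(2), where I' = I1 and A' = FF] cyc_minimal[OF extremal_mem(1), where I' = I1 and A' = EE] M_opposite_closed by blast

lemma M_closed:
  assumes "j \<le> s" "t \<in> M a"
  shows "EE j t \<in> M a" "FF j t \<in> M a" "KK j t \<in> M a" "KI j t \<in> M a"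
proof -
  show "EE j t \<in> M a" using assms cyc_affine_closed(1) M_opposite_closed(1) by (cases "j = 0") auto
  show "FF j t \<in> M a" using assms cyc_affine_closed(2)[folded M_eq] by (cases "j = 0") (auto intro: cyc.cyc_step)
  show "KK j t \<in> M a" "KI j t \<in> M a" using assms by (auto intro: cyc_K_closed(1,2))
qed

section \<open>Serre relations\<close>

lemma (in cspace) kernel_cyc_general:
  assumes "lin scale u" "u w = 0" "\<And>k v. k \<in> I \<Longrightarrow> \<exists>c. u (A k v) = scale c (A k (u v))" "\<And>k. lin scale (A k)" "t \<in> cyc scale A I w"
  shows "u t = 0"
  using assms(5)
proof induction
  case (cyc_step x i)
  obtain c where "u (A i x) = scale c (A i (u x))" using assms(3)[OF cyc_step(2)] by blast
  then show ?case by (simp only: cyc_step.IH lin_0[OF assms(4)] scale_zero_right)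
qed (use assms in \<open>auto simp: lin_add lin_scale lin_0\<close>)

lemmas kernel_cyc = cspace.kernel_cyc_general[OF cspace_sT]

lemma par_sq: "par i * par i = par i" by (cases "par i") auto

text \<open>The three positions of k relative to i and j are the three lemmas on
  \<open>qad_pow\<close>. For the F's the operators K and their inverses change places.\<close>

lemma serre_commutes:
  assumes ij: "i \<le> s" "j \<le> s" "i \<noteq> j" and k: "k \<le> s"
    and c: "rform i i * c = 2 * rform i j" "c = 0 \<or> c = - 1 \<and> par i = 0 \<or> c = - 2 \<and> par i = 1 \<and> par j = 0"
  shows "\<exists>x. qad_pow sT (par i) (par j) (p powi rform i i) c (EE i) (EE j) (nat (1 - c)) (FF k v)
       = sT x (FF k (qad_pow sT (par i) (par j) (p powi rform i i) c (EE i) (EE j) (nat (1 - c)) v))"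
    "\<exists>x. qad_pow sT (par i) (par j) (p powi rform i i) c (FF i) (FF j) (nat (1 - c)) (EE k v)
       = sT x (EE k (qad_pow sT (par i) (par j) (p powi rform i i) c (FF i) (FF j) (nat (1 - c)) v))"
proof -
  interpret T: cspace sT by (rule cspace_sT)
  define N where "N = nat (- c)"
  have N: "int (Suc N) = 1 - c" "nat (1 - c) = Suc N" using c(2) by (auto simp: N_def)
  have par: "parity_sign (of_nat N * par i) = 1" using c(2) by (auto simp: N_def)
  have y: "p powi rform i j \<noteq> 0" "p powi rform i i \<noteq> 0" using p0 by auto
  have tc: "(p powi rform i i) powi c = (p powi rform i j)\<^sup>2"
  proof -
    have "(p powi rform i i) powi c = p powi (rform i i * c)" by (simp add: power_int_mult)
    also have "\<dots> = p powi (rform i j * 2)" unfolding c(1) by (simp add: mult.commute)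
    also have "\<dots> = (p powi rform i j)\<^sup>2" by (simp add: power_int_mult)
    finally show ?thesis .
  qed
  have inv: "p powi (- z) = 1 / p powi z" for z by (simp add: power_int_minus inverse_eq_divide)
  have sy: "rform j i = rform i j" by (rule rform_sym[OF ij(2,1)])
  have f1: "EE i (FF i v) = sT (parity_sign (par i)) (FF i (EE i v)) + sT dq (KK i (KK i v) - KI i (KI i v))" if "i \<le> s" for i v
    using EE_FF[OF that that, of v] by (simp add: par_sq)
  have f2: "FF i (EE i v) = sT (parity_sign (par i)) (EE i (FF i v)) + sT (parity_sign (par i) * dq) (KI i (KI i v) - KK i (KK i v))" if "i \<le> s" for i v
    using FF_EE[OF that that, of v] by (simp add: par_sq sT_uminus sT_diff)
  have g1: "EE i (FF j v) = sT (parity_sign (par i * par j)) (FF j (EE i v))" if "i \<le> s" "j \<le> s" "i \<noteq> j" for i j v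
    using EE_FF[OF that(1,2), of v] that(3) by simp
  have g2: "FF i (EE j v) = sT (parity_sign (par i * par j)) (EE j (FF i v))" if "i \<le> s" "j \<le> s" "i \<noteq> j" for i j v
    using FF_EE[OF that(1,2), of v] that(3) by simp
  consider "k = i" | "k = j" | "k \<noteq> i" "k \<noteq> j" by blast
  then show "\<exists>x. qad_pow sT (par i) (par j) (p powi rform i i) c (EE i) (EE j) (nat (1 - c)) (FF k v)
       = sT x (FF k (qad_pow sT (par i) (par j) (p powi rform i i) c (EE i) (EE j) (nat (1 - c)) v))"
  proof cases
    case 1
    have B: "EE j (FF i v) = sT (parity_sign (par i * par j)) (FF i (EE j v))" for v
      using g1[OF ij(2,1) ij(3)[symmetric], of v] by (simp only: mult.commute)
    show ?thesis unfolding 1 N(2)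
      by (rule exI, rule T.qad_pow_comm_i[OF lin_ops(1,1,2,3,4) f1[OF ij(1)] B K_EF(1)[OF ij(1)] K_EF(2)[OF ij(1), unfolded inv] K_EF(1)[OF ij(2)] K_EF(2)[OF ij(2), unfolded inv] y(1,2) tc N(1) c(2)])
  next
    case 2
    show ?thesis unfolding 2 N(2)
      by (rule exI, rule T.qad_pow_comm_j[OF lin_ops(1,1,2,3,4) g1[OF ij] f1[OF ij(2)] K_EF(1)[OF ij(1), of j, unfolded sy] K_EF(2)[OF ij(1), of j, unfolded inv sy] y(1) tc y(2) N(1) par])
  next
    case 3
    show ?thesis
      by (rule exI, rule T.qad_pow_comm_other[OF lin_ops(1,1,2) g1[OF ij(1) k 3(1)[symmetric]] g1[OF ij(2) k 3(2)[symmetric]]])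
  qed
  consider "k = i" | "k = j" | "k \<noteq> i" "k \<noteq> j" by blast
  then show "\<exists>x. qad_pow sT (par i) (par j) (p powi rform i i) c (FF i) (FF j) (nat (1 - c)) (EE k v)
       = sT x (EE k (qad_pow sT (par i) (par j) (p powi rform i i) c (FF i) (FF j) (nat (1 - c)) v))"
  proof cases
    case 1
    have B: "FF j (EE i v) = sT (parity_sign (par i * par j)) (EE i (FF j v))" for v
      using g2[OF ij(2,1) ij(3)[symmetric], of v] by (simp only: mult.commute)
    show ?thesis unfolding 1 N(2)
      by (rule exI, rule T.qad_pow_comm_i[OF lin_ops(2,2,1,4,3) f2[OF ij(1)] B K_EF(4)[OF ij(1)] K_EF(3)[OF ij(1), unfolded inv] K_EF(4)[OF ij(2)] K_EF(3)[OF ij(2), unfolded inv] y(1,2) tc N(1) c(2)])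
  next
    case 2
    show ?thesis unfolding 2 N(2)
      by (rule exI, rule T.qad_pow_comm_j[OF lin_ops(2,2,1,4,3) g2[OF ij] f2[OF ij(2)] K_EF(4)[OF ij(1), of j, unfolded sy] K_EF(3)[OF ij(1), of j, unfolded inv sy] y(1) tc y(2) N(1) par])
  next
    case 3
    show ?thesis
      by (rule exI, rule T.qad_pow_comm_other[OF lin_ops(2,2,1) g2[OF ij(1) k 3(1)[symmetric]] g2[OF ij(2) k 3(2)[symmetric]]])
  qed
qed

lemma serre_inner:
  assumes ij: "i = 0 \<and> inner j \<or> inner i \<and> j = 0"
    and c: "rform i i * c = 2 * rform i j" "c = 0 \<or> c = - 1 \<and> par i = 0 \<or> c = - 2 \<and> par i = 1 \<and> par j = 0"
    and t: "t \<in> M a"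
  shows "qad_pow sT (par i) (par j) (p powi rform i i) c (EE i) (EE j) (nat (1 - c)) t = 0"
    "qad_pow sT (par i) (par j) (p powi rform i i) c (FF i) (FF j) (nat (1 - c)) t = 0"
proof -
  interpret T: cspace sT by (rule cspace_sT)
  have ij': "i \<le> s" "j \<le> s" "i \<noteq> j" using ij by (auto simp: inner_def)
  define u where "u = qad_pow sT (par i) (par j) (p powi rform i i) c (EE i) (EE j) (nat (1 - c))"
  define u' where "u' = qad_pow sT (par i) (par j) (p powi rform i i) c (FF i) (FF j) (nat (1 - c))"
  have lins: "lin sT u" "lin sT u'" unfolding u_def u'_def by (auto intro: T.qad_pow_lin lin_ops)
  have kill: "EE i (yv a) = 0" "EE j (yv a) = 0" "FF i (xv a) = 0" "FF j (xv a) = 0"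
    using ij inner_wb end_wb by auto
  have 1: "u (yv a) = 0" "u' (xv a) = 0"
    unfolding u_def u'_def using kill by (auto intro: T.qad_pow_zero_at lin_ops)
  have 2: "\<exists>x. u (FF k v) = sT x (FF k (u v))" "\<exists>x. u' (EE k v) = sT x (EE k (u' v))" if "k \<le> s" for k v
    unfolding u_def u'_def using serre_commutes[OF ij' that c] by blast+
  have "u (xv a) = 0" by (rule kernel_cyc[OF lins(1) 1(1) 2(1) lin_ops(2) extremal_mem(3)]) auto
  then show "u t = 0" by (rule kernel_cyc[OF lins(1) _ 2(1) lin_ops(2) t]) auto
  have "u' (yv a) = 0" by (rule kernel_cyc[OF lins(2) 1(2) 2(2) lin_ops(1) extremal_mem(4)]) auto
  then show "u' t = 0" by (rule kernel_cyc[OF lins(2) _ 2(2) lin_ops(1) t[unfolded M_eq]]) auto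
qed



text \<open>
  Here the argument of the preceding lemma fails, because $E_{h+1}$ does not kill the lowest word.
\<close>

lemma affine_end_comm: "EE 0 (EE (h + 1) t) = EE (h + 1) (EE 0 t)" "FF 0 (FF (h + 1) t) = FF (h + 1) (FF 0 t)"
proof -
  note ne = end_distinct
  have gs: "lsign 1 = - 1" "lsign 2 = - 1" "lsign (N - 1) = - 1" by (simp_all only: lsign_def end_letters if_False)
  note [simp del] = One_nat_def diff_Suc_1
  have c1: "DE 0 (DE (h + 1) g) l - 1 * DE (h + 1) (DE 0 g) l = 0 * g l" for g l
    using ne by (simp add: DE_def end_letters(1-7,9-12))
  have c2: "DF 0 (DF (h + 1) g) l - 1 * DF (h + 1) (DF 0 g) l = 0 * g l" for g l
    using ne by (simp add: DF_def end_letters(1-7,9-12) gs)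
  have sh: "shifts (DE 0) (B (h + 1)) 0" "shifts (DE (h + 1)) (B 0) (- 0)" "shifts (DF 0) (B (h + 1)) 0" "shifts (DF (h + 1)) (B 0) (- 0)"
    using shifts_B[of 0 "h + 1"] shifts_B[of "h + 1" 0] h1_le_s(1) unfolding end_values by simp_all
  have sg: "signs (DE 0) (sgn_op (h + 1)) 1" "signs (DE (h + 1)) (sgn_op 0) 1" "signs (DF 0) (sgn_op (h + 1)) 1" "signs (DF (h + 1)) (sgn_op 0) 1"
    using signs_op[of 0 "h + 1"] signs_op[of "h + 1" 0] h1_le_s(1) unfolding end_values by simp_all
  show "EE 0 (EE (h + 1) t) = EE (h + 1) (EE 0 t)"
    using tact_commutator[OF p0 twoterm_DE twoterm_DE sh(1,2) sg(1,2) _ c1]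
    unfolding EE_def tcomm_zero by (auto simp: fun_eq_iff)
  show "FF 0 (FF (h + 1) t) = FF (h + 1) (FF 0 t)"
    using tact_commutator[OF p0 twoterm_DF twoterm_DF sh(3,4) sg(3,4) _ c2]
    unfolding FF_def tcomm_zero by (auto simp: fun_eq_iff)
qed

text \<open>Only nodes with target 2 meet the affine root. Their root is \<delta>_2 minus the weight
  of the next letter: \<delta>_3 if r > 2, and for r = 2 either 0, which gives an odd root of norm
  -1, or \<plusminus>\<epsilon>_1, which gives an isotropic one.\<close>

lemma rform_affine:
  assumes "inner j"
  shows "rform 0 j = 0 \<or> rform 0 j = 1 \<and> (rform j j = - 2 \<and> par j = 0 \<or> rform j j = - 1 \<and> par j = 1 \<or> rform j j = 0)"
proof -
  have j: "j \<le> s" using assms by (simp add: inner_def)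
  note r = inner_range[OF assms] node_range[OF j] bar_src_tgt[OF j]
  have B0: "B 0 l = (if l = 2 then 1 else 0)" if "2 \<le> l" "l < N - 1" for l
  proof -
    have "lsign (N - 1) = - 1" by (simp only: lsign_def end_letters if_False)
    then show ?thesis using that by (auto simp: B_def lform_def end_letters bar_def)
  qed
  have r0: "rform 0 j = (if tgt j = 2 then 1 else 0)"
    using r by (simp add: rform_def B0)
  have "rform j j = - 2 \<and> par j = 0 \<or> rform j j = - 1 \<and> par j = 1 \<or> rform j j = 0" if "tgt j = 2"
  proof -
    have b: "fermionic (tgt j) = False" "lsign (tgt j) = - 1" "tgt j \<noteq> bar (tgt j)" 
      using N_ge_5 by (simp_all add: that end_letters lsign_def)
    have "rform j j = - 1 + lsign (src j) * (if src j = bar (src j) then 0 else 1)"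
      using r b by (auto simp: rform_def B_def lform_def)
    moreover have "fermionic (src j)" if "src j = bar (src j)"
      using that r(8,9) params(1-3) h_less_m by (auto simp: fermionic_def bar_def)
    ultimately show ?thesis using b by (auto simp: lsign_def par_def)
  qed
  then show ?thesis using r0 by auto
qed

lemma serre_affine:
  assumes ij: "i \<le> s" "j \<le> s" "i \<noteq> j" "i = 0 \<or> j = 0" and ii: "rform i i \<noteq> 0" and t: "t \<in> M a"
  defines "c \<equiv> 2 * rform i j div rform i i"
  shows "qad_pow sT (par i) (par j) (p powi rform i i) c (EE i) (EE j) (nat (1 - c)) t = 0"
    "qad_pow sT (par i) (par j) (p powi rform i i) c (FF i) (FF j) (nat (1 - c)) t = 0"
proof -
  have *: "qad_pow sT (par i) (par j) (p powi rform i i) c (EE i) (EE j) (nat (1 - c)) t = 0 \<and>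
    qad_pow sT (par i) (par j) (p powi rform i i) c (FF i) (FF j) (nat (1 - c)) t = 0"
  proof (cases "inner i \<or> inner j")
    case True
    then have ij': "i = 0 \<and> inner j \<or> inner i \<and> j = 0" using ij by (auto simp: inner_def)
    have d: "rform i i * c = 2 * rform i j \<and> (c = 0 \<or> c = - 1 \<and> par i = 0 \<or> c = - 2 \<and> par i = 1 \<and> par j = 0)"
    proof (cases "i = 0")
      case True
      then have "inner j" "par i = 0" "rform i i = - 2" using ij' end_values by (auto simp: inner_def)
      then show ?thesis using rform_affine[of j] True by (auto simp: c_def)
    next
      case False
      then have i: "inner i" "j = 0" "par j = 0" using ij' end_values by auto
      have "rform i j = rform 0 i" using rform_sym[of i 0] i ij by simp
      then show ?thesis using rform_affine[OF i(1)] ii i(3) by (auto simp: c_def)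
    qed
    show ?thesis using serre_inner[OF ij' d[THEN conjunct1] d[THEN conjunct2] t] by blast
  next
    case False
    then have "i = 0 \<and> j = h + 1 \<or> i = h + 1 \<and> j = 0" using ij by (auto simp: inner_def)
    then have "rform i j = 0" "EE i (EE j t) = EE j (EE i t)" "FF i (FF j t) = FF j (FF i t)" "par i = 0"
      using end_values affine_end_comm by auto
    then show ?thesis by (simp add: c_def qcomm_def)
  qed
  show "qad_pow sT (par i) (par j) (p powi rform i i) c (EE i) (EE j) (nat (1 - c)) t = 0"
    "qad_pow sT (par i) (par j) (p powi rform i i) c (FF i) (FF j) (nat (1 - c)) t = 0"
    using * by auto
qed


section \<open>Coefficients next to the extremal words\<close>

text \<open>On words with one letter different from b, the position enters only through a fixed
  geometric factor. The opposite end letter is left out, since the generators at node h+1 would give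
  it the factor twice.\<close>

definition coefs :: "nat \<Rightarrow> int \<Rightarrow> nat \<Rightarrow> (nat list \<Rightarrow> complex) \<Rightarrow> bool" where
  "coefs b e a t \<longleftrightarrow> (\<exists>g. \<forall>l i k. 2 \<le> l \<longrightarrow> l \<le> N - 1 \<longrightarrow> i + k + 1 = a \<longrightarrow>
     t (replicate i b @ l # replicate k b) = g l * p powi (e * (int k - int i)))"

lemma coefs_closed:
  "coefs b e a t \<Longrightarrow> coefs b e a t' \<Longrightarrow> coefs b e a (t + t')" "coefs b e a t \<Longrightarrow> coefs b e a (sT c t)" "coefs b e a 0"
proof -
  show "coefs b e a (t + t')" if "coefs b e a t" "coefs b e a t'"
  proof -
    obtain g g' where "\<And>l i k. 2 \<le> l \<Longrightarrow> l \<le> N - 1 \<Longrightarrow> i + k + 1 = a \<Longrightarrow> t (replicate i b @ l # replicate k b) = g l * p powi (e * (int k - int i))"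
     "\<And>l i k. 2 \<le> l \<Longrightarrow> l \<le> N - 1 \<Longrightarrow> i + k + 1 = a \<Longrightarrow> t' (replicate i b @ l # replicate k b) = g' l * p powi (e * (int k - int i))"
      using \<open>coefs b e a t\<close> \<open>coefs b e a t'\<close> unfolding coefs_def by metis
    then show ?thesis unfolding coefs_def by (intro exI[of _ "\<lambda>l. g l + g' l"]) (simp add: distrib_right)
  qed
  show "coefs b e a (sT c t)" if "coefs b e a t"
  proof -
    obtain g where "\<And>l i k. 2 \<le> l \<Longrightarrow> l \<le> N - 1 \<Longrightarrow> i + k + 1 = a \<Longrightarrow> t (replicate i b @ l # replicate k b) = g l * p powi (e * (int k - int i))"
      using \<open>coefs b e a t\<close> unfolding coefs_def by metis
    then show ?thesis unfolding coefs_def by (intro exI[of _ "\<lambda>l. c * g l"]) (simp add: sT_apply)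
  qed
  show "coefs b e a 0" unfolding coefs_def by (intro exI[of _ "\<lambda>l. 0"]) simp
qed

lemma coefs_wb:
  assumes "b = 1 \<or> b = N" shows "coefs b e a (trunc a (cword b))"
proof -
  have "cword b (replicate i b @ l # replicate k b) = 0" if "l \<noteq> b" for l i k
  proof -
    have "l \<in> set (replicate i b @ l # replicate k b)" by simp
    moreover have "l \<notin> set (replicate (length (replicate i b @ l # replicate k b)) b)" using that by simp
    ultimately show ?thesis unfolding cword_def by metis
  qed
  moreover have "l \<noteq> b" if "2 \<le> l" "l \<le> N - 1" for l using assms that N_ge_5 by auto
  ultimately show ?thesis unfolding coefs_def by (intro exI[of _ "\<lambda>_. 0"]) (simp add: trunc_def)
qed

lemma inner_word:
  assumes j: "inner j" and b: "b = 1 \<or> b = N"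
  shows "EE j t (replicate i b @ l # replicate k b) = DE j (\<lambda>l'. t (replicate i b @ l' # replicate k b)) l"
    "FF j t (replicate i b @ l # replicate k b) = DF j (\<lambda>l'. t (replicate i b @ l' # replicate k b)) l"
proof -
  have z: "zexp j = 0" using j by (simp add: zexp_def inner_def)
  note ie = inner_end[OF j b]
  show "EE j t (replicate i b @ l # replicate k b) = DE j (\<lambda>l'. t (replicate i b @ l' # replicate k b)) l"
    unfolding EE_def using tact_word[where D = "DE j" and b = b and s = "sgn_op j" and \<beta> = "B j", OF ie(5) ie(4) p0] by (simp add: z ie(3))
  show "FF j t (replicate i b @ l # replicate k b) = DF j (\<lambda>l'. t (replicate i b @ l' # replicate k b)) l"
    unfolding FF_def using tact_word[where D = "DF j" and b = b and s = "sgn_op j" and \<beta> = "B j", OF ie(6) ie(4) p0] by (simp add: z ie(3))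
qed

lemma coefs_inner:
  assumes j: "inner j" and b: "b = 1 \<or> b = N" and t: "coefs b e a t"
  shows "coefs b e a (EE j t)" "coefs b e a (FF j t)"
proof -
  obtain g where g: "\<And>l i k. 2 \<le> l \<Longrightarrow> l \<le> N - 1 \<Longrightarrow> i + k + 1 = a \<Longrightarrow> t (replicate i b @ l # replicate k b) = g l * p powi (e * (int k - int i))"
    using t unfolding coefs_def by metis
  note r = inner_range[OF j]
  have rr: "2 \<le> src j" "src j \<le> N - 1" "2 \<le> tgt j" "tgt j \<le> N - 1" "2 \<le> bar (src j)" "bar (src j) \<le> N - 1" "2 \<le> bar (tgt j)" "bar (tgt j) \<le> N - 1"
    using r by (auto simp: bar_def)
  show "coefs b e a (EE j t)" unfolding coefs_def
    by (intro exI[of _ "DE j g"] allI impI) (simp add: inner_word[OF j b] DE_def g rr distrib_right)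
  show "coefs b e a (FF j t)" unfolding coefs_def
    by (intro exI[of _ "DF j g"] allI impI) (simp add: inner_word[OF j b] DF_def g rr distrib_right mult.assoc)
qed

lemma replicate_split: "i + k + 1 = a \<Longrightarrow> replicate i b @ b # replicate k b = replicate a b"
  by (metis Suc_eq_plus1 add_Suc_right replicate_Suc replicate_add)

text \<open>Among letters 1 an inner-range letter can be written by F_{h+1} only as a 2 coming from
  the constant word. This dictates the position factor for every t. Among letters N the same holds
  for E_{h+1} and the letter N - 1.\<close>

lemma coefs_outer: "coefs 1 (- 1) a (FF (h + 1) t)" "coefs N 1 a (EE (h + 1) t)"
proof -
  have z: "zexp (h + 1) = 0" by (simp add: zexp_def)
  note ne = end_distinct
  have row: "DF (h + 1) g 1 = 0" "DE (h + 1) g N = 0" for g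
    unfolding DF_def DE_def end_letters using ne by simp_all
  have sg: "sgn_op (h + 1) l = 1" for l by (rule end_values(25))
  show "coefs 1 (- 1) a (FF (h + 1) t)" unfolding coefs_def FF_def
  proof (intro exI[of _ "\<lambda>l. if l = 2 then of_int (lsign 1) * t (replicate a 1) else 0"] allI impI)
    fix l i k assume l: "2 \<le> l" "l \<le> N - 1" and ik: "i + k + 1 = a"
    then have "l \<noteq> N" using N_ge_5 by auto
    then show "tact p (- zexp (h + 1)) (DF (h + 1)) (B (h + 1)) (sgn_op (h + 1)) (replicate i 1 @ l # replicate k 1) t
      = (if l = 2 then of_int (lsign 1) * t (replicate a 1) else 0) * p powi (- 1 * (int k - int i))"
      unfolding tact_word[where D = "DF (h + 1)" and b = 1 and s = "sgn_op (h + 1)", OF row(1) sg p0] z end_values DF_def end_letters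
      by (simp add: replicate_split[OF ik])
  qed
  show "coefs N 1 a (EE (h + 1) t)" unfolding coefs_def EE_def
  proof (intro exI[of _ "\<lambda>l. if l = N - 1 then t (replicate a N) else 0"] allI impI)
    fix l i k assume l: "2 \<le> l" "l \<le> N - 1" and ik: "i + k + 1 = a"
    then have "l \<noteq> 1" using N_ge_5 by auto
    then show "tact p (zexp (h + 1)) (DE (h + 1)) (B (h + 1)) (sgn_op (h + 1)) (replicate i N @ l # replicate k N) t
      = (if l = N - 1 then t (replicate a N) else 0) * p powi (1 * (int k - int i))"
      unfolding tact_word[where D = "DE (h + 1)" and b = N and s = "sgn_op (h + 1)", OF row(2) sg p0] z end_values DE_def end_letters
      by (simp add: replicate_split[OF ik])
  qed
qed

text \<open>The statement at 1 uses generation by the lowering operators, the one at N generation by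
  the raising operators.\<close>

lemma M_coefs:
  assumes "t \<in> M a"
  shows "coefs 1 (- 1) a t" "coefs N 1 a t"
proof -
  show "coefs 1 (- 1) a t" using assms
  proof induction
    case (cyc_step x i)
    then show ?case using I1_cases[OF cyc_step(2)] coefs_inner(2)[of i 1] coefs_outer(1) by auto
  qed (rule coefs_closed coefs_wb; simp?)+
  show "coefs N 1 a t" using assms unfolding M_eq
  proof induction
    case (cyc_step x i)
    then show ?case using I1_cases[OF cyc_step(2)] coefs_inner(1)[of i N] coefs_outer(2) by auto
  qed (rule coefs_closed coefs_wb; simp?)+
qed

lemma path_word_EE:
  assumes "path js l l'" "b = 1 \<or> b = N"
  shows "foldr EE js t (replicate i b @ l # replicate k b) = t (replicate i b @ l' # replicate k b)"
  using assms(1)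
proof (induction js arbitrary: l)
  case (Cons j js)
  then obtain l1 where "inner j" "arrow j l l1" "path js l1 l'" by auto
  then show ?case by (simp add: inner_word[OF _ assms(2)] arrow_letters(1) Cons.IH)
qed simp

lemma path_word_FF:
  assumes "path js l l'" "b = 1 \<or> b = N"
  shows "\<exists>c. c * c = 1 \<and> (\<forall>i k. fold FF js t (replicate i b @ l' # replicate k b) = c * t (replicate i b @ l # replicate k b))"
  using assms(1)
proof (induction js arbitrary: l t)
  case Nil
  then show ?case by (intro exI[of _ 1]) simp
next
  case (Cons j js)
  then obtain l1 where l1: "inner j" "arrow j l l1" "path js l1 l'" by auto
  obtain c where c: "c * c = 1" "\<And>i k. fold FF js (FF j t) (replicate i b @ l' # replicate k b) = c * FF j t (replicate i b @ l1 # replicate k b)"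
    using Cons.IH[OF l1(3)] by blast
  obtain d where d: "d * d = 1" "\<And>g. DF j g l1 = d * g l" using arrow_letters(2)[OF l1(1,2)] by blast
  have "(c * d) * (c * d) = 1" using c(1) d(1) by (metis mult.assoc mult.commute mult_1_right)
  then show ?case by (intro exI[of _ "c * d"]) (simp add: c inner_word[OF l1(1) assms(2)] d)
qed

lemma path_I1: "path js l l' \<Longrightarrow> set js \<subseteq> I1"
  by (induction js arbitrary: l) (auto dest: inner_I(1))

lemma powi_merge: "p powi x * (c * p powi y) = c * p powi (x + y)"
  using p0 by (simp add: power_int_add)

lemma powi_sum_nonzero:
  assumes "a \<ge> 1" "e = 1 \<or> e = - 1"
  shows "(\<Sum>i<a. p powi (2 * e * (int (a - 1 - i) - int i))) \<noteq> 0"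
proof -
  define x where "x = p powi (- 4 * e)"
  have x: "x = inverse (p ^ 4) \<or> x = p ^ 4" using assms(2) by (auto simp: x_def power_int_minus)
  then have x1: "x ^ j \<noteq> 1" if "j > 0" for j
    using proot[of "4 * j"] that p0 by (auto simp: power_mult[symmetric] power_inverse inverse_eq_1_iff)
  have "(\<Sum>i<a. x ^ i) \<noteq> 0"
    using x1[of 1] x1[of a] assms(1) geometric_sum[of x a] by auto
  moreover have "p powi (2 * e * (int (a - 1 - i) - int i)) = p powi (2 * e * (int a - 1)) * x ^ i" if "i < a" for i
  proof -
    have "2 * e * (int (a - 1 - i) - int i) = 2 * e * (int a - 1) + (- 4 * e) * int i"
      using that by (simp add: of_nat_diff algebra_simps)
    then have "p powi (2 * e * (int (a - 1 - i) - int i)) = p powi (2 * e * (int a - 1)) * p powi ((- 4 * e) * int i)"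
      using p0 by (simp only: power_int_add simp_thms)
    then show ?thesis by (simp only: x_def power_int_mult[of p "- 4 * e"] power_int_of_nat)
  qed
  ultimately show ?thesis using p0 by (simp add: sum_distrib_left[symmetric])
qed

definition end_weight :: "nat \<Rightarrow> int" where "end_weight l = (if l = 1 then 1 else 0) - (if l = N then 1 else 0)"

lemma end_weight_extremal:
  assumes "wsum end_weight u = - int (length u)" shows "u = replicate (length u) N"
  using assms
proof (induction u)
  case (Cons w u)
  have ge: "wsum end_weight u \<ge> - int (length u)" for u
    by (induction u) (auto simp: end_weight_def split: if_splits)
  have "end_weight w = - 1" "wsum end_weight u = - int (length u)"
    using Cons.prems ge[of u] ge[of "[w]"] by auto
  moreover from this have "w = N" by (auto simp: end_weight_def split: if_splits)
  ultimately show ?case using Cons.IH by simp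
qed simp

lemma foldr_EE_shift:
  assumes "set es \<subseteq> {0..s}"
  shows "\<exists>C. \<forall>(f :: int \<Rightarrow> complex) t. foldr EE es (\<lambda>u. f (wsum end_weight u) * t u) = (\<lambda>u. f (wsum end_weight u - C) * foldr EE es t u)"
  using assms
proof (induction es)
  case Nil
  show ?case by (intro exI[of _ 0]) simp
next
  case (Cons e es)
  then obtain C where C: "\<And>(f :: int \<Rightarrow> complex) t. foldr EE es (\<lambda>u. f (wsum end_weight u) * t u) = (\<lambda>u. f (wsum end_weight u - C) * foldr EE es t u)"
    by auto
  have "end_weight (bar l) = - end_weight l" if "1 \<le> l" "l \<le> N" for l
    using that by (auto simp: end_weight_def bar_def)
  then obtain c where c: "shifts (DE e) end_weight c" using letter_shifts(1)[of e end_weight] Cons.prems by auto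
  show ?case
  proof (intro exI[of _ "c + C"] allI)
    fix f :: "int \<Rightarrow> complex" and t
    show "foldr EE (e # es) (\<lambda>u. f (wsum end_weight u) * t u) = (\<lambda>u. f (wsum end_weight u - (c + C)) * foldr EE (e # es) t u)"
      unfolding foldr_Cons o_apply C
      unfolding EE_def[of e] tact_shifts[OF c twoterm_DE, where f = "\<lambda>x. f (x - C)"] by (simp add: algebra_simps)
  qed
qed

lemma foldr_EE_trunc: "foldr EE es (trunc a t) = trunc a (foldr EE es t)"
  by (induction es) (simp_all add: EE_trunc)

lemma foldr_EE_lin: "lin sT (foldr EE es)"
  by (induction es) (auto simp: lin_def lin_add[OF lin_ops(1)] lin_scale[OF lin_ops(1)])

text \<open>The highest word lies in the span of the products of raising operators applied to the
  lowest one, and its own x-coefficient is 1; hence some product has a nonzero one.\<close>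

lemma raising_word: "\<exists>es. set es \<subseteq> I1 \<and> foldr EE es (yv a) (replicate a 1) \<noteq> 0"
proof (rule ccontr)
  assume "\<not> ?thesis"
  then have z: "foldr EE es (yv a) (replicate a 1) = 0" if "set es \<subseteq> I1" for es using that by blast
  have "\<forall>es. set es \<subseteq> I1 \<longrightarrow> foldr EE es t (replicate a 1) = 0" if "t \<in> cyc sT EE I1 (yv a)" for t
    using that
  proof induction
    case (cyc_step x i)
    show ?case
    proof (intro allI impI)
      fix es assume "set es \<subseteq> I1"
      then have "set (es @ [i]) \<subseteq> I1" using cyc_step(2) by simp
      then have "foldr EE (es @ [i]) x (replicate a 1) = 0" using cyc_step.IH by blast
      then show "foldr EE es (EE i x) (replicate a 1) = 0" by simp
    qed
  next
    case cyc_base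
    then show ?case using z by blast
  next
    case cyc_zero
    show ?case by (intro allI impI, subst lin_0[OF foldr_EE_lin]) simp
  next
    case (cyc_add x y)
    show ?case by (intro allI impI, subst lin_add[OF foldr_EE_lin]) (simp add: cyc_add.IH)
  next
    case (cyc_scale x c)
    show ?case by (intro allI impI, subst lin_scale[OF foldr_EE_lin]) (simp add: cyc_scale.IH sT_apply)
  qed
  from this[OF extremal_mem(2), rule_format, of "[]"] show False by (simp add: trunc_def cword_def)
qed

section \<open>Submodules of M without x-coefficients, later applied to the kernel of the map to the
  given module\<close>

context
  fixes a :: nat and S :: "(nat list \<Rightarrow> complex) set"
  assumes a1: "a \<ge> 1" and SM: "S \<subseteq> M a" and SE: "\<And>j t. j \<in> I1 \<Longrightarrow> t \<in> S \<Longrightarrow> EE j t \<in> S" and SF: "\<And>j t. j \<in> I1 \<Longrightarrow> t \<in> S \<Longrightarrow> FF j t \<in> S"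
    and Sx: "\<And>t. t \<in> S \<Longrightarrow> t (replicate a 1) = 0"
begin

lemma foldr_mem: "set js \<subseteq> I1 \<Longrightarrow> t \<in> S \<Longrightarrow> foldr EE js t \<in> S" "set js \<subseteq> I1 \<Longrightarrow> t \<in> S \<Longrightarrow> fold FF js t \<in> S"
  by (induction js arbitrary: t) (auto simp: SE SF)

text \<open>A product of raising operators that takes the lowest word to the highest one shifts \<open>end_weight\<close> by
  \<open>2 a\<close>, so its value at the highest word only sees the lowest word: that is the only word of length \<open>a\<close> with \<open>end_weight\<close> equal to \<open>- a\<close>.\<close>

lemma lowest_coef: assumes t: "t \<in> S" shows "t (replicate a N) = 0"
proof -
  obtain es where es: "set es \<subseteq> I1" "foldr EE es (yv a) (replicate a 1) \<noteq> 0" using raising_word by blast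
  have es0: "set es \<subseteq> {0..s}" using es(1) by auto
  obtain C where C: "\<And>(f :: int \<Rightarrow> complex) t. foldr EE es (\<lambda>u. f (wsum end_weight u) * t u) = (\<lambda>u. f (wsum end_weight u - C) * foldr EE es t u)"
    using foldr_EE_shift[OF es0] by blast
  define f :: "int \<Rightarrow> complex" where "f x = (if x = - int a then 1 else 0)" for x
  have gN: "end_weight N = - 1" using N_ge_5 by (simp add: end_weight_def)
  have wN: "wsum end_weight (replicate k N) = - int k" for k
    by (induction k) (auto simp: gN)
  \<comment> \<open>In degree a, multiplication by f of the weight is the projection onto the line
    of the lowest word.\<close>
  have proj: "trunc a (\<lambda>u. f (wsum end_weight u) * t u) = sT (t (replicate a N)) (yv a)" for t
  proof
    fix u show "trunc a (\<lambda>u. f (wsum end_weight u) * t u) u = sT (t (replicate a N)) (yv a) u"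
      using end_weight_extremal[of u] wN[of "length u"]
      by (auto simp: trunc_def f_def sT_apply cword_def)
  qed
  have main: "f (wsum end_weight (replicate a 1) - C) * foldr EE es t (replicate a 1) = t (replicate a N) * foldr EE es (yv a) (replicate a 1)" for t
  proof -
    have "f (wsum end_weight (replicate a 1) - C) * foldr EE es t (replicate a 1) = foldr EE es (trunc a (\<lambda>u. f (wsum end_weight u) * t u)) (replicate a 1)"
      unfolding foldr_EE_trunc C by (simp add: trunc_def)
    then show ?thesis unfolding proj lin_scale[OF foldr_EE_lin] by (simp add: sT_apply)
  qed
  have "foldr EE es t (replicate a 1) = 0" using Sx[OF foldr_mem(1)[OF es(1) t]] .
  then show ?thesis using main[of t] es(2) by simp
qed

text \<open>A path of raising operators moves the coefficients at N - 1 to the letter 2 without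
  changing them, and E_{h+1} adds them up in the x-coefficient. By \<open>coefs\<close> this sum is
  g (N - 1) times a nonzero geometric sum, while S has no x-coefficients.\<close>

lemma coef_next_to_highest: assumes t: "t \<in> S" and ik: "i + k + 1 = a" shows "t (replicate i 1 @ (N - 1) # replicate k 1) = 0"
proof -
  obtain js where js: "path js 2 (N - 1)" using path_exists by blast
  define t' where "t' = foldr EE js t"
  have t': "t' \<in> S" unfolding t'_def by (rule foldr_mem(1)[OF path_I1[OF js] t])
  obtain g where g: "\<And>l i k. 2 \<le> l \<Longrightarrow> l \<le> N - 1 \<Longrightarrow> i + k + 1 = a \<Longrightarrow> t (replicate i 1 @ l # replicate k 1) = g l * p powi (- 1 * (int k - int i))"
    using M_coefs(1)[OF subsetD[OF SM t]] unfolding coefs_def by blast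
  have N1: "2 \<le> N - 1" "N - 1 \<le> N - 1" "(1::nat) \<noteq> N - 1" using N_ge_5 by auto
  have z: "zexp (h + 1) = 0" by (simp add: zexp_def)
  have "EE (h + 1) t' (replicate a 1) = (\<Sum>i<a. g (N - 1) * p powi (2 * - 1 * (int (a - 1 - i) - int i)))"
    unfolding EE_def tact_replicate[where s = "sgn_op (h + 1)", OF twoterm_DE end_values(25) p0]
  proof (rule sum.cong[OF refl])
    fix i assume i: "i \<in> {..<a}"
    then have ia: "i + (a - 1 - i) + 1 = a" by auto
    have "DE (h + 1) (\<lambda>w'. t' (replicate i 1 @ w' # replicate (a - 1 - i) 1)) 1 = g (N - 1) * p powi (- 1 * (int (a - 1 - i) - int i))" (is "?D = _")
      unfolding DE_def end_letters using N1 path_word_EE[OF js, of 1 t i "a - 1 - i"] g[OF N1(1,2) ia] by (simp add: t'_def)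
    moreover have "(0 + - 1) * d + - 1 * d = 2 * - 1 * d" for d :: int by simp
    ultimately show "p powi ((zexp (h + 1) + B (h + 1) 1) * (int (a - 1 - i) - int i)) * DE (h + 1) (\<lambda>w'. t' (replicate i 1 @ w' # replicate (a - 1 - i) 1)) 1
      = g (N - 1) * p powi (2 * - 1 * (int (a - 1 - i) - int i))"
      unfolding z end_values by (simp only: powi_merge)
  qed
  moreover have "EE (h + 1) t' (replicate a 1) = 0" using Sx[OF SE[OF _ t']] h1_le_s by auto
  ultimately have "g (N - 1) = 0"
    using powi_sum_nonzero[OF a1, of "- 1"] by (simp add: sum_distrib_left[symmetric])
  then show ?thesis using g[OF N1(1,2) ik] by simp
qed

text \<open>The mirror image of the preceding argument with lowering operators;
  \<open>lowest_coef\<close> supplies the vanishing of y-coefficients. The path now costs a sign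
  c.\<close>

lemma coef_next_to_lowest: assumes t: "t \<in> S" and ik: "i + k + 1 = a" shows "t (replicate i N @ 2 # replicate k N) = 0"
proof -
  obtain js where js: "path js 2 (N - 1)" using path_exists by blast
  define t' where "t' = fold FF js t"
  have t': "t' \<in> S" unfolding t'_def by (rule foldr_mem(2)[OF path_I1[OF js] t])
  obtain g where g: "\<And>l i k. 2 \<le> l \<Longrightarrow> l \<le> N - 1 \<Longrightarrow> i + k + 1 = a \<Longrightarrow> t (replicate i N @ l # replicate k N) = g l * p powi (1 * (int k - int i))"
    using M_coefs(2)[OF subsetD[OF SM t]] unfolding coefs_def by blast
  obtain c where c: "c * c = 1" "\<And>i k. t' (replicate i N @ (N - 1) # replicate k N) = c * t (replicate i N @ 2 # replicate k N)"
    using path_word_FF[OF js, of N t] unfolding t'_def by blast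
  have N1: "2 \<le> N - 1" "(2::nat) \<le> 2" "N \<noteq> 2" using N_ge_5 by auto
  have gs: "lsign 2 = - 1" by (simp only: lsign_def end_letters if_False)
  have z: "zexp (h + 1) = 0" by (simp add: zexp_def)
  have "FF (h + 1) t' (replicate a N) = (\<Sum>i<a. (- c * g 2) * p powi (2 * 1 * (int (a - 1 - i) - int i)))"
    unfolding FF_def tact_replicate[where s = "sgn_op (h + 1)", OF twoterm_DF end_values(25) p0]
  proof (rule sum.cong[OF refl])
    fix i assume i: "i \<in> {..<a}"
    then have ia: "i + (a - 1 - i) + 1 = a" by auto
    have "DF (h + 1) (\<lambda>w'. t' (replicate i N @ w' # replicate (a - 1 - i) N)) N = - c * g 2 * p powi (1 * (int (a - 1 - i) - int i))" (is "?D = _")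
      unfolding DF_def end_letters gs using N1 c(2) g[OF N1(2,1) ia] by simp
    moreover have "(- 0 + 1) * d + 1 * d = 2 * 1 * d" for d :: int by simp
    ultimately show "p powi ((- zexp (h + 1) + B (h + 1) N) * (int (a - 1 - i) - int i)) * DF (h + 1) (\<lambda>w'. t' (replicate i N @ w' # replicate (a - 1 - i) N)) N
      = (- c * g 2) * p powi (2 * 1 * (int (a - 1 - i) - int i))"
      unfolding z end_values by (simp only: powi_merge)
  qed
  moreover have "FF (h + 1) t' (replicate a N) = 0" using lowest_coef[OF SF[OF _ t']] h1_le_s by auto
  ultimately have "- c * g 2 = 0"
    using powi_sum_nonzero[OF a1, of 1] unfolding sum_distrib_left[symmetric] by (metis mult_eq_0_iff)
  then have "g 2 = 0" using c(1) by auto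
  then show ?thesis using g[OF N1(2,1) ik] by simp
qed

text \<open>At the highest word F_0 reads only words with one letter N - 1, and at the lowest word
  E_0 reads only words with one letter 2.\<close>

lemma affine_coefs: 
  assumes t: "t \<in> S" shows "FF 0 t (replicate a 1) = 0" "EE 0 t (replicate a N) = 0"
proof -
  have ne: "(1::nat) \<noteq> 2" "N \<noteq> N - 1" using N_ge_5 by auto
  show "FF 0 t (replicate a 1) = 0"
    unfolding FF_def tact_replicate[where s = "sgn_op 0", OF twoterm_DF end_values(26) p0] DF_def end_letters
    using ne by (intro sum.neutral) (auto simp: coef_next_to_highest[OF t])
  show "EE 0 t (replicate a N) = 0"
    unfolding EE_def tact_replicate[where s = "sgn_op 0", OF twoterm_DE end_values(26) p0] DE_def end_letters
    using ne by (intro sum.neutral) (auto simp: coef_next_to_lowest[OF t])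
qed

end


section \<open>Weights\<close>

definition wt :: "nat \<Rightarrow> weight" where
  "wt l = (if l \<le> r then del l else if l \<le> r + h then eps (l - r) else if bar l \<le> r then - del (bar l)
     else if bar l \<le> r + h then - eps (bar l - r) else 0)"

lemma ip_add_left: "ip m n (x + y) z = ip m n x z + ip m n y z"
  by (simp add: ip_def distrib_right sum.distrib)

lemma ip_diff_left: "ip m n (x - y) z = ip m n x z - ip m n y z"
  by (simp add: ip_def left_diff_distrib sum_subtractf)

lemma ip_diff_right: "ip m n z (x - y) = ip m n z x - ip m n z y"
  by (simp add: ip_def right_diff_distrib sum_subtractf)

lemma ip_uminus: "ip m n (- x) z = - ip m n x z" "ip m n z (- x) = - ip m n z x"
  by (simp_all add: ip_def sum_negf)

lemma ip_zero: "ip m n 0 z = 0" "ip m n z 0 = 0"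
  by (simp_all add: ip_def)

lemma ip_basis:
  "1 \<le> k \<Longrightarrow> k \<le> h \<Longrightarrow> ip m n (eps k) z = fst z k" "1 \<le> k \<Longrightarrow> k \<le> r \<Longrightarrow> ip m n (del k) z = - snd z k"
  by (simp_all add: ip_def eps_def del_def h_def r_def if_distrib[of "\<lambda>x. x * _"] cong: if_cong)

lemma wt_bar: "1 \<le> l \<Longrightarrow> l \<le> N \<Longrightarrow> wt (bar l) = - wt l"
  using params h_less_m by (auto simp: wt_def bar_def)

lemma wt_cases:
  assumes "1 \<le> l" "l \<le> N"
  obtains (d) "l \<le> r" "wt l = del l" | (e) k where "1 \<le> k" "k \<le> h" "l = r + k" "wt l = eps k"
  | (z) "l = bar l" "wt l = 0" "l = s + 1"
  | (d') k where "1 \<le> k" "k \<le> r" "l = bar k" "wt l = - del k" | (e') k where "1 \<le> k" "k \<le> h" "l = bar (r + k)" "wt l = - eps k"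
proof -
  have b: "bar (bar l) = l" "1 \<le> bar l" using assms by (auto simp: bar_def)
  have N': "N = 2 * s \<or> N = 2 * s + 1" using N_cases by blast
  consider "l \<le> r" | "r < l" "l \<le> r + h" | "r + h < l" "bar l \<le> r" | "r + h < l" "r < bar l" "bar l \<le> r + h" | "r + h < l" "r + h < bar l"
    by linarith
  then show thesis
  proof cases
    case 1 then show thesis using d by (simp add: wt_def)
  next
    case 2 then show thesis using e[of "l - r"] by (simp add: wt_def)
  next
    case 3 then show thesis using d'[of "bar l"] b by (simp add: wt_def)
  next
    case 4 then show thesis using e'[of "bar l - r"] b by (simp add: wt_def)
  next
    case 5
    then have "l = s + 1" "l = bar l" using N' params(2) by (auto simp: bar_def)
    moreover have "wt l = 0" using 5 by (simp add: wt_def)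
    ultimately show thesis using z by blast
  qed
qed

lemma lform_bar:
  assumes y: "1 \<le> y" "y \<le> N" shows "lform (bar y) x = - lform y x"
proof (cases "1 \<le> x \<and> x \<le> N")
  case True
  then have "y = bar x \<longleftrightarrow> bar y = x" using bar_bar y by metis
  then show ?thesis using y True by (auto simp: lform_def lsign_bar bar_inj)
next
  case False then show ?thesis using y by (auto simp: lform_def bar_def)
qed

text \<open>Both sides change sign when l is replaced by \<open>bar l\<close>, which leaves l \<le>
  s. The letter of weight 0 is its own mirror image, so there both sides are 0.\<close>

lemma ip_wt:
  assumes "1 \<le> l" "l \<le> N" "1 \<le> l'" "l' \<le> N"
  shows "ip m n (wt l) (wt l') = lform l l'"
proof -
  have key: "ip m n (wt l) (wt l') = lform l l'" if l: "l \<le> s" "1 \<le> l" and l': "1 \<le> l'" "l' \<le> N" for l l'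
  proof -
    have small: "bar k \<le> s \<Longrightarrow> k \<le> s \<Longrightarrow> 1 \<le> k \<Longrightarrow> False" for k
      using N_cases(1) by (auto simp: bar_def)
    have tgt: "x = bar y \<longleftrightarrow> False" if "x \<le> s" "1 \<le> y" "y \<le> s" for x y
      using small[of y] that by auto
    have lN: "l \<le> N" using l N_cases(1) by auto
    have gl: "lsign l = (if l \<le> r then - 1 else 1)"
      using l params(2) h_less_m by (auto simp: lsign_def fermionic_def)
    show ?thesis
    proof (cases "l \<le> r")
      case True
      have "wt l = del l" using True by (simp add: wt_def)
      then have ipl: "ip m n (wt l) z = - snd z l" for z using ip_basis(2)[of l z] l True by simp
      from l' show ?thesis
      proof (cases l' rule: wt_cases)
        case d then show ?thesis using tgt[of l l'] l l' N_cases(3) by (auto simp: ipl lform_def gl True del_def)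
      next
        case (e k) then show ?thesis using tgt[of l l'] l l' params(2) True by (auto simp: ipl lform_def gl eps_def)
      next
        case z then show ?thesis using l N_cases by (auto simp: ipl lform_def gl)
      next
        case (d' k) 
        have k: "k \<le> s" "k \<le> N" using d' N_cases by auto
        have "l \<noteq> bar k" using tgt[of l k] l d' k by auto
        then show ?thesis using l' d' k True by (auto simp: ipl lform_def gl del_def bar_bar)
      next
        case (e' k)
        have k: "r + k \<le> s" "r + k \<le> N" using e' N_cases params(2) by auto
        have "l \<noteq> bar (r + k)" using tgt[of l "r + k"] l e' k by auto
        then show ?thesis using l' e' k True by (auto simp: ipl lform_def gl eps_def bar_bar)
      qed
    next
      case False
      then have lk: "1 \<le> l - r" "l - r \<le> h" using l params(2) by auto
      have "wt l = eps (l - r)" using False l params(2) by (simp add: wt_def)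
      then have ipl: "ip m n (wt l) z = fst z (l - r)" for z using ip_basis(1)[OF lk, of z] by simp
      from l' show ?thesis
      proof (cases l' rule: wt_cases)
        case d then show ?thesis using tgt[of l l'] l l' N_cases(3) False by (auto simp: ipl lform_def gl del_def)
      next
        case (e k) then show ?thesis using tgt[of l l'] l l' params(2) False by (auto simp: ipl lform_def gl eps_def)
      next
        case z then show ?thesis using l N_cases by (auto simp: ipl lform_def gl)
      next
        case (d' k) 
        have k: "k \<le> s" "k \<le> N" using d' N_cases by auto
        have "l \<noteq> bar k" using tgt[of l k] l d' k by auto
        then show ?thesis using l' d' k False by (auto simp: ipl lform_def gl del_def bar_bar)
      next
        case (e' k)
        have k: "r + k \<le> s" "r + k \<le> N" using e' N_cases params(2) by auto
        have "l \<noteq> bar (r + k)" using tgt[of l "r + k"] l e' k by auto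
        then show ?thesis using l' e' k False by (auto simp: ipl lform_def gl eps_def bar_bar)
      qed
    qed
  qed
  have pb: "lform (bar l) l' = - lform l l'" using assms lform_bar by blast
  have "N = 2 * s \<or> N = 2 * s + 1" using N_cases(1) by blast
  then have "l \<le> s \<or> bar l \<le> s \<or> l = s + 1 \<and> l = bar l" unfolding bar_def by arith
  then consider "l \<le> s" | "bar l \<le> s" | "l = s + 1" "l = bar l" by blast
  then show ?thesis
  proof cases
    case 1 then show ?thesis using key assms by blast
  next
    case 2
    then have "ip m n (wt (bar l)) (wt l') = lform (bar l) l'" using key[of "bar l" l'] assms bar_range by blast
    then show ?thesis using assms by (simp add: wt_bar ip_uminus pb)
  next
    case 3
    then have "wt l = - wt l" using wt_bar[OF assms(1,2)] by simp
    then have "ip m n (wt l) (wt l') = - ip m n (wt l) (wt l')" by (metis ip_uminus(1))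
    moreover have "lform l l' = - lform l l'" using pb 3 by simp
    ultimately show ?thesis by simp
  qed
qed

lemma sroot_wt:
  assumes "i \<le> s"
  shows "sroot m n i = wt (tgt i) - wt (src i)"
proof (cases "i = 0")
  case True
  have "wt (N - 1) = - del 2" "wt 1 = del 1" using wt_bar[of 2] N_ge_5 params(1) unfolding end_letters by (auto simp: wt_def)
  then show ?thesis using True by (simp add: sroot_def theta_def end_letters)
next
  case i: False
  have hs: "hh m = h" "ss m n = s" "rr n = r" by (simp_all add: h_def s_def r_def)
  consider (1) "i < h" | (2) "i = h" "odd m" | (3) "i = h" "even m" | (4) "i > h" "i < s" | (5) "i = s" "i > h" using assms by linarith
  then show ?thesis
  proof cases
    case 1 
    have "wt (r + i) = eps i" "wt (r + i + 1) = eps (i + 1)" using 1 i by (auto simp: wt_def)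
    then show ?thesis using 1 i by (simp add: sroot_def hs src_def tgt_def)
  next
    case 2
    have "bar (r + h + 1) = r + h + 1" using 2 N_cases(1) params(2) by (auto simp: bar_def)
    then have "wt (r + i) = eps i" "wt (r + i + 1) = 0" using 2 i by (auto simp: wt_def)
    then show ?thesis using 2 i by (simp add: sroot_def hs src_def tgt_def)
  next
    case 3
    have h1: "1 \<le> h" using i 3 by simp
    have m2: "m = 2 \<longleftrightarrow> h = 1" using params(4) 3 by auto
    have b: "bar (s + 1) = s" using 3 N_cases(1) by (auto simp: bar_def)
    have a: "wt (s + 1) = - eps h" using wt_bar[of s] N_cases(1,2) 3 params(2) h1 b bar_bar[of "s + 1"] by (simp add: wt_def)
    have "wt (s - 1) = (if h = 1 then del r else eps (h - 1))" using params(2) h1 by (auto simp: wt_def)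
    then show ?thesis using 3 i a m2 by (auto simp: sroot_def hs src_def tgt_def)
  next
    case 4
    have "wt (i - h) = del (i - h)" "wt (i - h + 1) = del (i - h + 1)" using 4 params(2) by (auto simp: wt_def)
    then show ?thesis using 4 i by (simp add: sroot_def hs src_def tgt_def)
  next
    case 5
    have ih: "i - h = r" using 5 params(2) by simp
    have "wt (r + 1) = (if m = 1 then 0 else eps 1)"
    proof (cases "m = 1")
      case True
      then have "h = 0" using params(4) by auto
      moreover have "N = 2 * r + 1" using params(3) True by simp
      then have "bar (r + 1) = r + 1" by (simp add: bar_def)
      ultimately have "wt (r + 1) = 0" by (simp add: wt_def)
      then show ?thesis by (simp only: if_P[OF True])
    next
      case False
      then have "1 \<le> h" using params(4) m1 by auto
      then show ?thesis using False by (simp add: wt_def)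
    qed
    moreover have "wt r = del r" by (simp add: wt_def)
    ultimately show ?thesis using 5 i ih by (simp add: sroot_def hs src_def tgt_def)
  qed
qed

lemma B_ip: "i \<le> s \<Longrightarrow> 1 \<le> l \<Longrightarrow> l \<le> N \<Longrightarrow> ip m n (sroot m n i) (wt l) = B i l"
  using node_range[of i] by (simp add: sroot_wt ip_diff_left ip_wt B_def)

lemma rform_eq: "i \<le> s \<Longrightarrow> j \<le> s \<Longrightarrow> rootip m n i j = rform i j"
  using node_range[of j] sroot_wt[of j] by (simp add: rootip_def ip_diff_right B_ip rform_def)

lemma lam_ip: "i \<le> s \<Longrightarrow> ip m n (sroot m n i) (lam a) = int a * B i 1"
proof -
  assume i: "i \<le> s"
  have "wt 1 = del 1" using params(1) by (simp add: wt_def)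
  moreover have "ip m n x (lam a) = int a * ip m n x (del 1)" for x
    using params(1) by (simp add: ip_def lam_def del_def r_def[symmetric] if_distrib[of "\<lambda>x. _ * x"] cong: if_cong)
  ultimately show ?thesis using B_ip[OF i, of 1] N_ge_5 by simp
qed

section \<open>Sums of simple roots along paths\<close>

lemma path_wt:
  assumes "path js l l'" shows "sum_list (map (sroot m n) js) = wt l - wt l'"
  using assms
proof (induction js arbitrary: l)
  case (Cons j js)
  then obtain k where k: "inner j" "arrow j l k" "path js k l'" by auto
  have j: "j \<le> s" using k(1) by (simp add: inner_def)
  have "sroot m n j = wt l - wt k"
    using k(2) sroot_wt[OF j] wt_bar node_range[OF j] by (auto simp: arrow_def)
  then show ?case using Cons.IH[OF k(3)] by simp
qed simp

lemma path_B:
  assumes "path js l l'" shows "(\<Sum>j\<leftarrow>js. B j x) = lform l x - lform l' x"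
  using assms
proof (induction js arbitrary: l)
  case (Cons j js)
  then obtain k where k: "inner j" "arrow j l k" "path js k l'" by auto
  have j: "j \<le> s" using k(1) by (simp add: inner_def)
  have "B j x = lform l x - lform k x"
    using k(2) node_range[OF j] by (auto simp: arrow_def B_def lform_bar)
  then show ?case using Cons.IH[OF k(3)] by simp
qed simp

text \<open>Node h+1 followed by a path from 2 to N - 1 sums to (\<delta>_1 - \<delta>_2) + 2
  \<delta>_2. This makes K_0 a product of inverse K_j.\<close>

lemma theta_chain: "\<exists>theta_path. set theta_path \<subseteq> I1 \<and> sum_list (map (sroot m n) theta_path) = theta \<and> (\<forall>x. (\<Sum>j\<leftarrow>theta_path. B j x) = - B 0 x)"
proof -
  obtain js where js: "path js 2 (N - 1)" using path_exists by blast
  have h1: "h + 1 \<le> s" by (rule h1_le_s)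
  have w: "wt (N - 1) = - del 2" "wt 1 = del 1" "wt 2 = del 2" using wt_bar[of 2] N_ge_5 params(1) unfolding end_letters by (auto simp: wt_def)
  have "set js \<subseteq> I1" by (rule path_I1[OF js])
  moreover have "sroot m n (h + 1) = del 1 - del 2" using sroot_wt[OF h1] w unfolding end_letters by simp
  then have "sum_list (map (sroot m n) ((h + 1) # js)) = theta"
    using path_wt[OF js] w by (simp add: theta_def)
  moreover have "(\<Sum>j\<leftarrow>(h + 1) # js. B j x) = - B 0 x" for x
    using path_B[OF js, of x] by (simp add: B_def end_letters)
  ultimately show ?thesis using h1 by (intro exI[of _ "(h + 1) # js"]) auto
qed

text \<open>A sum of simple roots orthogonal to all simple roots pairs equally with the two ends of
  every arrow; since the pairing is odd under \<open>bar\<close>, it is zero on all letters. A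
  functional that is positive on simple roots then gives a contradiction. This is what separates the
  weights below the highest one by the K_i of osp(m|n).\<close>

lemma roots_nondegenerate:
  assumes js: "js \<noteq> []" "set js \<subseteq> I1"
  shows "\<exists>i\<in>I1. (\<Sum>j\<leftarrow>js. rform i j) \<noteq> 0"
proof (rule ccontr)
  assume "\<not> ?thesis"
  then have z: "(\<Sum>j\<leftarrow>js. rform i j) = 0" if "i \<in> I1" for i using that by blast
  define Bs where "Bs l = (\<Sum>j\<leftarrow>js. B j l)" for l
  have node: "Bs (tgt i) = Bs (src i)" if "i \<in> I1" for i
  proof -
    have "(\<Sum>j\<leftarrow>js. rform i j) = (\<Sum>j\<leftarrow>js. B j (tgt i) - B j (src i))"
      using js(2) that rform_sym[of i] by (intro arg_cong[of _ _ sum_list] map_cong) (auto simp: rform_def)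
    then show ?thesis using z[OF that] by (simp add: Bs_def sum_list_subtractf)
  qed
  have Bbar: "Bs (bar l) = - Bs l" if "1 \<le> l" "l \<le> N" for l
    unfolding Bs_def by (induction js) (simp_all add: B_bar[OF that])
  have step: "Bs l = Bs (l + 1)" if l: "1 \<le> l" "l \<le> s" "l = s \<longrightarrow> odd m" for l
  proof (cases "l = 1")
    case True
    have "h + 1 \<in> I1" using h1_le_s by auto
    from node[OF this] show ?thesis unfolding end_letters True by simp
  next
    case False
    then have "2 \<le> l" using l by simp
    from node_of[OF this l(2,3)] show ?thesis using node inner_I(1) by metis
  qed
  have Bs_s: "Bs s = 0"
  proof (cases "odd m")
    case True
    then have "bar (s + 1) = s + 1" "s + 1 \<le> N" using N_cases(1) by (auto simp: bar_def)
    then have "Bs (s + 1) = 0" using Bbar[of "s + 1"] by simp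
    then show ?thesis using step[of s] True N_cases(2) by simp
  next
    case False
    have h1: "1 \<le> h" using params(4) m1 False by auto
    have "h \<in> I1" "src h = s + 1" "tgt h = s - 1" using h1 False params(2) by (auto simp: src_def tgt_def)
    then have "Bs (s - 1) = Bs (s + 1)" using node by metis
    moreover have "s + 1 = bar s" "s \<le> N" using N_cases(1) False by (auto simp: bar_def)
    then have "Bs (s + 1) = - Bs s" using Bbar[of s] N_cases(2) by simp
    moreover have "1 \<le> s - 1" "s - 1 \<noteq> s" "s - 1 + 1 = s" using N_cases(2) by auto
    then have "Bs (s - 1) = Bs s" using step[of "s - 1"] by (metis diff_le_self)
    ultimately show ?thesis by simp
  qed
  have Bs0: "Bs l = 0" if "1 \<le> l" "l \<le> s" for l
    using that(2,1)
  proof (induction l rule: inc_induct)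
    case base then show ?case using Bs_s by simp
  next
    case (step k) then show ?case using \<open>\<And>l. 1 \<le> l \<Longrightarrow> l \<le> s \<Longrightarrow> l = s \<longrightarrow> odd m \<Longrightarrow> Bs l = Bs (l + 1)\<close>[of k] by (simp add: Suc_eq_plus1)
  qed
  \<comment> \<open>A height: pairing with suitable coefficients gives the letter l \<le> s the
    value s + 1 - l, so every raising step increases it.\<close>
  define H where "H l = (\<Sum>x = 1..s. int (s + 1 - x) * lsign x * lform l x)" for l
  have H1: "H l = int (s + 1 - l)" if "1 \<le> l" "l \<le> s" for l
  proof -
    have "lsign x * lform l x = (if x = l then 1 else 0)" if "x \<in> {1..s}" for x
    proof -
      have "l \<noteq> bar x" using that \<open>l \<le> s\<close> N_cases(1) by (auto simp: bar_def)
      then show ?thesis using lsign_sq by (simp add: lform_def)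
    qed
    then have "H l = (\<Sum>x = 1..s. if x = l then int (s + 1 - x) else 0)"
      unfolding H_def by (intro sum.cong) (auto simp: mult.assoc)
    then show ?thesis using that by simp
  qed
  have Hbar: "H (bar l) = - H l" if "1 \<le> l" "l \<le> N" for l
    unfolding H_def sum_negf[symmetric] by (intro sum.cong) (auto simp: lform_bar[OF that])
  have Hs: "H (s + 1) \<le> 0"
  proof (cases "odd m")
    case True
    then have "bar (s + 1) = s + 1" "s + 1 \<le> N" using N_cases(1) by (auto simp: bar_def)
    then show ?thesis using Hbar[of "s + 1"] by simp
  next
    case False
    then have "s + 1 = bar s" "s \<le> N" using N_cases(1) by (auto simp: bar_def)
    then have "H (s + 1) = - H s" using Hbar[of s] N_cases(2) by simp
    then show ?thesis using H1[of s] N_cases(2) by simp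
  qed
  have pos: "H (tgt j) - H (src j) > 0" if "j \<in> I1" for j
  proof -
    have j: "j \<le> s" "j \<noteq> 0" using that by auto
    show ?thesis
      using node_disj[OF j(1)]
    proof (elim disjE exE conjE)
      fix l assume l: "1 \<le> l" "l \<le> s" "src j = l + 1" "tgt j = l"
      then show ?thesis using H1[of l] H1[of "l + 1"] Hs by (cases "l = s") auto
    next
      assume "src j = s + 1" "tgt j = s - 1"
      then show ?thesis using H1[of "s - 1"] Hs N_cases(2) by auto
    qed (use j in auto)
  qed
  have "(\<Sum>j\<leftarrow>js. H (tgt j) - H (src j)) = (\<Sum>x = 1..s. int (s + 1 - x) * lsign x * Bs x)"
  proof -
    have "H (tgt j) - H (src j) = (\<Sum>x = 1..s. int (s + 1 - x) * lsign x * B j x)" for j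
      by (simp add: H_def B_def sum_subtractf[symmetric] right_diff_distrib)
    then show ?thesis unfolding Bs_def by (induction js) (simp_all add: distrib_left sum.distrib)
  qed
  also have "\<dots> = 0" using Bs0 by (intro sum.neutral) auto
  finally have "(\<Sum>j\<leftarrow>js. H (tgt j) - H (src j)) = 0" .
  moreover have "(\<Sum>j\<leftarrow>js. H (tgt j) - H (src j)) > 0"
    using js
  proof (induction js)
    case (Cons j js)
    then show ?case using pos[of j] by (cases "js = []") auto
  qed simp
  ultimately show False by simp
qed

end

section \<open>Parity\<close>

definition even_part :: "(bit \<Rightarrow> 'v::ab_group_add set) \<Rightarrow> 'v \<Rightarrow> 'v" where
  "even_part G u = (SOME x. x \<in> G 0 \<and> u - x \<in> G 1)"

text \<open>The operator with eigenvalue 1 on \<open>G 0\<close> and -1 on \<open>G 1\<close>. It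
  turns gradedness into commutation relations, and these can be transported from tensors to the
  given module.\<close>

definition parity_op :: "(bit \<Rightarrow> 'v::ab_group_add set) \<Rightarrow> 'v \<Rightarrow> 'v" where
  "parity_op G u = even_part G u - (u - even_part G u)"

locale graded_space = cspace scale for scale :: "complex \<Rightarrow> 'v::ab_group_add \<Rightarrow> 'v" +
  fixes G :: "bit \<Rightarrow> 'v set"
  assumes graded: "z2_graded scale G"
begin

lemma subspace_G: "subspace (G d)"
  using graded by (simp add: z2_graded_def)

lemma even_part_eq:
  assumes "x \<in> G 0" "y \<in> G 1"
  shows "even_part G (x + y) = x"
proof -
  have "even_part G (x + y) \<in> G 0 \<and> (x + y) - even_part G (x + y) \<in> G 1"
    unfolding even_part_def by (rule someI[of _ x]) (use assms in simp)
  moreover define z where "z = even_part G (x + y)"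
  ultimately have z: "z \<in> G 0" "(x + y) - z \<in> G 1" by auto
  have "z - x \<in> G 0" using subspace_diff[OF subspace_G z(1) assms(1)] .
  moreover have "y - ((x + y) - z) \<in> G 1" using subspace_diff[OF subspace_G assms(2) z(2)] .
  then have "z - x \<in> G 1" by (simp add: algebra_simps)
  ultimately have "z - x \<in> G 0 \<inter> G 1" by blast
  then have "z - x = 0" using graded unfolding z2_graded_def by blast
  then show ?thesis by (simp add: z_def)
qed

lemma decompose: obtains x y where "x \<in> G 0" "y \<in> G 1" "u = x + y"
  using graded unfolding z2_graded_def by blast

lemma parity_op_eq: "x \<in> G 0 \<Longrightarrow> y \<in> G 1 \<Longrightarrow> parity_op G (x + y) = x - y"
  by (simp add: parity_op_def even_part_eq)

lemma parity_op_lin: "lin scale (parity_op G)"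
  unfolding lin_def
proof (intro conjI allI)
  fix u v c
  obtain x y where u: "x \<in> G 0" "y \<in> G 1" "u = x + y" by (rule decompose)
  obtain x' y' where v: "x' \<in> G 0" "y' \<in> G 1" "v = x' + y'" by (rule decompose)
  have "u + v = (x + x') + (y + y')" using u v by (simp add: algebra_simps)
  then have "parity_op G (u + v) = (x + x') - (y + y')"
    using parity_op_eq[OF subspace_add[OF subspace_G u(1) v(1)] subspace_add[OF subspace_G u(2) v(2)]] by simp
  then show "parity_op G (u + v) = parity_op G u + parity_op G v"
    using parity_op_eq[OF u(1,2)] parity_op_eq[OF v(1,2)] u v by simp
  have "scale c u = scale c x + scale c y" using u by (simp add: scale_right_distrib)
  then have "parity_op G (scale c u) = scale c x - scale c y"
    using parity_op_eq[OF subspace_scale[OF subspace_G u(1)] subspace_scale[OF subspace_G u(2)]] by simp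
  then show "parity_op G (scale c u) = scale c (parity_op G u)"
    using parity_op_eq[OF u(1,2)] u by (simp add: scale_right_diff_distrib)
qed

lemma mem_G_iff: "u \<in> G d \<longleftrightarrow> parity_op G u = scale (parity_sign d) u"
proof -
  obtain x y where u: "x \<in> G 0" "y \<in> G 1" "u = x + y" by (rule decompose)
  have p: "parity_op G u = x - y" using parity_op_eq u by simp
  have half: "z = 0" if "z = - z" for z :: 'v
  proof -
    have "scale 2 z = scale 1 z + scale 1 z" by (simp only: scale_left_distrib[symmetric]) simp
    also have "\<dots> = 0" using that by (simp add: eq_neg_iff_add_eq_0)
    finally show ?thesis by simp
  qed
  have z0: "0 \<in> G d" for d using subspace_0[OF subspace_G] .
  have uniq: "z = 0" if "z \<in> G 0" "z \<in> G 1" for z using that graded unfolding z2_graded_def by blast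
  show ?thesis
  proof (cases "d = 0")
    case True
    have "u \<in> G 0 \<longleftrightarrow> y = 0"
    proof
      assume "u \<in> G 0"
      then have "u - x \<in> G 0" using subspace_diff[OF subspace_G _ u(1)] by blast
      then show "y = 0" using uniq u by simp
    qed (use u in simp)
    moreover have "x - y = x + y \<longleftrightarrow> y = 0" using half[of y] by (auto simp: algebra_simps eq_neg_iff_add_eq_0)
    ultimately show ?thesis using True p u by simp
  next
    case False
    then have d: "d = 1" by simp
    have "u \<in> G 1 \<longleftrightarrow> x = 0"
    proof
      assume "u \<in> G 1"
      then have "u - y \<in> G 1" using subspace_diff[OF subspace_G _ u(2)] by blast
      then show "x = 0" using uniq u by simp
    qed (use u in simp)
    moreover have "x - y = - (x + y) \<longleftrightarrow> x = 0" using half[of x] by (auto simp: algebra_simps eq_neg_iff_add_eq_0)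
    ultimately show ?thesis using d p u by simp
  qed
qed

lemma graded_op_iff:
  "graded_op scale G d A \<longleftrightarrow> lin scale A \<and> (\<forall>u. parity_op G (A u) = scale (parity_sign d) (A (parity_op G u)))"
proof
  assume A: "graded_op scale G d A"
  then have l: "lin scale A" by (simp add: graded_op_def linear_imp_lin)
  have "parity_op G (A u) = scale (parity_sign d) (A (parity_op G u))" for u
  proof -
    obtain x y where u: "x \<in> G 0" "y \<in> G 1" "u = x + y" by (rule decompose)
    have "A x \<in> G d" "A y \<in> G (1 + d)" using A u unfolding graded_op_def by (metis add_0 image_subset_iff)+
    then have "parity_op G (A x) = scale (parity_sign d) (A x)" "parity_op G (A y) = scale (parity_sign (1 + d)) (A y)"
      by (simp_all add: mem_G_iff)
    moreover have "parity_sign (1 + d) = - parity_sign d" unfolding parity_sign_add by simp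
    ultimately show ?thesis using u parity_op_eq[OF u(1,2)]
      by (simp add: lin_add[OF l] lin_diff[OF l] lin_add[OF parity_op_lin] scale_right_diff_distrib)
  qed
  then show "lin scale A \<and> (\<forall>u. parity_op G (A u) = scale (parity_sign d) (A (parity_op G u)))" using l by blast
next
  assume A: "lin scale A \<and> (\<forall>u. parity_op G (A u) = scale (parity_sign d) (A (parity_op G u)))"
  have "A u \<in> G (c + d)" if "u \<in> G c" for u c
    using that A unfolding mem_G_iff parity_sign_add by (simp add: lin_scale[of scale A] mult.commute)
  then show "graded_op scale G d A"
    unfolding graded_op_def using lin_imp_linear[of scale A] A vector_space_axioms by blast
qed

text \<open>Half the sum and half the difference of a vector and its image under
  \<open>parity_op\<close> are its homogeneous components.\<close>

lemma submoduleI: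
  assumes W: "subspace W" "\<And>u. u \<in> W \<Longrightarrow> parity_op G u \<in> W"
    and ops: "\<And>i u. i \<in> I \<Longrightarrow> u \<in> W \<Longrightarrow> eop R i u \<in> W \<and> fop R i u \<in> W \<and> kop R i u \<in> W \<and> kinv R i u \<in> W"
  shows "submodule I scale G R W"
proof -
  have "x \<in> W \<and> y \<in> W" if "x \<in> G 0" "y \<in> G 1" "x + y \<in> W" for x y
  proof -
    have xy: "x - y \<in> W" using W(2)[OF that(3)] parity_op_eq[OF that(1,2)] by simp
    have "scale (1 / 2) ((x + y) + (x - y)) \<in> W" 
      by (rule subspace_scale[OF W(1) subspace_add[OF W(1) that(3) xy]])
    moreover have "scale (1 / 2) ((x + y) - (x - y)) \<in> W"
      by (rule subspace_scale[OF W(1) subspace_diff[OF W(1) that(3) xy]])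
    moreover have "scale (1 / 2) (z + z) = z" for z
      by (simp only: scale_right_distrib scale_left_distrib[symmetric]) simp
    ultimately show ?thesis by (simp add: algebra_simps)
  qed
  then show ?thesis unfolding submodule_def using W(1) ops by blast
qed

end

section \<open>The module\<close>

definition scP :: "(complex \<Rightarrow> 'v \<Rightarrow> 'v) \<Rightarrow> complex \<Rightarrow> 'v \<times> ('x \<Rightarrow> complex) \<Rightarrow> 'v \<times> ('x \<Rightarrow> complex)" where
  "scP sc c x = (sc c (fst x), sT c (snd x))"

lemma scP_Pair [simp]: "scP sc c (u, t) = (sc c u, sT c t)"
  by (simp add: scP_def)

lemma lin_pair: "lin sc X \<Longrightarrow> lin sT Y \<Longrightarrow> lin (scP sc) (map_prod X Y)"
  by (auto simp: lin_def)

locale osp_module = osp m n p for m n p +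
  fixes a :: nat and sc :: "complex \<Rightarrow> 'v::ab_group_add \<Rightarrow> 'v" and G :: "bit \<Rightarrow> 'v set" and R :: "'v gens"
  assumes a1: "a \<ge> 1" and V: "is_V m n p (lam a) sc G R"
begin

lemma rep: "Uq_osp_rep m n p sc G R" and irred: "irreducible_rep (osp_index m n) sc G R"
  using V by (auto simp: is_V_def)

lemma osp_index_I1: "osp_index m n = I1"
  by (simp add: osp_index_def s_def)

sublocale graded_space sc G
proof -
  have "z2_graded sc G" using rep by (simp add: Uq_rep_def)
  moreover then have "vector_space sc" by (simp add: z2_graded_def)
  ultimately show "graded_space sc G" by (simp add: graded_space_def cspace_def graded_space_axioms_def)
qed

lemma relations:
  assumes "i \<in> I1"
  shows "graded_op sc G (par i) (eop R i)" "graded_op sc G (par i) (fop R i)" "graded_op sc G 0 (kop R i)" "graded_op sc G 0 (kinv R i)"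
    "kop R i (kinv R i v) = v" "kinv R i (kop R i v) = v" 
    "j \<in> I1 \<Longrightarrow> kop R i (kop R j v) = kop R j (kop R i v)"
    "j \<in> I1 \<Longrightarrow> kop R i (eop R j v) = sc (p powi rform i j) (eop R j (kop R i v))"
    "j \<in> I1 \<Longrightarrow> kop R i (fop R j v) = sc (p powi (- rform i j)) (fop R j (kop R i v))"
    "j \<in> I1 \<Longrightarrow> eop R i (fop R j v) = sc (parity_sign (par i * par j)) (fop R j (eop R i v)) +
          (if i = j then sc dq (kop R i (kop R i v) - kinv R i (kinv R i v)) else 0)"
proof -
  have i: "i \<in> osp_index m n" "i \<le> s" using assms by (auto simp: osp_index_I1)
  note U = rep[unfolded Uq_rep_def]
  note U1 = U[THEN conjunct2, THEN conjunct1] and U2 = U[THEN conjunct2, THEN conjunct2, THEN conjunct1]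
    and U3 = U[THEN conjunct2, THEN conjunct2, THEN conjunct2, THEN conjunct1]
    and U4 = U[THEN conjunct2, THEN conjunct2, THEN conjunct2, THEN conjunct2, THEN conjunct1]
    and U5 = U[THEN conjunct2, THEN conjunct2, THEN conjunct2, THEN conjunct2, THEN conjunct2, THEN conjunct1]
  show "graded_op sc G (par i) (eop R i)" "graded_op sc G (par i) (fop R i)" "graded_op sc G 0 (kop R i)" "graded_op sc G 0 (kinv R i)"
    using bspec[OF U1 i(1)] unfolding par_eq[OF i(2)] by blast+
  show "kop R i (kinv R i v) = v" "kinv R i (kop R i v) = v" using bspec[OF U2 i(1)] by blast+
  assume jj: "j \<in> I1"
  then have j: "j \<in> osp_index m n" "j \<le> s" by (auto simp: osp_index_I1)
  show "kop R i (kop R j v) = kop R j (kop R i v)" using bspec[OF bspec[OF U3 i(1)] j(1)] by blast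
  show "kop R i (eop R j v) = sc (p powi rform i j) (eop R j (kop R i v))"
    "kop R i (fop R j v) = sc (p powi (- rform i j)) (fop R j (kop R i v))"
    using bspec[OF bspec[OF U4 i(1)] j(1)] unfolding rform_eq[OF i(2) j(2)] by blast+
  have "qcomm sc (par i) (par j) 1 (eop R i) (fop R j) v =
     (if i = j then sc dq (kop R i (kop R i v) - kinv R i (kinv R i v)) else 0)"
    unfolding par_eq[OF i(2)] par_eq[OF j(2)] using bspec[OF bspec[OF U5 i(1)] j(1)] by blast
  then show "eop R i (fop R j v) = sc (parity_sign (par i * par j)) (fop R j (eop R i v)) +
          (if i = j then sc dq (kop R i (kop R i v) - kinv R i (kinv R i v)) else 0)"
    unfolding qcomm_def mult_1_right diff_eq_eq by (simp only: add.commute)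
qed

lemma lin_R:
  assumes "i \<in> I1"
  shows "lin sc (eop R i)" "lin sc (fop R i)" "lin sc (kop R i)" "lin sc (kinv R i)"
  using relations(1-4)[OF assms] by (auto simp: graded_op_iff)

lemma kinv_fop:
  assumes "i \<in> I1" "j \<in> I1" shows "kinv R i (fop R j v) = sc (p powi rform i j) (fop R j (kinv R i v))"
proof -
  have "fop R j v = fop R j (kop R i (kinv R i v))" using relations(5)[OF assms(1)] by simp
  also have "\<dots> = sc (p powi rform i j) (kop R i (fop R j (kinv R i v)))"
    using relations(9)[OF assms, of "kinv R i v"] p0 by (simp add: power_int_minus)
  finally have "kinv R i (fop R j v) = kinv R i (sc (p powi rform i j) (kop R i (fop R j (kinv R i v))))" by simp
  then show ?thesis using relations(6)[OF assms(1)] by (simp add: lin_scale[OF lin_R(4)[OF assms(1)]])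
qed

text \<open>The highest vector of \<open>is_V\<close> need not be homogeneous. Its components
  satisfy the same equations, because the operators respect the grading, and one of them is
  nonzero.\<close>

lemma highest_vector:
  obtains v0 d0 where "v0 \<noteq> 0" "v0 \<in> G d0" "\<And>i. i \<in> I1 \<Longrightarrow> kop R i v0 = sc (p powi (int a * B i 1)) v0"
    "\<And>i. i \<in> I1 \<Longrightarrow> eop R i v0 = 0"
proof -
  obtain v where v: "v \<noteq> 0" "has_weight m n p sc R (lam a) v" "\<And>i. i \<in> I1 \<Longrightarrow> eop R i v = 0"
    using V unfolding is_V_def osp_index_I1 by blast
  have k: "kop R i v = sc (p powi (int a * B i 1)) v" if "i \<in> I1" for i
    using v(2) that lam_ip[of i a] unfolding has_weight_def osp_index_I1 by simp
  \<comment> \<open>Twice the component of parity d.\<close>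
  define w where "w d = v + sc (parity_sign d) (parity_op G v)" for d
  have pp: "parity_op G (parity_op G u) = u" for u
  proof -
    obtain x y where u: "x \<in> G 0" "y \<in> G 1" "u = x + y" by (rule decompose)
    have "parity_op G u = x + (- y)" using parity_op_eq u by simp
    then show ?thesis using parity_op_eq[OF u(1) subspace_neg[OF subspace_G u(2)]] u by simp
  qed
  have wG: "w d \<in> G d" for d
    unfolding mem_G_iff w_def by (simp add: lin_add[OF parity_op_lin] lin_scale[OF parity_op_lin] pp scale_right_distrib add.commute)
  have "w 0 + w 1 = v + v" by (simp add: w_def)
  moreover have "v + v \<noteq> 0"
  proof
    assume "v + v = 0"
    moreover have "v + v = sc 2 v" by (metis one_add_one scale_left_distrib scale_one)
    ultimately show False using v(1) by simp
  qed
  ultimately obtain d where d: "w d \<noteq> 0" by (metis add_0)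
  have kw: "kop R i (w d) = sc (p powi (int a * B i 1)) (w d)" if "i \<in> I1" for i
  proof -
    have "kop R i (parity_op G v) = parity_op G (kop R i v)"
      using relations(3)[OF that] by (simp add: graded_op_iff)
    then show ?thesis unfolding w_def
      by (simp add: lin_add[OF lin_R(3)[OF that]] lin_scale[OF lin_R(3)[OF that]] k[OF that] lin_scale[OF parity_op_lin] scale_right_distrib mult.commute)
  qed
  have ew: "eop R i (w d) = 0" if "i \<in> I1" for i
  proof -
    have "parity_op G (eop R i v) = sc (parity_sign (par i)) (eop R i (parity_op G v))"
      using relations(1)[OF that] by (simp add: graded_op_iff)
    then have "sc (parity_sign (par i)) (eop R i (parity_op G v)) = 0" using v(3)[OF that] lin_0[OF parity_op_lin] by simp
    then have "eop R i (parity_op G v) = 0" by (auto simp: parity_sign_def split: if_splits)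
    then show ?thesis unfolding w_def
      by (simp add: lin_add[OF lin_R(1)[OF that]] lin_scale[OF lin_R(1)[OF that]] v(3)[OF that])
  qed
  show thesis using that[OF d wG kw ew] .
qed

end

text \<open>These rules would also turn an unapplied \<open>f + g\<close> into an abstraction.\<close>

declare plus_fun_apply [simp del] zero_fun_apply [simp del] minus_apply [simp del] uminus_apply [simp del]

locale osp_highest = osp_module m n p a sc G R for m n p a and sc :: "complex \<Rightarrow> 'v::ab_group_add \<Rightarrow> 'v" and G R +
  fixes v0 :: 'v and d0 :: bit
  assumes v0: "v0 \<noteq> 0" "v0 \<in> G d0" and kv0: "\<And>i. i \<in> I1 \<Longrightarrow> kop R i v0 = sc (p powi (int a * B i 1)) v0"
    and ev0: "\<And>i. i \<in> I1 \<Longrightarrow> eop R i v0 = 0"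
begin

text \<open>\<open>P\<close> relates the given module to \<open>M\<close>; it turns out to be the graph of a surjection from \<open>M\<close>.\<close>

definition P :: "('v \<times> (nat list \<Rightarrow> complex)) set" where
  "P = cyc (scP sc) (\<lambda>j. map_prod (fop R j) (FF j)) I1 (v0, xv a)"

lemma scP_sel: "fst (scP sc' c x) = sc' c (fst x)" "snd (scP sc' c x) = sT c (snd x)"
  by (simp_all add: scP_def)

lemma P_base: "(v0, xv a) \<in> P" by (simp add: P_def cyc.cyc_base)

lemma P_zero: "(0, 0) \<in> P" unfolding P_def zero_prod_def[symmetric] by (rule cyc.cyc_zero)

lemma P_add: "(u, t) \<in> P \<Longrightarrow> (u', t') \<in> P \<Longrightarrow> (u + u', t + t') \<in> P"
  unfolding P_def using cyc.cyc_add[of "(u, t)" _ _ _ _ "(u', t')"] by simp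

lemma P_scale: "(u, t) \<in> P \<Longrightarrow> (sc c u, sT c t) \<in> P"
  unfolding P_def using cyc.cyc_scale[of "(u, t)" "scP sc"] by simp

lemma P_diff: "(u, t) \<in> P \<Longrightarrow> (u', t') \<in> P \<Longrightarrow> (u - u', t - t') \<in> P"
  using P_add[of u t "sc (- 1) u'" "sT (- 1) t'"] P_scale[of u' t' "- 1"] by (simp add: sT_uminus)

lemma P_FF: "j \<in> I1 \<Longrightarrow> (u, t) \<in> P \<Longrightarrow> (fop R j u, FF j t) \<in> P"
  unfolding P_def using cyc.cyc_step[of "(u, t)" "scP sc" "\<lambda>j. map_prod (fop R j) (FF j)" I1 _ j] by simp

lemma P_induct [consumes 1, case_names base zero add scale step]:
  assumes "(u, t) \<in> P" "Q v0 (xv a)" "Q 0 0" "\<And>u t u' t'. (u, t) \<in> P \<Longrightarrow> Q u t \<Longrightarrow> (u', t') \<in> P \<Longrightarrow> Q u' t' \<Longrightarrow> Q (u + u') (t + t')"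
    "\<And>c u t. (u, t) \<in> P \<Longrightarrow> Q u t \<Longrightarrow> Q (sc c u) (sT c t)" "\<And>j u t. j \<in> I1 \<Longrightarrow> (u, t) \<in> P \<Longrightarrow> Q u t \<Longrightarrow> Q (fop R j u) (FF j t)"
  shows "Q u t"
proof -
  have "x \<in> cyc (scP sc) (\<lambda>j. map_prod (fop R j) (FF j)) I1 (v0, xv a) \<Longrightarrow> Q (fst x) (snd x)" for x
  proof (induction rule: cyc.induct)
    case (cyc_add x y)
    then show ?case using assms(4)[of "fst x" "snd x" "fst y" "snd y"] by (simp add: P_def)
  next
    case (cyc_scale x c)
    then show ?case using assms(5)[of "fst x" "snd x" c] by (simp add: P_def scP_sel)
  next
    case (cyc_step x j)
    then show ?case using assms(6)[of j "fst x" "snd x"] by (simp add: P_def)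
  qed (use assms(2,3) in auto)
  then show ?thesis using assms(1) unfolding P_def by fastforce
qed

text \<open>X on the given module and Y on tensors are compatible. Once P is known to be functional,
  \<open>transport_eq\<close> turns identities on M into identities on the given module.\<close>

definition pres :: "('v \<Rightarrow> 'v) \<Rightarrow> ((nat list \<Rightarrow> complex) \<Rightarrow> nat list \<Rightarrow> complex) \<Rightarrow> bool" where
  "pres X Y \<longleftrightarrow> (\<forall>u t. (u, t) \<in> P \<longrightarrow> (X u, Y t) \<in> P)"

lemma pres_commuting:
  assumes "lin sc X" "lin sT Y" "(X v0, Y (xv a)) \<in> P"
    and "\<And>j u. j \<in> I1 \<Longrightarrow> X (fop R j u) = sc (c j) (fop R j (X u))" "\<And>j t. j \<in> I1 \<Longrightarrow> Y (FF j t) = sT (c j) (FF j (Y t))"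
  shows "pres X Y"
proof -
  have "map_prod X Y x \<in> P" if "x \<in> P" for x
    unfolding P_def
    by (rule cyc_closed_commuting[where c = c, OF lin_pair[OF assms(1,2)]])
      (use assms(3-5) that in \<open>auto simp: P_def\<close>)
  then show ?thesis unfolding pres_def by (metis map_prod_simp)
qed

lemma pres_K:
  assumes i: "i \<in> I1" shows "pres (kop R i) (KK i)" "pres (kinv R i) (KI i)"
proof -
  have iss: "i \<le> s" using i by simp
  show "pres (kop R i) (KK i)"
    by (rule pres_commuting[where c = "\<lambda>j. p powi (- rform i j)"])
      (use i P_scale[OF P_base] in \<open>auto simp: lin_R lin_ops kv0 K_wb relations(9) K_EF\<close>)
  have "kinv R i v0 = sc (p powi (- (int a * B i 1))) v0"
  proof -
    have "sc (p powi (int a * B i 1)) (kinv R i v0) = v0" using relations(6)[OF i, of v0] kv0[OF i] lin_scale[OF lin_R(4)[OF i]] by metis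
    then have "sc (p powi (- (int a * B i 1))) v0 = sc (p powi (- (int a * B i 1)) * p powi (int a * B i 1)) (kinv R i v0)" by (metis scale_scale)
    then show ?thesis using p0 by (simp add: power_int_minus)
  qed
  then show "pres (kinv R i) (KI i)"
    by (intro pres_commuting[where c = "\<lambda>j. p powi (rform i j)"])
      (use i P_scale[OF P_base] in \<open>auto simp: lin_R lin_ops K_wb kinv_fop K_EF\<close>)
qed

text \<open>For E this is the highest weight argument on pairs: both components obey the same
  commutator with F_j and both generators are killed.\<close>

lemma pres_EF:
  assumes i: "i \<in> I1" shows "pres (eop R i) (EE i)" "pres (fop R i) (FF i)"
proof -
  show "pres (fop R i) (FF i)" using P_FF[OF i] by (simp add: pres_def)
  have kill: "EE i (xv a) = 0" using I1_cases[OF i] inner_wb end_wb by auto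
  have "(eop R i u, EE i t) \<in> P" if "(u, t) \<in> P" for u t
    using that
  proof (induction rule: P_induct)
    case base
    show ?case using P_zero ev0[OF i] kill by simp
  next
    case zero
    show ?case using P_zero lin_0[OF lin_R(1)[OF i]] lin_0[OF lin_ops(1)] by simp
  next
    case (add u t u' t')
    then show ?case using P_add by (simp add: lin_add[OF lin_R(1)[OF i]] lin_add[OF lin_ops(1)])
  next
    case (scale c u t)
    then show ?case using P_scale by (simp add: lin_scale[OF lin_R(1)[OF i]] lin_scale[OF lin_ops(1)])
  next
    case (step j u t)
    have 1: "(sc (parity_sign (par i * par j)) (fop R j (eop R i u)), sT (parity_sign (par i * par j)) (FF j (EE i t))) \<in> P"
      by (intro P_scale P_FF step)
    have 2: "(sc dq (kop R i (kop R i u) - kinv R i (kinv R i u)), sT dq (KK i (KK i t) - KI i (KI i t))) \<in> P"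
      using pres_K[OF i] step(2) unfolding pres_def by (intro P_scale P_diff) auto
    have 3: "(if i = j then sc dq (kop R i (kop R i u) - kinv R i (kinv R i u)) else 0, if i = j then sT dq (KK i (KK i t) - KI i (KI i t)) else 0) \<in> P"
      using 2 P_zero by auto
    have iss: "i \<le> s" "j \<le> s" using i step(1) by auto
    show ?case unfolding relations(10)[OF i step(1)] EE_FF[OF iss] by (rule P_add[OF 1 3])
  qed
  then show "pres (eop R i) (EE i)" by (simp add: pres_def)
qed

text \<open>The highest word is even, while its partner v0 has parity d0; the sign makes up for the
  difference.\<close>

definition ParT where "ParT t = sT (parity_sign d0) (Par t)"

lemma pres_parity: "pres (parity_op G) ParT"
proof (rule pres_commuting[where c = "\<lambda>j. parity_sign (par j)"])
  show "lin sc (parity_op G)" by (rule parity_op_lin)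
  show "lin sT ParT" using lin_PP unfolding lin_def ParT_def by (simp add: sT_add sT_sT mult.commute)
  have "Par (xv a) = xv a"
  proof -
    have w: "wprod (\<lambda>l. if fermionic l then - 1 else 1) (replicate k 1) = (1::complex)" for k
      using end_letters(1) by (induction k) auto
    have "wprod (\<lambda>l. if fermionic l then - 1 else 1) u * cword 1 u = cword 1 u" for u
      using w[of "length u"] by (cases "u = replicate (length u) 1") (metis mult_1_left, simp add: cword_def)
    then show ?thesis by (auto simp: Par_def trunc_def fun_eq_iff)
  qed
  moreover have "parity_op G v0 = sc (parity_sign d0) v0" using v0(2) by (simp add: mem_G_iff)
  ultimately show "(parity_op G v0, ParT (xv a)) \<in> P" using P_scale[OF P_base] by (simp add: ParT_def)
  fix j u t assume j: "j \<in> I1"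
  show "parity_op G (fop R j u) = sc (parity_sign (par j)) (fop R j (parity_op G u))"
    using relations(2)[OF j] by (simp add: graded_op_iff)
  have "j \<le> s" using j by simp
  then show "ParT (FF j t) = sT (parity_sign (par j)) (FF j (ParT t))"
    unfolding ParT_def by (simp add: lin_scale[OF lin_ops(2)] PP_ops sT_sT mult.commute ps_mult_left mult.left_commute)
qed

lemma P_M: "(u, t) \<in> P \<Longrightarrow> t \<in> M a"
  by (induction rule: P_induct) (rule cyc.intros; assumption)+

lemma M_P: "t \<in> M a \<Longrightarrow> \<exists>u. (u, t) \<in> P"
  by (induction rule: cyc.induct) (use P_base P_zero P_add P_scale P_FF in blast)+

lemma pres_comp: "pres X Y \<Longrightarrow> pres X' Y' \<Longrightarrow> pres (\<lambda>u. X (X' u)) (\<lambda>t. Y (Y' t))"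
  by (simp add: pres_def)

lemma pres_lin:
  "pres (\<lambda>u. u) (\<lambda>t. t)" "pres (\<lambda>u. 0) (\<lambda>t. 0)" "pres X Y \<Longrightarrow> pres (\<lambda>u. sc c (X u)) (\<lambda>t. sT c (Y t))"
  "pres X Y \<Longrightarrow> pres X' Y' \<Longrightarrow> pres (\<lambda>u. X u + X' u) (\<lambda>t. Y t + Y' t)"
  "pres X Y \<Longrightarrow> pres X' Y' \<Longrightarrow> pres (\<lambda>u. X u - X' u) (\<lambda>t. Y t - Y' t)"
  by (simp_all add: pres_def P_zero P_scale P_add P_diff)

section \<open>Descent of the affine generators\<close>

definition shadow :: "(nat list \<Rightarrow> complex) set \<Rightarrow> 'v set" where
  "shadow Q = {u. \<exists>t. (u, t) \<in> P \<and> t \<in> Q}"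

text \<open>Irreducibility enters here: the image of a stable set of tensors is a graded
  submodule.\<close>

lemma shadow_submodule:
  assumes zero: "0 \<in> Q" and add: "\<And>t t'. t \<in> Q \<Longrightarrow> t' \<in> Q \<Longrightarrow> t + t' \<in> Q" and scale: "\<And>c t. t \<in> Q \<Longrightarrow> sT c t \<in> Q"
    and ops: "\<And>j t. j \<in> I1 \<Longrightarrow> t \<in> Q \<Longrightarrow> EE j t \<in> Q \<and> FF j t \<in> Q \<and> KK j t \<in> Q \<and> KI j t \<in> Q" and Par: "\<And>t. t \<in> Q \<Longrightarrow> Par t \<in> Q"
  shows "shadow Q = {0} \<or> shadow Q = UNIV"
proof -
  have "subspace (shadow Q)"
  proof (rule subspaceI)
    show "0 \<in> shadow Q" unfolding shadow_def using zero P_zero by blast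
    show "x + y \<in> shadow Q" if "x \<in> shadow Q" "y \<in> shadow Q" for x y
      using that add P_add unfolding shadow_def by blast
    show "sc c x \<in> shadow Q" if "x \<in> shadow Q" for c x
      using that scale P_scale unfolding shadow_def by blast
  qed
  moreover have "parity_op G u \<in> shadow Q" if "u \<in> shadow Q" for u
  proof -
    from that obtain t where t: "(u, t) \<in> P" "t \<in> Q" by (auto simp: shadow_def)
    have "ParT t \<in> Q" using t(2) Par scale by (simp add: ParT_def)
    then show ?thesis using t(1) pres_parity unfolding pres_def shadow_def by blast
  qed
  moreover have "eop R i u \<in> shadow Q \<and> fop R i u \<in> shadow Q \<and> kop R i u \<in> shadow Q \<and> kinv R i u \<in> shadow Q"
    if "i \<in> I1" "u \<in> shadow Q" for i u
    using that ops pres_EF[OF that(1)] pres_K[OF that(1)] unfolding pres_def shadow_def by blast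
  ultimately have "submodule I1 sc G R (shadow Q)" by (rule submoduleI)
  then show ?thesis using irred unfolding irreducible_rep_def osp_index_I1 by blast
qed

lemma P_onto: "\<exists>t. (u, t) \<in> P"
proof -
  have "shadow UNIV = {0} \<or> shadow UNIV = UNIV" by (rule shadow_submodule) auto
  moreover have "v0 \<in> shadow UNIV" using P_base by (auto simp: shadow_def)
  ultimately have "u \<in> shadow UNIV" using v0(1) by auto
  then show ?thesis by (auto simp: shadow_def)
qed

definition Rad :: "(nat \<Rightarrow> (nat list \<Rightarrow> complex) \<Rightarrow> nat list \<Rightarrow> complex) \<Rightarrow> nat list \<Rightarrow> (nat list \<Rightarrow> complex) set" where
  "Rad A w = {t. \<forall>es. set es \<subseteq> I1 \<longrightarrow> foldr A es t w = 0}"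

text \<open>One argument for both radicals: A raises and w is the highest word, or A lowers and w is
  the lowest one. Closure under A' comes from moving A' outwards through the product of A's: the
  commutators are diagonal, and an outermost A' has no coefficient at w.\<close>

lemma Rad_closed:
  assumes AA': "A = EE \<and> A' = FF \<or> A = FF \<and> A' = EE" and lins: "\<And>j. lin sT (A j)"
    and row: "\<And>j t. j \<in> I1 \<Longrightarrow> A' j t w = 0"
    and comm: "\<And>i j t. i \<in> I1 \<Longrightarrow> j \<in> I1 \<Longrightarrow> \<exists>c d. A i (A' j t) = sT c (A' j (A i t)) + sT d (KK i (KK i t) - KI i (KI i t))"
    and K: "\<And>i j t. j \<in> I1 \<Longrightarrow> \<exists>c. A j (KK i t) = sT c (KK i (A j t))" "\<And>i j t. j \<in> I1 \<Longrightarrow> \<exists>c. A j (KI i t) = sT c (KI i (A j t))"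
    and P: "\<And>j t. j \<in> I1 \<Longrightarrow> \<exists>c. A j (Par t) = sT c (Par (A j t))"
  shows "shadow (Rad A w) = {0} \<or> shadow (Rad A w) = UNIV"
proof (rule shadow_submodule)
  have fl: "lin sT (foldr A es)" for es
    by (induction es) (auto simp: lin_def lin_add[OF lins(1)] lin_scale[OF lins(1)])
  have fun_app: "(f + g) x = f x + g x" "(f - g) x = f x - g x" "(0 :: nat list \<Rightarrow> complex) x = 0" for f g :: "nat list \<Rightarrow> complex" and x
    by (simp_all add: plus_fun_def zero_fun_def fun_diff_def)
  have diag: "\<exists>c. foldr A es (Y t) = sT c (Y (foldr A es t))" if "set es \<subseteq> I1" and Y: "\<And>j t. j \<in> I1 \<Longrightarrow> \<exists>c. A j (Y t) = sT c (Y (A j t))" for es Y t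
    using that(1)
  proof (induction es)
    case Nil
    show ?case by (intro exI[of _ 1]) simp
  next
    case (Cons e es)
    obtain c where "foldr A es (Y t) = sT c (Y (foldr A es t))" using Cons by auto
    moreover obtain d where "A e (Y (foldr A es t)) = sT d (Y (A e (foldr A es t)))" using Y[of e] Cons.prems by auto
    ultimately show ?case by (intro exI[of _ "c * d"]) (simp add: lin_scale[OF lins(1)] sT_sT)
  qed
  have diag_closed: "Y t \<in> Rad A w" if "\<And>j t. j \<in> I1 \<Longrightarrow> \<exists>c. A j (Y t) = sT c (Y (A j t))" "\<And>t. t w = 0 \<Longrightarrow> Y t w = 0" "t \<in> Rad A w" for Y t
    unfolding Rad_def
  proof (intro CollectI allI impI)
    fix es assume es: "set es \<subseteq> I1"
    from diag[OF es that(1)] obtain c where "foldr A es (Y t) = sT c (Y (foldr A es t))" by blast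
    then show "foldr A es (Y t) w = 0" using that(2)[of "foldr A es t"] that(3) es by (simp add: Rad_def sT_apply)
  qed
  show "0 \<in> Rad A w" by (simp add: Rad_def lin_0[OF fl] fun_app)
  show add: "t + t' \<in> Rad A w" if "t \<in> Rad A w" "t' \<in> Rad A w" for t t'
    using that by (simp add: Rad_def lin_add[OF fl] fun_app)
  show scale: "sT c t \<in> Rad A w" if "t \<in> Rad A w" for c t
    using that by (simp add: Rad_def lin_scale[OF fl] sT_apply)
  show "Par t \<in> Rad A w" if "t \<in> Rad A w" for t
    by (rule diag_closed[OF P _ that], assumption) (simp add: Par_def)
  have KK: "KK i t \<in> Rad A w" "KI i t \<in> Rad A w" if "t \<in> Rad A w" for i t
    by (rule diag_closed[OF K(1) _ that]; simp add: KK_def) (rule diag_closed[OF K(2) _ that]; simp add: KI_def)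
  have Aj: "A j t \<in> Rad A w" if "t \<in> Rad A w" "j \<in> I1" for j t
    unfolding Rad_def
  proof (intro CollectI allI impI)
    fix es assume "set es \<subseteq> I1"
    then have "set (es @ [j]) \<subseteq> I1" using that(2) by simp
    then have "foldr A (es @ [j]) t w = 0" using that(1) unfolding Rad_def by blast
    then show "foldr A es (A j t) w = 0" by simp
  qed
  have A'j: "foldr A es (A' j t) w = 0" if "set es \<subseteq> I1" "t \<in> Rad A w" and j: "j \<in> I1" for es j t
    using that(1,2)
  \<comment> \<open>A' meets the innermost, that is the last, factor of the \<open>foldr\<close>
    first, hence the induction from the right.\<close>
  proof (induction es arbitrary: t rule: rev_induct)
    case Nil
    then show ?case by (simp add: row[OF j])
  next
    case (snoc i es)
    then have i: "i \<in> I1" "set es \<subseteq> I1" by auto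
    obtain c d where cd: "A i (A' j t) = sT c (A' j (A i t)) + sT d (KK i (KK i t) - KI i (KI i t))" using comm[OF i(1) j] by blast
    note t = snoc.prems(2)
    have "KK i (KK i t) - KI i (KI i t) \<in> Rad A w"
      using add[OF KK(1)[OF KK(1)[OF t]] scale[OF KK(2)[OF KK(2)[OF t]], of "- 1"]] by (simp add: sT_uminus)
    then have "foldr A es (KK i (KK i t) - KI i (KI i t)) w = 0" using i(2) by (simp add: Rad_def)
    then show ?case using snoc.IH[OF i(2) Aj[OF snoc.prems(2) i(1)]]
      by (simp add: cd lin_add[OF fl] lin_scale[OF fl] fun_app sT_apply)
  qed
  show "EE j t \<in> Rad A w \<and> FF j t \<in> Rad A w \<and> KK j t \<in> Rad A w \<and> KI j t \<in> Rad A w" if "j \<in> I1" "t \<in> Rad A w" for j t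
  proof -
    have "A j t \<in> Rad A w" "A' j t \<in> Rad A w" using Aj[OF that(2,1)] A'j[OF _ that(2,1)] by (auto simp: Rad_def)
    then show ?thesis using AA' KK[OF that(2)] by auto
  qed
qed

lemma row_zero: "j \<in> I1 \<Longrightarrow> FF j t (replicate k 1) = 0" "j \<in> I1 \<Longrightarrow> EE j t (replicate k N) = 0"
proof -
  have ne: "(1::nat) \<noteq> 2" "N \<noteq> 1" "N \<noteq> N - 1" "1 \<noteq> N" using N_ge_5 by auto
  have r: "DF (h + 1) g 1 = 0" "DE (h + 1) g N = 0" for g
    unfolding DF_def DE_def end_letters using ne by simp_all
  show "FF j t (replicate k 1) = 0" if "j \<in> I1"
    unfolding FF_def
    by (rule tact_replicate_row_zero) (use I1_cases[OF that] inner_end(6)[of j 1] r in auto)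
  show "EE j t (replicate k N) = 0" if "j \<in> I1"
    unfolding EE_def
    by (rule tact_replicate_row_zero) (use I1_cases[OF that] inner_end(5)[of j N] r in auto)
qed

lemma shadow_Rad:
  "shadow (Rad EE (replicate a 1)) = {0} \<or> shadow (Rad EE (replicate a 1)) = UNIV"
  "shadow (Rad FF (replicate a N)) = {0} \<or> shadow (Rad FF (replicate a N)) = UNIV"
proof -
  have inv: "p powi x \<noteq> 0" for x using p0 by simp
  have K1: "EE j (KK i t) = sT (p powi (- rform i j)) (KK i (EE j t))" "EE j (KI i t) = sT (p powi rform i j) (KI i (EE j t))"
    "FF j (KK i t) = sT (p powi rform i j) (KK i (FF j t))" "FF j (KI i t) = sT (p powi (- rform i j)) (KI i (FF j t))" if "j \<in> I1" for i j t
    using that p0 by (simp_all add: K_EF sT_sT power_int_minus)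
  have K2: "\<exists>c. EE j (KK i t) = sT c (KK i (EE j t))" "\<exists>c. EE j (KI i t) = sT c (KI i (EE j t))"
    "\<exists>c. FF j (KK i t) = sT c (KK i (FF j t))" "\<exists>c. FF j (KI i t) = sT c (KI i (FF j t))"
    "\<exists>c. EE j (Par t) = sT c (Par (EE j t))" "\<exists>c. FF j (Par t) = sT c (Par (FF j t))" if "j \<in> I1" for i j t
    using K1[OF that] PP_ops[of j t] that by (auto intro: exI)
  have e: "A + (if c then sT d X else 0) = A + sT (if c then d else 0) X" for A X :: "nat list \<Rightarrow> complex" and c d by simp
  have c1: "\<exists>c d. EE i (FF j t) = sT c (FF j (EE i t)) + sT d (KK i (KK i t) - KI i (KI i t))" if "i \<in> I1" "j \<in> I1" for i j t
  proof -
    have "i \<le> s" "j \<le> s" using that by auto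
    from EE_FF[OF this, of t, unfolded e] show ?thesis by (intro exI)
  qed
  have c2: "\<exists>c d. FF i (EE j t) = sT c (EE j (FF i t)) + sT d (KK i (KK i t) - KI i (KI i t))" if "i \<in> I1" "j \<in> I1" for i j t
  proof -
    have "i \<le> s" "j \<le> s" using that by auto
    from FF_EE[OF this, of t, unfolded e] show ?thesis by (intro exI)
  qed
  show "shadow (Rad EE (replicate a 1)) = {0} \<or> shadow (Rad EE (replicate a 1)) = UNIV"
    by (rule Rad_closed[where A' = FF, OF _ lin_ops(1) row_zero(1) c1 K2(1,2,5)]) auto
  show "shadow (Rad FF (replicate a N)) = {0} \<or> shadow (Rad FF (replicate a N)) = UNIV"
    by (rule Rad_closed[where A' = EE, OF _ lin_ops(2) row_zero(2) c2 K2(3,4,6)]) auto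
qed


section \<open>Separating the highest vector from lower weights\<close>

lemma powi_inj: "p powi x = p powi y \<longleftrightarrow> x = y"
proof -
  have "p powi z \<noteq> 1" if "z \<noteq> 0" for z
  proof (cases "z > 0")
    case True
    then show ?thesis using proot[of "nat z"] by (simp add: power_int_def)
  next
    case False
    then show ?thesis using proot[of "nat (- z)"] that p0 by (simp add: power_int_def power_inverse inverse_eq_1_iff)
  qed
  moreover have "p powi x = p powi y \<Longrightarrow> p powi (x - y) = 1" using p0 by (simp add: power_int_diff)
  ultimately show ?thesis by (metis eq_iff_diff_eq_0)
qed

definition shiftK :: "nat \<times> complex \<Rightarrow> 'v \<Rightarrow> 'v" where
  "shiftK x u = kop R (fst x) u - sc (snd x) u"

definition top_weight :: "nat \<Rightarrow> complex" where "top_weight i = p powi (int a * B i 1)"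

definition good :: "(nat \<times> complex) list \<Rightarrow> bool" where
  "good L \<longleftrightarrow> (\<forall>x\<in>set L. fst x \<in> I1 \<and> snd x \<noteq> top_weight (fst x))"

text \<open>Replaces a sum of weight spaces: vectors killed by a product of factors K_i - c, where c
  is never the eigenvalue of v0. Since the factors commute, such vectors are closed under sums, and
  on v0 a product of this kind is a nonzero scalar.\<close>

definition lower :: "'v set" where
  "lower = {w. \<exists>L. good L \<and> foldr shiftK L w = 0}"

lemma lin_shiftK: "fst x \<in> I1 \<Longrightarrow> lin sc (shiftK x)"
  using lin_R(3)[of "fst x"] by (auto simp: lin_def shiftK_def scale_right_distrib scale_right_diff_distrib mult.commute)

lemma lin_foldr_shiftK: "good L \<Longrightarrow> lin sc (foldr shiftK L)"
proof (induction L)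
  case (Cons x L)
  then have "lin sc (shiftK x)" "lin sc (foldr shiftK L)" using lin_shiftK by (auto simp: good_def)
  then show ?case by (auto simp: lin_def)
qed (simp add: lin_def)

lemma shiftK_commute:
  assumes "fst x \<in> I1" "fst y \<in> I1" shows "shiftK x (shiftK y u) = shiftK y (shiftK x u)"
  using relations(7)[OF assms, of u]
  by (simp add: shiftK_def lin_diff[OF lin_R(3)[OF assms(1)]] lin_diff[OF lin_R(3)[OF assms(2)]] lin_scale[OF lin_R(3)[OF assms(1)]]
    lin_scale[OF lin_R(3)[OF assms(2)]] scale_right_diff_distrib mult.commute)

lemma foldr_shiftK_commute1:
  "good L \<Longrightarrow> fst x \<in> I1 \<Longrightarrow> foldr shiftK L (shiftK x u) = shiftK x (foldr shiftK L u)"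
  by (induction L) (auto simp: good_def shiftK_commute)

lemma foldr_shiftK_commute:
  "good L \<Longrightarrow> good L' \<Longrightarrow> foldr shiftK L (foldr shiftK L' u) = foldr shiftK L' (foldr shiftK L u)"
  by (induction L') (auto simp: good_def foldr_shiftK_commute1[unfolded good_def])

lemma v0_not_lower: "v0 \<notin> lower"
proof
  assume "v0 \<in> lower"
  then obtain L where L: "good L" "foldr shiftK L v0 = 0" by (auto simp: lower_def)
  have "foldr shiftK L v0 = sc (\<Prod>x\<leftarrow>L. top_weight (fst x) - snd x) v0"
    using L(1)
  proof (induction L)
    case (Cons x L)
    then have x: "fst x \<in> I1" "foldr shiftK L v0 = sc (\<Prod>x\<leftarrow>L. top_weight (fst x) - snd x) v0" by (auto simp: good_def)
    have "shiftK x v0 = sc (top_weight (fst x) - snd x) v0"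
      using kv0[OF x(1)] by (simp add: shiftK_def top_weight_def scale_left_diff_distrib)
    then show ?case by (simp add: x(2) lin_scale[OF lin_shiftK[OF x(1)]] mult.commute)
  qed simp
  moreover have "(\<Prod>x\<leftarrow>L. top_weight (fst x) - snd x) \<noteq> 0"
    using L(1) by (induction L) (auto simp: good_def)
  ultimately show False using L(2) v0(1) by simp
qed

lemma lower_add: "w \<in> lower \<Longrightarrow> w' \<in> lower \<Longrightarrow> w + w' \<in> lower"
proof -
  assume "w \<in> lower" "w' \<in> lower"
  then obtain L L' where L: "good L" "foldr shiftK L w = 0" and L': "good L'" "foldr shiftK L' w' = 0" by (auto simp: lower_def)
  have "good (L @ L')" using L L' by (auto simp: good_def)
  moreover have "foldr shiftK (L @ L') (w + w') = foldr shiftK L' (foldr shiftK L w) + foldr shiftK L (foldr shiftK L' w')"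
    using foldr_shiftK_commute[OF L(1) L'(1)] by (simp add: lin_add[OF lin_foldr_shiftK[OF L(1)]] lin_add[OF lin_foldr_shiftK[OF L'(1)]])
  then have "foldr shiftK (L @ L') (w + w') = 0" using L L' lin_0[OF lin_foldr_shiftK[OF L(1)]] lin_0[OF lin_foldr_shiftK[OF L'(1)]] by simp
  ultimately show ?thesis unfolding lower_def by blast
qed

lemma lower_scale: "w \<in> lower \<Longrightarrow> sc c w \<in> lower"
  by (auto simp: lower_def lin_scale[OF lin_foldr_shiftK])

text \<open>By \<open>roots_nondegenerate\<close> some K_i distinguishes the weight of the monomial
  from that of v0, so a single factor suffices.\<close>

lemma lower_monomial:
  assumes "js \<noteq> []" "set js \<subseteq> I1" shows "foldr (fop R) js v0 \<in> lower"
proof -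
  have k: "kop R i (foldr (fop R) js v0) = sc (p powi (int a * B i 1 - (\<Sum>j\<leftarrow>js. rform i j))) (foldr (fop R) js v0)" if "i \<in> I1" for i
    using assms(2)
  proof (induction js)
    case Nil
    then show ?case using kv0[OF that] by simp
  next
    case (Cons j js)
    have "int a * B i 1 - (\<Sum>j\<leftarrow>j # js. rform i j) = - rform i j + (int a * B i 1 - (\<Sum>j\<leftarrow>js. rform i j))" by simp
    then have "p powi (int a * B i 1 - (\<Sum>j\<leftarrow>j # js. rform i j)) = p powi (- rform i j) * p powi (int a * B i 1 - (\<Sum>j\<leftarrow>js. rform i j))"
      using p0 by (simp only: power_int_add simp_thms)
    then show ?case using Cons that relations(9)[of i j] lin_scale[OF lin_R(2)[of j]] by simp
  qed
  obtain i where i: "i \<in> I1" "(\<Sum>j\<leftarrow>js. rform i j) \<noteq> 0" using roots_nondegenerate[OF assms] by blast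
  define \<kappa> where "\<kappa> = p powi (int a * B i 1 - (\<Sum>j\<leftarrow>js. rform i j))"
  have "good [(i, \<kappa>)]" using i by (simp add: good_def top_weight_def \<kappa>_def powi_inj)
  moreover have "foldr shiftK [(i, \<kappa>)] (foldr (fop R) js v0) = 0" using k[OF i(1)] by (simp add: shiftK_def \<kappa>_def)
  ultimately show ?thesis unfolding lower_def by blast
qed

inductive_set below :: "'v set" where
  below_mono: "js \<noteq> [] \<Longrightarrow> set js \<subseteq> I1 \<Longrightarrow> foldr (fop R) js v0 \<in> below"
| below_zero: "0 \<in> below"
| below_add: "x \<in> below \<Longrightarrow> y \<in> below \<Longrightarrow> x + y \<in> below"
| below_scale: "x \<in> below \<Longrightarrow> sc c x \<in> below"

lemma below_lower: "w \<in> below \<Longrightarrow> w \<in> lower"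
proof (induction rule: below.induct)
  case below_zero
  have "good []" "foldr shiftK [] (0 :: 'v) = 0" by (auto simp: good_def)
  then show ?case unfolding lower_def by blast
qed (auto intro: lower_monomial lower_add lower_scale)

lemma below_fop: "w \<in> below \<Longrightarrow> j \<in> I1 \<Longrightarrow> fop R j w \<in> below"
proof (induction rule: below.induct)
  case (below_mono js)
  then show ?case using below.below_mono[of "j # js"] by simp
next
  case below_zero
  then show ?case using lin_0[OF lin_R(2)] by (simp add: below.below_zero)
qed (auto simp: lin_add[OF lin_R(2)] lin_scale[OF lin_R(2)] intro: below.intros)

lemma fun_app: "(f + g) x = f x + g x" "(f - g) x = f x - g x" "(0 :: nat list \<Rightarrow> complex) x = 0" for f g :: "nat list \<Rightarrow> complex" and x
  by (simp_all add: plus_fun_def zero_fun_def fun_diff_def)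

text \<open>Every F_j produces tensors without x-coefficient and vectors in \<open>below\<close>, so
  the x-coefficient of t is carried by v0 alone.\<close>

lemma P_leading:
  assumes "(u, t) \<in> P" shows "\<exists>w\<in>below. u = sc (t (replicate a 1)) v0 + w"
  using assms
proof (induction rule: P_induct)
  case base
  have "xv a (replicate a 1) = 1" by (simp add: trunc_def cword_def)
  then show ?case by (intro bexI[of _ 0]) (auto intro: below.intros)
next
  case zero
  then show ?case by (intro bexI[of _ 0]) (auto simp: fun_app intro: below.intros)
next
  case (add u t u' t')
  then obtain w w' where "w \<in> below" "w' \<in> below" "u = sc (t (replicate a 1)) v0 + w" "u' = sc (t' (replicate a 1)) v0 + w'" by blast
  then show ?case by (intro bexI[of _ "w + w'"]) (auto simp: fun_app scale_left_distrib intro: below.intros)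
next
  case (scale c u t)
  then obtain w where "w \<in> below" "u = sc (t (replicate a 1)) v0 + w" by blast
  then show ?case by (intro bexI[of _ "sc c w"]) (auto simp: sT_apply scale_right_distrib intro: below.intros)
next
  case (step j u t)
  then obtain w where w: "w \<in> below" "u = sc (t (replicate a 1)) v0 + w" by blast
  have "fop R j v0 \<in> below" using below.below_mono[of "[j]"] step(1) by simp
  then have "sc (t (replicate a 1)) (fop R j v0) + fop R j w \<in> below" using below_fop[OF w(1) step(1)] by (intro below.intros)
  then show ?case using w step(1) by (intro bexI[of _ "sc (t (replicate a 1)) (fop R j v0) + fop R j w"])
     (auto simp: row_zero lin_add[OF lin_R(2)] lin_scale[OF lin_R(2)])
qed

lemma P_zero_leading:
  assumes "(0, t) \<in> P" shows "t (replicate a 1) = 0"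
proof (rule ccontr)
  define c where "c = t (replicate a 1)"
  assume c: "t (replicate a 1) \<noteq> 0"
  obtain w where w: "w \<in> below" "0 = sc c v0 + w" using P_leading[OF assms] unfolding c_def by blast
  then have "sc c v0 = - w" by (simp add: eq_neg_iff_add_eq_0)
  then have "sc (1 / c) (sc c v0) = sc (1 / c) (- w)" by simp
  then have v: "sc (- (1 / c)) w = v0" using c by (simp add: c_def[symmetric])
  have "v0 \<in> below" using below.below_scale[OF w(1), of "- (1 / c)"] unfolding v .
  then show False using below_lower v0_not_lower by blast
qed

text \<open>Two tensors over v0 have the same x-coefficient, which is 1 for the highest word and 0
  on the radical. So v0 is not in the image of the radical, and irreducibility makes that image
  zero.\<close>

lemma Rad_x_trivial: "shadow (Rad EE (replicate a 1)) = {0}"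
proof -
  have "v0 \<notin> shadow (Rad EE (replicate a 1))"
  proof
    assume "v0 \<in> shadow (Rad EE (replicate a 1))"
    then obtain t where t: "(v0, t) \<in> P" "t \<in> Rad EE (replicate a 1)" by (auto simp: shadow_def)
    have "foldr EE [] t (replicate a 1) = 0" using t(2) unfolding Rad_def by (auto simp del: foldr.simps)
    moreover have "(0, t - xv a) \<in> P" using P_diff[OF t(1) P_base] by simp
    then have "(t - xv a) (replicate a 1) = 0" by (rule P_zero_leading)
    ultimately show False by (simp add: fun_app trunc_def cword_def)
  qed
  then show ?thesis using shadow_Rad(1) by blast
qed

section \<open>The kernel of the map from M to the given module\<close>

definition kern :: "(nat list \<Rightarrow> complex) set" where "kern = {t. (0, t) \<in> P}"

lemma kern_closed: 
  "kern \<subseteq> M a" "\<And>j t. j \<in> I1 \<Longrightarrow> t \<in> kern \<Longrightarrow> EE j t \<in> kern" "\<And>j t. j \<in> I1 \<Longrightarrow> t \<in> kern \<Longrightarrow> FF j t \<in> kern"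
  "\<And>t. t \<in> kern \<Longrightarrow> t (replicate a 1) = 0"
proof -
  show "kern \<subseteq> M a" using P_M by (auto simp: kern_def)
  show "EE j t \<in> kern" if "j \<in> I1" "t \<in> kern" for j t
    using pres_EF(1)[OF that(1)] that(2) lin_0[OF lin_R(1)[OF that(1)]] unfolding pres_def kern_def by force
  show "FF j t \<in> kern" if "j \<in> I1" "t \<in> kern" for j t
    using pres_EF(2)[OF that(1)] that(2) lin_0[OF lin_R(2)[OF that(1)]] unfolding pres_def kern_def by force
qed (auto simp: kern_def P_zero_leading)

lemma kern_lowest: 
  assumes t: "t \<in> kern" shows "t (replicate a N) = 0"
proof (rule lowest_coef[of a kern t])
  show "EE j t \<in> kern" "FF j t \<in> kern" if "j \<in> I1" "t \<in> kern" for j t using kern_closed(2,3)[OF that] .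
  show "t (replicate a 1) = 0" if "t \<in> kern" for t using kern_closed(4)[OF that] .
qed (rule a1 kern_closed(1) t)+

lemma kern_affine: 
  assumes t: "t \<in> kern" shows "FF 0 t (replicate a 1) = 0" "EE 0 t (replicate a N) = 0"
proof -
  have c: "EE j t \<in> kern" "FF j t \<in> kern" if "j \<in> I1" "t \<in> kern" for j t using kern_closed(2,3)[OF that] .
  have d: "t (replicate a 1) = 0" if "t \<in> kern" for t using kern_closed(4)[OF that] .
  show "FF 0 t (replicate a 1) = 0"
    by (rule affine_coefs(1)[of a kern t]) (rule a1, rule kern_closed(1), rule c(1), assumption+, rule c(2), assumption+, rule d, assumption, rule t)
  show "EE 0 t (replicate a N) = 0"
    by (rule affine_coefs(2)[of a kern t]) (rule a1, rule kern_closed(1), rule c(1), assumption+, rule c(2), assumption+, rule d, assumption, rule t)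
qed

text \<open>The same argument with a vector vm lying over the lowest word in place of v0; that the
  y-coefficient over vm is well defined is \<open>kern_lowest\<close>.\<close>

lemma Rad_y_trivial: "shadow (Rad FF (replicate a N)) = {0}"
proof -
  obtain vm where vm: "(vm, yv a) \<in> P" using M_P[OF extremal_mem(1)] by blast
  have "vm \<notin> shadow (Rad FF (replicate a N))"
  proof
    assume "vm \<in> shadow (Rad FF (replicate a N))"
    then obtain t where t: "(vm, t) \<in> P" "t \<in> Rad FF (replicate a N)" by (auto simp: shadow_def)
    have "foldr FF [] t (replicate a N) = 0" using t(2) unfolding Rad_def by (auto simp del: foldr.simps)
    moreover have "t - yv a \<in> kern" using P_diff[OF t(1) vm] by (simp add: kern_def)
    then have "(t - yv a) (replicate a N) = 0" by (rule kern_lowest)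
    ultimately show False by (simp add: fun_app trunc_def cword_def)
  qed
  then show ?thesis using shadow_Rad(2) by blast
qed

text \<open>The tensor 0 lies in the radical, so only the vector 0 can lie over it.\<close>

lemma P_unique: "(u, t) \<in> P \<Longrightarrow> (u', t) \<in> P \<Longrightarrow> u = u'"
proof -
  assume "(u, t) \<in> P" "(u', t) \<in> P"
  from P_diff[OF this] have "(u - u', 0) \<in> P" by simp
  moreover have "0 \<in> Rad EE (replicate a 1)"
  proof -
    have "foldr EE es 0 = 0" for es by (induction es) (auto simp: lin_0[OF lin_ops(1)])
    then show ?thesis by (simp add: Rad_def fun_app)
  qed
  ultimately have "u - u' \<in> shadow (Rad EE (replicate a 1))" by (auto simp: shadow_def)
  then show ?thesis by (simp add: Rad_x_trivial)
qed

text \<open>Lowering operators move past E_0 and keep t in the kernel, so only the y-coefficient of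
  E_0 on the kernel matters, and \<open>kern_affine\<close> computes it. This puts E_0 t into the
  radical seen from y.\<close>

lemma kern_EE0: "t \<in> kern \<Longrightarrow> (u', EE 0 t) \<in> P \<Longrightarrow> u' = 0"
proof -
  assume t: "t \<in> kern" and u': "(u', EE 0 t) \<in> P"
  have "foldr FF es (EE 0 t) (replicate a N) = 0" if es: "set es \<subseteq> I1" for es
  proof -
    have "foldr FF es (EE 0 t) = EE 0 (foldr FF es t)"
      using es by (induction es) (auto simp: comm_affine)
    moreover have "foldr FF es t \<in> kern" using es t by (induction es) (auto intro: kern_closed)
    ultimately show ?thesis using kern_affine(2) by simp
  qed
  then have "EE 0 t \<in> Rad FF (replicate a N)" by (simp add: Rad_def)
  then have "u' \<in> shadow (Rad FF (replicate a N))" using u' by (auto simp: shadow_def)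
  then show ?thesis by (simp add: Rad_y_trivial)
qed

lemma kern_FF0: "t \<in> kern \<Longrightarrow> (u', FF 0 t) \<in> P \<Longrightarrow> u' = 0"
proof -
  assume t: "t \<in> kern" and u': "(u', FF 0 t) \<in> P"
  have "foldr EE es (FF 0 t) (replicate a 1) = 0" if es: "set es \<subseteq> I1" for es
  proof -
    have "foldr EE es (FF 0 t) = FF 0 (foldr EE es t)"
      using es by (induction es) (auto simp: comm_affine)
    moreover have "foldr EE es t \<in> kern" using es t by (induction es) (auto intro: kern_closed)
    ultimately show ?thesis using kern_affine(1) by simp
  qed
  then have "FF 0 t \<in> Rad EE (replicate a 1)" by (simp add: Rad_def)
  then have "u' \<in> shadow (Rad EE (replicate a 1))" using u' by (auto simp: shadow_def)
  then show ?thesis by (simp add: Rad_x_trivial)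
qed

text \<open>An arbitrary lift t of u is chosen; \<open>pres_descend\<close> shows that every lift
  gives the same result.\<close>

definition descend :: "((nat list \<Rightarrow> complex) \<Rightarrow> nat list \<Rightarrow> complex) \<Rightarrow> 'v \<Rightarrow> 'v" where
  "descend Y u = (SOME u'. \<exists>t. (u, t) \<in> P \<and> (u', Y t) \<in> P)"

lemma pres_descend:
  assumes Y: "lin sT Y" "\<And>t. t \<in> M a \<Longrightarrow> Y t \<in> M a" "\<And>t u'. t \<in> kern \<Longrightarrow> (u', Y t) \<in> P \<Longrightarrow> u' = 0"
  shows "pres (descend Y) Y"
  unfolding pres_def
proof (intro allI impI)
  fix u t assume ut: "(u, t) \<in> P"
  obtain u' where "(u', Y t) \<in> P" using M_P[OF Y(2)[OF P_M[OF ut]]] by blast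
  then have "\<exists>t. (u, t) \<in> P \<and> (descend Y u, Y t) \<in> P"
    unfolding descend_def by (intro someI[of "\<lambda>u'. \<exists>t. (u, t) \<in> P \<and> (u', Y t) \<in> P" u'] exI[of _ t] conjI ut)
  then obtain t1 where t1: "(u, t1) \<in> P" "(descend Y u, Y t1) \<in> P" by blast
  have "t - t1 \<in> kern" using P_diff[OF ut t1(1)] by (simp add: kern_def)
  moreover obtain w where w: "(w, Y (t - t1)) \<in> P" using M_P[OF Y(2)[OF P_M[OF P_diff[OF ut t1(1)]]]] by blast
  ultimately have "w = 0" using Y(3) by blast
  then have "(descend Y u + 0, Y t1 + Y (t - t1)) \<in> P" using P_add[OF t1(2)] w by blast
  then show "(descend Y u, Y t) \<in> P" by (simp add: lin_diff[OF Y(1)])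
qed

text \<open>All remaining relations reach the given module by this rule: they need only be checked
  for tensors in M.\<close>

lemma transport_eq:
  assumes "pres X Y" "pres X' Y'" "\<And>t. t \<in> M a \<Longrightarrow> Y t = Y' t" shows "X u = X' u"
proof -
  obtain t where t: "(u, t) \<in> P" using P_onto by blast
  have "(X u, Y t) \<in> P" "(X' u, Y t) \<in> P" using assms t P_M[OF t] unfolding pres_def by force+
  then show ?thesis by (rule P_unique)
qed

lemma pres_imp_lin: "pres X Y \<Longrightarrow> lin sT Y \<Longrightarrow> lin sc X"
  unfolding lin_def
proof (intro conjI allI)
  assume X: "pres X Y" and Y: "(\<forall>x y. Y (x + y) = Y x + Y y) \<and> (\<forall>c x. Y (sT c x) = sT c (Y x))"
  fix u v c
  obtain t t' where t: "(u, t) \<in> P" "(v, t') \<in> P" using P_onto by blast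
  have "(X (u + v), Y t + Y t') \<in> P" using X Y P_add[OF t] unfolding pres_def by metis
  moreover have "(X u + X v, Y t + Y t') \<in> P" using X t unfolding pres_def by (intro P_add) auto
  ultimately show "X (u + v) = X u + X v" by (rule P_unique)
  have "(X (sc c u), sT c (Y t)) \<in> P" using X Y P_scale[OF t(1)] unfolding pres_def by metis
  moreover have "(sc c (X u), sT c (Y t)) \<in> P" using X t unfolding pres_def by (intro P_scale) auto
  ultimately show "X (sc c u) = sc c (X u)" by (rule P_unique)
qed


section \<open>The affinization\<close>

definition theta_path :: "nat list" where
  "theta_path = (SOME theta_path. set theta_path \<subseteq> I1 \<and> sum_list (map (sroot m n) theta_path) = theta \<and> (\<forall>x. (\<Sum>j\<leftarrow>theta_path. B j x) = - B 0 x))"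

lemma theta_path: "set theta_path \<subseteq> I1" "sum_list (map (sroot m n) theta_path) = theta" "(\<Sum>j\<leftarrow>theta_path. B j x) = - B 0 x"
proof -
  have *: "set theta_path \<subseteq> I1 \<and> sum_list (map (sroot m n) theta_path) = theta \<and> (\<forall>x. (\<Sum>j\<leftarrow>theta_path. B j x) = - B 0 x)"
    unfolding theta_path_def by (rule someI_ex[OF theta_chain])
  show "set theta_path \<subseteq> I1" by (rule *[THEN conjunct1])
  show "sum_list (map (sroot m n) theta_path) = theta" by (rule *[THEN conjunct2, THEN conjunct1])
  show "(\<Sum>j\<leftarrow>theta_path. B j x) = - B 0 x" by (rule *[THEN conjunct2, THEN conjunct2, THEN spec])
qed

text \<open>E_0 and F_0 descend from tensors, but K_0 is a product of the given inverse K_j along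
  \<theta>. It agrees with the tensor operator by \<open>KK_0\<close>, and in this form its value on
  an arbitrary weight vector of the given module can be read off.\<close>

definition Raff :: "'v gens" where
  "Raff = \<lparr>eop = (\<lambda>i. if i = 0 then descend (EE 0) else eop R i), fop = (\<lambda>i. if i = 0 then descend (FF 0) else fop R i),
     kop = (\<lambda>i. if i = 0 then foldr (kinv R) theta_path else kop R i), kinv = (\<lambda>i. if i = 0 then foldr (kop R) theta_path else kinv R i)\<rparr>"

lemma Raff_simps:
  "i \<noteq> 0 \<Longrightarrow> eop Raff i = eop R i" "i \<noteq> 0 \<Longrightarrow> fop Raff i = fop R i" "i \<noteq> 0 \<Longrightarrow> kop Raff i = kop R i" "i \<noteq> 0 \<Longrightarrow> kinv Raff i = kinv R i"
  "eop Raff 0 = descend (EE 0)" "fop Raff 0 = descend (FF 0)" "kop Raff 0 = foldr (kinv R) theta_path" "kinv Raff 0 = foldr (kop R) theta_path"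
  by (simp_all add: Raff_def)

lemma foldr_K: "foldr KK js t u = p powi (\<Sum>j\<leftarrow>js. wsum (B j) u) * t u" "foldr KI js t u = p powi (- (\<Sum>j\<leftarrow>js. wsum (B j) u)) * t u"
proof -
  have e: "p powi (x + y) = p powi x * p powi y" "p powi (- (x + y)) = p powi (- x) * p powi (- y)" for x y
    using p0 by (simp_all add: power_int_add power_int_diff power_int_minus divide_inverse)
  show "foldr KK js t u = p powi (\<Sum>j\<leftarrow>js. wsum (B j) u) * t u"
    by (induction js) (simp_all add: KK_def e)
  show "foldr KI js t u = p powi (- (\<Sum>j\<leftarrow>js. wsum (B j) u)) * t u"
  proof (induction js)
    case (Cons j js)
    show ?case unfolding foldr_Cons o_apply list.map sum_list.Cons e KI_def[of j] Cons.IH by (simp only: mult.assoc)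
  qed simp
qed

lemma KK_0: "foldr KI theta_path t = KK 0 t" "foldr KK theta_path t = KI 0 t"
proof -
  have "(\<Sum>j\<leftarrow>theta_path. wsum (B j) u) = - wsum (B 0) u" for u
  proof (induction u)
    case Nil
    have "(\<Sum>j\<leftarrow>js. wsum (B j) []) = 0" for js by (induction js) auto
    then show ?case by simp
  next
    case (Cons w u)
    have "(\<Sum>j\<leftarrow>theta_path. wsum (B j) (w # u)) = (\<Sum>j\<leftarrow>theta_path. B j w) + (\<Sum>j\<leftarrow>theta_path. wsum (B j) u)"
      by (simp add: sum_list_addf)
    then show ?case using Cons theta_path(3)[of w] by simp
  qed
  then show "foldr KI theta_path t = KK 0 t" "foldr KK theta_path t = KI 0 t"
    by (simp_all add: foldr_K KK_def KI_def fun_eq_iff)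
qed

lemma pres_foldr: "(\<And>j. j \<in> set js \<Longrightarrow> pres (X j) (Y j)) \<Longrightarrow> pres (foldr X js) (foldr Y js)"
  by (induction js) (simp_all add: pres_def)

lemma pres_Raff:
  assumes "i \<le> s"
  shows "pres (eop Raff i) (EE i)" "pres (fop Raff i) (FF i)" "pres (kop Raff i) (KK i)" "pres (kinv Raff i) (KI i)"
proof -
  have "pres (eop Raff i) (EE i) \<and> pres (fop Raff i) (FF i) \<and> pres (kop Raff i) (KK i) \<and> pres (kinv Raff i) (KI i)"
  proof (cases "i = 0")
    case False
    then have "i \<in> I1" using assms by auto
    then show ?thesis using False pres_EF pres_K by (simp add: Raff_simps)
  next
    case True
    have "pres (descend (EE 0)) (EE 0)" by (rule pres_descend[OF lin_ops(1)]) (auto intro: M_closed kern_EE0)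
    moreover have "pres (descend (FF 0)) (FF 0)" by (rule pres_descend[OF lin_ops(2)]) (auto intro: M_closed kern_FF0)
    moreover have "pres (foldr (kinv R) theta_path) (foldr KI theta_path)" "pres (foldr (kop R) theta_path) (foldr KK theta_path)"
      using theta_path(1) pres_K by (auto intro!: pres_foldr)
    ultimately show ?thesis by (simp add: True Raff_simps KK_0 pres_def)
  qed
  then show "pres (eop Raff i) (EE i)" "pres (fop Raff i) (FF i)" "pres (kop Raff i) (KK i)" "pres (kinv Raff i) (KI i)" by auto
qed

lemma pres_qcomm:
  assumes "pres A A'" "pres C C'" shows "pres (qcomm sc x y z A C) (qcomm sT x y z A' C')"
  unfolding qcomm_def by (rule pres_lin(5)[OF pres_comp[OF assms] pres_lin(3)[OF pres_comp[OF assms(2,1)]]])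

lemma pres_qad:
  assumes "pres A A'" "pres C C'"
  shows "pres (qad_pow sc x y z c A C k) (qad_pow sT x y z c A' C' k)"
proof (induction k)
  case (Suc k)
  show ?case unfolding qad_pow.simps by (rule pres_qcomm[OF assms(1) Suc])
qed (simp add: assms)

lemma Raff_graded:
  assumes i: "i \<le> s"
  shows "graded_op sc G (par i) (eop Raff i)" "graded_op sc G (par i) (fop Raff i)" "graded_op sc G 0 (kop Raff i)" "graded_op sc G 0 (kinv Raff i)"
proof -
  \<comment> \<open>Commutation with \<open>parity_op\<close> is transported from commutation with
    \<open>ParT\<close>; the sign depending on d0 occurs on both sides.\<close>
  have gr: "graded_op sc G d X" if "pres X Y" "lin sT Y" "\<And>t. Par (Y t) = sT (parity_sign d) (Y (Par t))" for X Y d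
    unfolding graded_op_iff
  proof (intro conjI allI)
    show "lin sc X" by (rule pres_imp_lin[OF that(1,2)])
    fix u
    show "parity_op G (X u) = sc (parity_sign d) (X (parity_op G u))"
      by (rule transport_eq[OF pres_comp[OF pres_parity that(1)] pres_lin(3)[OF pres_comp[OF that(1) pres_parity]]])
        (simp add: ParT_def that(3) lin_scale[OF that(2)] sT_sT mult.commute)
  qed
  show "graded_op sc G (par i) (eop Raff i)"
    by (rule gr[OF pres_Raff(1)[OF i] lin_ops(1)]) (simp add: PP_ops(1)[OF i] sT_sign_cancel)
  show "graded_op sc G (par i) (fop Raff i)"
    by (rule gr[OF pres_Raff(2)[OF i] lin_ops(2)]) (simp add: PP_ops(2)[OF i] sT_sign_cancel)
  show "graded_op sc G 0 (kop Raff i)"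
    by (rule gr[OF pres_Raff(3)[OF i] lin_ops(3)]) (simp add: PP_ops(3)[OF i])
  show "graded_op sc G 0 (kinv Raff i)"
    by (rule gr[OF pres_Raff(4)[OF i] lin_ops(4)]) (simp add: PP_ops(4)[OF i])
qed

lemma Raff_K:
  assumes ij: "i \<le> s" "j \<le> s"
  shows "kop Raff i (kinv Raff i v) = v" "kinv Raff i (kop Raff i v) = v" "kop Raff i (kop Raff j v) = kop Raff j (kop Raff i v)"
    "kop Raff i (eop Raff j v) = sc (p powi rform i j) (eop Raff j (kop Raff i v))"
    "kop Raff i (fop Raff j v) = sc (p powi (- rform i j)) (fop Raff j (kop Raff i v))"
proof -
  note Pi = pres_Raff[OF ij(1)] and Pj = pres_Raff[OF ij(2)]
  show "kop Raff i (kinv Raff i v) = v" by (rule transport_eq[OF pres_comp[OF Pi(3,4)] pres_lin(1)]) (rule KK_KI)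
  show "kinv Raff i (kop Raff i v) = v" by (rule transport_eq[OF pres_comp[OF Pi(4,3)] pres_lin(1)]) (rule KK_KI)
  show "kop Raff i (kop Raff j v) = kop Raff j (kop Raff i v)" by (rule transport_eq[OF pres_comp[OF Pi(3) Pj(3)] pres_comp[OF Pj(3) Pi(3)]]) (rule K_comm)
  show "kop Raff i (eop Raff j v) = sc (p powi rform i j) (eop Raff j (kop Raff i v))"
    by (rule transport_eq[OF pres_comp[OF Pi(3) Pj(1)] pres_lin(3)[OF pres_comp[OF Pj(1) Pi(3)]]]) (rule K_EF[OF ij(2)])
  show "kop Raff i (fop Raff j v) = sc (p powi (- rform i j)) (fop Raff j (kop Raff i v))"
    by (rule transport_eq[OF pres_comp[OF Pi(3) Pj(2)] pres_lin(3)[OF pres_comp[OF Pj(2) Pi(3)]]]) (rule K_EF[OF ij(2)])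
qed

lemma Raff_commutator:
  assumes ij: "i \<le> s" "j \<le> s"
  shows "qcomm sc (par i) (par j) 1 (eop Raff i) (fop Raff j) v = (if i = j then sc dq (kop Raff i (kop Raff i v) - kinv Raff i (kinv Raff i v)) else 0)"
proof -
  note Pi = pres_Raff[OF ij(1)] and Pj = pres_Raff[OF ij(2)]
  have 1: "pres (qcomm sc (par i) (par j) 1 (eop Raff i) (fop Raff j)) (qcomm sT (par i) (par j) 1 (EE i) (FF j))"
    by (rule pres_qcomm[OF Pi(1) Pj(2)])
  have 2: "pres (\<lambda>v. if i = j then sc dq (kop Raff i (kop Raff i v) - kinv Raff i (kinv Raff i v)) else 0)
      (\<lambda>t. if i = j then sT dq (KK i (KK i t) - KI i (KI i t)) else 0)"
    using pres_lin(3)[OF pres_lin(5)[OF pres_comp[OF Pi(3) Pi(3)] pres_comp[OF Pi(4) Pi(4)]], of dq] pres_lin(2) by (cases "i = j") simp_all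
  show ?thesis
    by (rule transport_eq[OF 1 2]) (simp add: qcomm_def EE_FF[OF ij])
qed

lemma osp_serre:
  assumes ij: "i \<in> I1" "j \<in> I1" and X: "X = eop R \<or> X = fop R"
  shows "i \<noteq> j \<Longrightarrow> rform i i \<noteq> 0 \<Longrightarrow> qad_pow sc (par i) (par j) (p powi rform i i) (cartan m n i j) (X i) (X j) (nat (1 - cartan m n i j)) v = 0"
    "par i = 1 \<Longrightarrow> rform i i = 0 \<Longrightarrow> X i (X i v) = 0"
    "par i = 1 \<Longrightarrow> rform i i = 0 \<Longrightarrow> rform i j = 0 \<Longrightarrow> qcomm sc (par i) (par j) 1 (X i) (X j) v = 0"
proof -
  have i: "i \<in> osp_index m n" "i \<le> s" and j: "j \<in> osp_index m n" "j \<le> s" using ij by (auto simp: osp_index_I1)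
  have XX: "X \<in> {eop R, fop R}" using X by auto
  note U = rep[unfolded Uq_rep_def]
  note U67 = U[THEN conjunct2, THEN conjunct2, THEN conjunct2, THEN conjunct2, THEN conjunct2, THEN conjunct2]
  note U6 = bspec[OF bspec[OF bspec[OF U67[THEN conjunct1] i(1)] j(1)] XX, unfolded par_eq[OF i(2), symmetric] par_eq[OF j(2), symmetric] rform_eq[OF i(2) i(2)]]
  note U7 = bspec[OF bspec[OF U67[THEN conjunct2] i(1)] XX, unfolded par_eq[OF i(2), symmetric] rform_eq[OF i(2) i(2)]]
  show "qad_pow sc (par i) (par j) (p powi rform i i) (cartan m n i j) (X i) (X j) (nat (1 - cartan m n i j)) v = 0"
    if "i \<noteq> j" "rform i i \<noteq> 0" using U6 that by blast
  show "X i (X i v) = 0" if "par i = 1" "rform i i = 0" using U7 that by blast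
  show "qcomm sc (par i) (par j) 1 (X i) (X j) v = 0" if "par i = 1" "rform i i = 0" "rform i j = 0"
    using U7 that(1,2) bspec[OF _ j(1)] that(3) unfolding par_eq[OF j(2), symmetric] rform_eq[OF i(2) j(2)]
    by (metis (no_types, lifting) j(1) j(2) par_eq rform_eq i(2))
qed

lemma cartan_eq: "i \<le> s \<Longrightarrow> j \<le> s \<Longrightarrow> cartan m n i j = 2 * rform i j div rform i i"
  by (simp add: cartan_def rform_eq)

lemma Raff_serre:
  assumes ij: "i \<le> s" "j \<le> s" "i \<noteq> j" "rform i i \<noteq> 0" and X: "X = eop Raff \<or> X = fop Raff"
  shows "qad_pow sc (par i) (par j) (p powi rform i i) (cartan m n i j) (X i) (X j) (nat (1 - cartan m n i j)) v = 0"
proof (cases "i = 0 \<or> j = 0")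
  case True
  note Pi = pres_Raff[OF ij(1)] and Pj = pres_Raff[OF ij(2)]
  note S = serre_affine[OF ij(1-3) True ij(4)]
  show ?thesis using X unfolding cartan_eq[OF ij(1,2)]
  proof (elim disjE)
    assume X: "X = eop Raff"
    show "qad_pow sc (par i) (par j) (p powi rform i i) (2 * rform i j div rform i i) (X i) (X j) (nat (1 - 2 * rform i j div rform i i)) v = 0"
      unfolding X by (rule transport_eq[OF pres_qad[OF Pi(1) Pj(1)] pres_lin(2)]) (rule S(1))
  next
    assume X: "X = fop Raff"
    show "qad_pow sc (par i) (par j) (p powi rform i i) (2 * rform i j div rform i i) (X i) (X j) (nat (1 - 2 * rform i j div rform i i)) v = 0"
      unfolding X by (rule transport_eq[OF pres_qad[OF Pi(2) Pj(2)] pres_lin(2)]) (rule S(2))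
  qed
next
  case False
  then have "i \<in> I1" "j \<in> I1" "i \<noteq> 0" "j \<noteq> 0" using ij by auto
  moreover from this have "X i = (if X = eop Raff then eop R else fop R) i" "X j = (if X = eop Raff then eop R else fop R) j"
    using X by (auto simp: Raff_simps)
  ultimately show ?thesis using osp_serre(1)[of i j "if X = eop Raff then eop R else fop R"] ij by auto
qed

lemma Raff_isotropic:
  assumes ij: "i \<le> s" "j \<le> s" "par i = 1" "rform i i = 0" and X: "X = eop Raff \<or> X = fop Raff"
  shows "X i (X i v) = 0" "rform i j = 0 \<Longrightarrow> qcomm sc (par i) (par j) 1 (X i) (X j) v = 0"
proof -
  define X0 where "X0 = (if X = eop Raff then eop R else fop R)"
  have X0: "X0 = eop R \<or> X0 = fop R" "X k = X0 k" if "k \<noteq> 0" for k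
    using X that by (auto simp: X0_def Raff_simps)
  have i0: "i \<noteq> 0" using ij(3) end_values(32) by (metis zero_neq_one)
  then have i: "i \<in> I1" using ij by auto
  show "X i (X i v) = 0" using osp_serre(2)[OF i i X0(1)[OF i0] ij(3,4)] X0(2)[OF i0] by simp
  show "qcomm sc (par i) (par j) 1 (X i) (X j) v = 0" if r: "rform i j = 0"
  proof (cases "j = 0")
    case False
    then have "j \<in> I1" using ij by auto
    then show ?thesis using osp_serre(3)[OF i _ X0(1)[OF i0] ij(3,4) r] X0(2)[OF i0] X0(2)[OF False] by simp
  next
    case True
    \<comment> \<open>Node 0 is not isotropic, so its Serre relation with Cartan entry 0 already
      says that the two generators commute; node 0 being even, no sign intervenes.\<close>
    have "0 \<le> s" "rform 0 i = 0" "par 0 = 0" "rform 0 0 \<noteq> 0" using r rform_sym[of i 0] ij True end_values by auto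
    then have "X 0 (X i v) = X i (X 0 v)"
      using Raff_serre[OF _ ij(1) i0[symmetric] _ X, of v] cartan_eq[of 0 i] ij(1) by (simp add: qcomm_def)
    then show ?thesis by (simp add: True qcomm_def end_values)
  qed
qed

lemma aff_index_eq: "aff_index m n = {0..s}"
  by (simp add: aff_index_def s_def)

lemma Raff_rep: "Uq_gl2_rep m n p sc G Raff"
  unfolding Uq_rep_def aff_index_eq
proof (intro conjI ballI allI impI)
  show "z2_graded sc G" by (rule graded)
  fix i assume "i \<in> {0..s}"
  then have i: "i \<le> s" by simp
  show "graded_op sc G (sroot_parity m n i) (eop Raff i)" "graded_op sc G (sroot_parity m n i) (fop Raff i)"
    "graded_op sc G 0 (kop Raff i)" "graded_op sc G 0 (kinv Raff i)"
    using Raff_graded[OF i] par_eq[OF i] by auto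
  show "kop Raff i (kinv Raff i v) = v" "kinv Raff i (kop Raff i v) = v" for v using Raff_K(1,2)[OF i i] by auto
  show "X i (X i v) = 0" if "X \<in> {eop Raff, fop Raff}" "sroot_parity m n i = 1 \<and> rootip m n i i = 0" for X v
    using Raff_isotropic(1)[OF i i, of X] that par_eq[OF i] rform_eq[OF i i] by auto
  fix j assume "j \<in> {0..s}"
  then have j: "j \<le> s" by simp
  show "kop Raff i (kop Raff j v) = kop Raff j (kop Raff i v)" for v by (rule Raff_K(3)[OF i j])
  show "kop Raff i (eop Raff j v) = sc (p powi rootip m n i j) (eop Raff j (kop Raff i v))"
    "kop Raff i (fop Raff j v) = sc (p powi (- rootip m n i j)) (fop Raff j (kop Raff i v))" for v
    using Raff_K(4,5)[OF i j] rform_eq[OF i j] by auto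
  show "qcomm sc (sroot_parity m n i) (sroot_parity m n j) 1 (eop Raff i) (fop Raff j) v =
     (if i = j then sc (1 / (p\<^sup>2 - 1 / p\<^sup>2)) (kop Raff i (kop Raff i v) - kinv Raff i (kinv Raff i v)) else 0)" for v
    using Raff_commutator[OF i j, of v] unfolding par_eq[OF i] par_eq[OF j] .
  show "qad_pow sc (sroot_parity m n i) (sroot_parity m n j) (p powi rootip m n i i) (cartan m n i j) (X i) (X j) (nat (1 - cartan m n i j)) v = 0"
    if "X \<in> {eop Raff, fop Raff}" "i \<noteq> j \<and> rootip m n i i \<noteq> 0" for X v
    using Raff_serre[OF i j, of X v] that unfolding par_eq[OF i] par_eq[OF j] rform_eq[OF i i] by auto
  show "qcomm sc (sroot_parity m n i) (sroot_parity m n j) 1 (X i) (X j) v = 0"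
    if "X \<in> {eop Raff, fop Raff}" "sroot_parity m n i = 1 \<and> rootip m n i i = 0" "rootip m n i j = 0" for X v
    using Raff_isotropic(2)[OF i j, of X v] that unfolding par_eq[OF i] par_eq[OF j] rform_eq[OF i i] rform_eq[OF i j] by auto
qed

lemma Raff_weight:
  assumes "has_weight m n p sc R \<nu> v" shows "kop Raff 0 v = sc (p powi (- ip m n theta \<nu>)) v"
proof -
  have kv: "kinv R i v = sc (p powi (- ip m n (sroot m n i) \<nu>)) v" if i: "i \<in> I1" for i
  proof -
    have "kop R i v = sc (p powi ip m n (sroot m n i) \<nu>) v" using assms i by (simp add: has_weight_def osp_index_I1)
    then have "v = sc (p powi ip m n (sroot m n i) \<nu>) (kinv R i v)" using relations(6)[OF i, of v] lin_scale[OF lin_R(4)[OF i]] by metis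
    then have "sc (p powi (- ip m n (sroot m n i) \<nu>)) v = sc (p powi (- ip m n (sroot m n i) \<nu>) * p powi ip m n (sroot m n i) \<nu>) (kinv R i v)"
      by (metis scale_scale)
    then show ?thesis using p0 by (simp add: power_int_minus)
  qed
  have "foldr (kinv R) js v = sc (p powi (- ip m n (sum_list (map (sroot m n) js)) \<nu>)) v" if "set js \<subseteq> I1" for js
    using that
  proof (induction js)
    case Nil
    show ?case by (simp add: ip_zero)
  next
    case (Cons j js)
    then have j: "j \<in> I1" by simp
    show ?case using Cons kv[OF j] p0
      by (simp add: lin_scale[OF lin_R(4)[OF j]] ip_add_left power_int_diff power_int_minus divide_inverse mult.commute)
  qed
  from this[OF theta_path(1)] show ?thesis by (simp add: Raff_simps theta_path(2))
qed

lemma affinization_Raff: "affinization m n p sc G R Raff"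
  unfolding affinization_def
  using Raff_rep Raff_weight by (auto simp: Raff_simps osp_index_I1)

lemma irreducible_Raff: "irreducible_rep (aff_index m n) sc G Raff"
proof -
  have "submodule (osp_index m n) sc G R W" if "submodule (aff_index m n) sc G Raff W" for W
  proof -
    have ops: "eop R i v \<in> W \<and> fop R i v \<in> W \<and> kop R i v \<in> W \<and> kinv R i v \<in> W" if i: "i \<in> I1" and v: "v \<in> W" for i v
    proof -
      have "i \<in> {0..s}" "i \<noteq> 0" using i by auto
      then show ?thesis using \<open>submodule (aff_index m n) sc G Raff W\<close> v unfolding submodule_def aff_index_eq
        by (metis Raff_simps(1-4))
    qed
    then show ?thesis using that unfolding submodule_def osp_index_I1 by blast
  qed
  then show ?thesis using irred unfolding irreducible_rep_def by blast
qed

end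

theorem mainTheorem1:
  fixes m n a :: nat
    and q p :: complex
    and sc :: "complex \<Rightarrow> 'v::ab_group_add \<Rightarrow> 'v"
    and G :: "bit \<Rightarrow> 'v set"
    and R :: "'v gens"
  assumes "m \<ge> 1" and "even n" and "n > 2" and "m \<le> n"
    and "q \<noteq> 0" and "\<forall>k>0. q ^ k \<noteq> 1" and "p\<^sup>2 = q"
    and "a \<ge> 1"
    and "is_V m n p (lam a) sc G R"
  shows "affinizable m n p sc G R \<and>
         (\<exists>S. affinization m n p sc G R S \<and> irreducible_rep (aff_index m n) sc G S)"
proof -
  have "p ^ k \<noteq> 1" if "k > 0" for k
  proof
    assume "p ^ k = 1"
    then have "q ^ k = 1" using assms(7) by (metis power_mult power_mult_distrib mult.commute power_one)
    then show False using assms(6) that by blast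
  qed
  moreover have "p \<noteq> 0" using assms(5,7) by auto
  ultimately have "osp m n p" using assms(1-3) by unfold_locales
  then interpret osp_module m n p a sc G R
    using assms(8,9) by (simp add: osp_module_def osp_module_axioms_def)
  obtain v0 d0 where "v0 \<noteq> 0" "v0 \<in> G d0" "\<And>i. i \<in> {1..s} \<Longrightarrow> kop R i v0 = sc (p powi (int a * B i 1)) v0"
    "\<And>i. i \<in> {1..s} \<Longrightarrow> eop R i v0 = 0"
    using highest_vector by blast
  then interpret osp_highest m n p a sc G R v0 d0 by unfold_locales
  show ?thesis using affinization_Raff irreducible_Raff unfolding affinizable_def by blast
qed

end
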